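(* Let $\ell\in\{1,2,3,4,5,6\}$. Then for all integers $k\ge0$ and $n\ge0$, $$\overline{\mathrm{spt}}_\omega\left(5^{2k+\ell-1}(10n+5)\right)\equiv \overline{\mathrm{spt}}_\omega\left(5^{\ell-1}(10n+5)\right)\pmod{5^{\ell}}.$$ Furthermore, for all integers $n\ge 0$, $$\overline{\mathrm{spt}}_\omega\left(5^{2}(10n+3)\right)\equiv \overline{\mathrm{spt}}_\omega\left(5^{2}(10n+7)\right)\equiv0\pmod{5^2},$$ $$\overline{\mathrm{spt}}_\omega\left(5^{4}(10n+3)\right)\equiv \overline{\mathrm{spt}}_\omega\left(5^{4}(10n+7)\right)\equiv0\pmod{5^4},$$ $$\overline{\mathrm{spt}}_\omega\left(5^{6}(10n+3)\right)\equiv \overline{\mathrm{spt}}_\omega\left(5^{6}(10n+7)\right)\equiv0\pmod{5^6}.$$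
   Context: An overpartition of $n$ is a partition of $n$ (into positive parts) in which the first occurrence of each distinct part size may or may not be overlined. $\overline{\mathrm{spt}}_\omega(n)$ denotes the total number of appearances of the smallest part (counted with multiplicity, overlined and non-overlined copies together), summed over all overpartitions of $n$ in which the smallest part is always overlined (i.e. its first occurrence is overlined) and all odd parts are less than twice the smallest part. For example, $\overline{\mathrm{spt}}_\omega(1)=1$ and $\overline{\mathrm{spt}}_\omega(3)=6$. *)

theory Defs
  imports "HOL-Library.Multiset" "HOL-Number_Theory.Cong"
begin

text \<open>
  An overpartition of \<open>n\<close> is encoded as a pair \<open>(P, S)\<close>: \<open>P\<close> is the multiset of all
  parts, overlined or not, and \<open>S\<close> is the set of those part sizes whose first occurrence
  is overlined.
\<close>

definition overpartitions :: "nat \<Rightarrow> (nat multiset \<times> nat set) set" where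
  "overpartitions n =
     {(P, S). (\<forall>p\<in>#P. 0 < p) \<and> sum_mset P = n \<and> S \<subseteq> set_mset P}"

abbreviation smallest_part :: "nat multiset \<Rightarrow> nat" where
  "smallest_part P \<equiv> Min (set_mset P)"

text \<open>
  The condition \<open>P \<noteq> {#}\<close> only matters for \<open>n = 0\<close>: the empty overpartition has no
  smallest part.
\<close>

definition omega_overpartitions :: "nat \<Rightarrow> (nat multiset \<times> nat set) set" where
  "omega_overpartitions n =
     {(P, S) \<in> overpartitions n. P \<noteq> {#} \<and> smallest_part P \<in> S \<and>
        (\<forall>p\<in>#P. odd p \<longrightarrow> p < 2 * smallest_part P)}"

definition spt_omega :: "nat \<Rightarrow> nat" where
  "spt_omega n = (\<Sum>(P, S)\<in>omega_overpartitions n. count P (smallest_part P))"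

lemma finite_overpartitions: "finite (overpartitions n)"
proof -
  have "overpartitions n \<subseteq> mset ` {xs. set xs \<subseteq> {..n} \<and> length xs \<le> n} \<times> Pow {..n}"
  proof (rule subrelI, intro SigmaI)
    fix P S assume "(P, S) \<in> overpartitions n"
    hence pos: "\<forall>p\<in>#P. 0 < p" and sum: "sum_mset P = n" and S: "S \<subseteq> set_mset P"
      by (auto simp: overpartitions_def)
    have le: "set_mset P \<subseteq> {..n}"
      using sum by (auto dest!: multi_member_split)
    have "size P \<le> sum_mset P"
      using pos by (induction P) auto
    moreover obtain xs where "mset xs = P" using ex_mset by blast
    ultimately show "P \<in> mset ` {xs. set xs \<subseteq> {..n} \<and> length xs \<le> n}"
      using le sum by (auto simp flip: size_mset intro!: image_eqI[of _ _ xs])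
    show "S \<in> Pow {..n}" using S le by auto
  qed
  thus ?thesis
    by (rule finite_subset) (auto intro: finite_lists_length_le)
qed

lemma finite_omega_overpartitions: "finite (omega_overpartitions n)"
  by (rule finite_subset[OF _ finite_overpartitions[of n]]) (auto simp: omega_overpartitions_def)

end

theory Submission
  imports Defs Complex_Main "HOL-Computational_Algebra.Formal_Power_Series"
begin

text \<open>
  Write \<open>phim\<close> for the theta function \<open>\<Sum> (-1)^j q^(j^2)\<close> and \<open>psi\<close> for \<open>\<Sum> q^(2 j^2 - j)\<close>, both over all
  integers \<open>j\<close>. Expanding \<open>(-q; q\<^sup>2)\<^sub>m\<close> by the finite Jacobi triple product, the sum over the
  smallest part \<open>m\<close> telescopes, and \<open>phim\<close> times the generating function of \<open>spt_omega (2 n + 1)\<close>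
  becomes the generating function of the divisor sums of \<open>2 n + 1\<close>, which is \<open>psi\<^sup>4\<close> by
  Legendre's theorem on four triangular numbers.

  Put \<open>x = (phim (q\<^sup>5) / phim q)\<^sup>2\<close>. The quotient \<open>S = phim q / phim (q^25)\<close> is a root of an
  explicit quintic polynomial over the series in \<open>q\<^sup>5\<close>, so the extraction of the coefficients
  \<open>5 n + 2\<close> takes \<open>psi\<^sup>4 / phim q\<close> times a polynomial in \<open>x\<close> to \<open>psi\<^sup>4 / phim (q\<^sup>5)\<close> times
  such a polynomial, up to a factor \<open>(1 - 5 x)\<^sup>2\<close> in the denominator, and conversely. Modulo
  \<open>5\<^sup>6\<close> all these are integer polynomials of degree at most 6, so it is a finite computation that
  the iterates \<open>l\<close> and \<open>l + 2\<close> agree modulo \<open>5\<^sup>l\<close>; applying the extraction further preserves this.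
\<close>

unbundle fps_syntax

text \<open>Only odd arguments occur: 5^(2k+l-1) (10n+5) is 5^(2k+l) (2n+1), and as 2 (5n+2) + 1 = 5
  (2n+1), multiplying the argument by 5 is the extraction of the exponents 5n+2 from
  \<open>oddspt\<close>. Likewise 10n+3 and 10n+7 belong to the classes 1 and 3 modulo 5. The
  extraction moves the denominator back and forth between phim(q) and phim(q^5), so only iterates of
  equal parity are comparable; hence the step by 2. The quintic for S comes from the norm of phim
  down to series in q^5, a product over fifth roots of unity. The coefficients are therefore
  complex, and integrality is treated separately by \<open>divis\<close>. Of the two parts of S in
  the classes 1 and 4 only symmetric functions are polynomials in S and v. That suffices for the
  class 2, whereas the classes 1 and 3 involve the parts themselves and need a linear system. The
  factor (1 - 5x)^2 arises from solving the recurrences for the extractions of psi^2 S^k and psi^4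
  S^k; modulo 5^6 its inverse is a polynomial of degree 5.\<close>

abbreviation X :: "complex fps" where "X \<equiv> fps_X"

subsection \<open>Truncated congruence and infinite products of power series\<close>

definition fcong :: "nat \<Rightarrow> 'a::comm_ring_1 fps \<Rightarrow> 'a fps \<Rightarrow> bool" where
  "fcong n f g \<longleftrightarrow> (\<forall>i<n. f $ i = g $ i)"

lemma fcong_refl [simp, intro]: "fcong n f f"
  and fcong_sym: "fcong n f g \<Longrightarrow> fcong n g f"
  and fcong_trans [trans]: "fcong n f g \<Longrightarrow> fcong n g h \<Longrightarrow> fcong n f h"
  and fcong_mono: "fcong n f g \<Longrightarrow> m \<le> n \<Longrightarrow> fcong m f g"
  and fcong_diff: "fcong n f g \<Longrightarrow> fcong n f' g' \<Longrightarrow> fcong n (f - f') (g - g')"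
  and fcong_nth: "fcong n f g \<Longrightarrow> i < n \<Longrightarrow> f $ i = g $ i"
  by (auto simp: fcong_def)

lemma fcong_eqI: "(\<And>n. fcong (Suc n) f g) \<Longrightarrow> f = g"
  by (auto simp: fcong_def fps_eq_iff)

lemma fcong_mult: "fcong n f g \<Longrightarrow> fcong n f' g' \<Longrightarrow> fcong n (f * f') (g * g')"
  by (auto simp: fcong_def fps_mult_nth intro!: sum.cong)

lemma fcong_power: "fcong n f g \<Longrightarrow> fcong n (f ^ k) (g ^ k)"
  by (induction k) (auto intro: fcong_mult)

lemma fcong_sum: "(\<And>i. i \<in> A \<Longrightarrow> fcong n (f i) (g i)) \<Longrightarrow> fcong n (sum f A) (sum g A)"
  by (auto simp: fcong_def fps_sum_nth intro!: sum.cong)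

lemma fcong_prod: "(\<And>i. i \<in> A \<Longrightarrow> fcong n (f i) (g i)) \<Longrightarrow> fcong n (prod f A) (prod g A)"
  by (induction A rule: infinite_finite_induct) (auto intro: fcong_mult)

lemma fcong_compose: "fcong n f g \<Longrightarrow> fcong n (f oo h) (g oo h)"
  by (auto simp: fcong_def fps_compose_nth intro!: sum.cong)

lemma fcong_inverse:
  fixes f g :: "'a::field fps"
  assumes "fcong n f g" "f $ 0 \<noteq> 0" "g $ 0 \<noteq> 0"
  shows "fcong n (inverse f) (inverse g)"
proof -
  have "fcong n (inverse f * inverse g * g) (inverse f * inverse g * f)"
    by (intro fcong_mult fcong_refl fcong_sym[OF assms(1)])
  also have "inverse f * inverse g * f = inverse g"
    using assms inverse_mult_eq_1[of f] by (simp add: mult_ac)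
  also have "inverse f * inverse g * g = inverse f"
    using assms inverse_mult_eq_1[of g] by (simp add: mult.assoc)
  finally show ?thesis .
qed

lemma fcong_shift: "fcong n f g \<Longrightarrow> fcong (m + n) (fps_X ^ m * f) (fps_X ^ m * g)"
  by (auto simp: fcong_def fps_X_power_mult_nth)

text \<open>Every coefficient is read off a finite partial product. Under \<open>convp\<close>,
  where factor l is 1 up to exponent l, later factors cannot change it, so no topology is
  involved.\<close>

definition iprod :: "(nat \<Rightarrow> 'a::comm_ring_1 fps) \<Rightarrow> 'a fps" where
  "iprod f = Abs_fps (\<lambda>n. (\<Prod>l<Suc n. f l) $ n)"

definition convp :: "(nat \<Rightarrow> 'a::comm_ring_1 fps) \<Rightarrow> bool" where
  "convp f \<longleftrightarrow> (\<forall>l. fcong (Suc l) (f l) 1)"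

lemma convp_prod:
  assumes "convp f" "n \<le> m"
  shows "fcong (Suc n) (\<Prod>l<m. f l) (\<Prod>l<n. f l)"
  using assms(2)
proof (induction m rule: dec_induct)
  case (step m)
  have "fcong (Suc n) (f m) 1"
    using assms(1) step.hyps by (auto simp: convp_def intro: fcong_mono)
  from fcong_mult[OF step.IH this] show ?case by simp
qed auto

lemma convp_prod':
  assumes "convp f" "n \<le> m"
  shows "fcong n (\<Prod>l<m. f l) (\<Prod>l<n. f l)"
  using convp_prod[OF assms] by (rule fcong_mono) auto

lemma iprod_fcong:
  assumes "convp f" "n \<le> m"
  shows "fcong n (\<Prod>l<m. f l) (iprod f)"
  unfolding fcong_def
proof safe
  fix i assume i: "i < n"
  have "fcong (Suc i) (\<Prod>l<m. f l) (\<Prod>l<Suc i. f l)"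
    using convp_prod'[OF assms(1), of "Suc i" m] i assms(2) by auto
  thus "(\<Prod>l<m. f l) $ i = iprod f $ i"
    by (auto simp: fcong_def iprod_def simp del: prod.lessThan_Suc)
qed

text \<open>Arbitrarily long partial products suffice, which is exactly what regrouping of factors
  provides.\<close>

lemma iprod_eqI:
  assumes "convp f" "\<And>n. \<exists>m\<ge>n. fcong n (\<Prod>l<m. f l) g"
  shows "iprod f = g"
proof (rule fcong_eqI)
  fix n
  obtain m where m: "m \<ge> Suc n" "fcong (Suc n) (\<Prod>l<m. f l) g" using assms(2) by blast
  show "fcong (Suc n) (iprod f) g"
    using fcong_trans[OF fcong_sym[OF iprod_fcong[OF assms(1) m(1)]] m(2)] .
qed

lemma convp_mult: "convp f \<Longrightarrow> convp g \<Longrightarrow> convp (\<lambda>l. f l * g l)"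
  unfolding convp_def using fcong_mult[of _ _ 1 _ 1] by fastforce

lemma convp_power: "convp f \<Longrightarrow> convp (\<lambda>l. f l ^ k)"
  unfolding convp_def using fcong_power[of _ _ 1 k] by fastforce

lemma iprod_mult:
  assumes "convp f" "convp g"
  shows "iprod (\<lambda>l. f l * g l) = iprod f * iprod g"
proof (rule iprod_eqI[OF convp_mult[OF assms]])
  fix n
  show "\<exists>m\<ge>n. fcong n (\<Prod>l<m. f l * g l) (iprod f * iprod g)"
    by (rule exI[of _ n]) (auto simp: prod.distrib intro!: fcong_mult iprod_fcong assms)
qed

lemma iprod_power:
  assumes "convp f"
  shows "iprod (\<lambda>l. f l ^ k) = iprod f ^ k"
proof (rule iprod_eqI[OF convp_power[OF assms]])
  fix n
  show "\<exists>m\<ge>n. fcong n (\<Prod>l<m. f l ^ k) (iprod f ^ k)"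
    by (rule exI[of _ n]) (auto simp: prod_power_distrib[symmetric] intro!: fcong_power iprod_fcong assms)
qed

lemma prod_block: "(\<Prod>l<n. \<Prod>r<m. f (m * l + r)) = (\<Prod>l<n * m. f (l::nat) :: 'a::comm_monoid_mult)"
  using prod.nat_group[of f m n] by (simp add: prod.atLeast0_lessThan_Suc atLeast0LessThan
     prod.shift_bounds_nat_ivl[of _ 0 _ m, simplified] mult.commute add.commute
     flip: prod.atLeastLessThan_shift_0)

lemma convp_block:
  assumes "convp f" "m > 0"
  shows "convp (\<lambda>l. \<Prod>r<m. f (m * l + r))"
  unfolding convp_def
proof
  fix l
  have "fcong (Suc l) (\<Prod>r<m. f (m * l + r)) (\<Prod>r<m. 1)"
  proof (rule fcong_prod)
    fix r
    have "l \<le> m * l" using assms(2) by simp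
    thus "fcong (Suc l) (f (m * l + r)) 1"
      using assms(1) unfolding convp_def by (meson Suc_le_mono fcong_mono le_add1 le_trans)
  qed
  thus "fcong (Suc l) (\<Prod>r<m. f (m * l + r)) 1" by simp
qed

lemma iprod_block:
  assumes "convp f" "m > 0"
  shows "iprod (\<lambda>l. \<Prod>r<m. f (m * l + r)) = iprod f"
proof (rule iprod_eqI[OF convp_block[OF assms]])
  fix n
  have "n \<le> n * m" using assms(2) by simp
  thus "\<exists>k\<ge>n. fcong n (\<Prod>l<k. \<Prod>r<m. f (m * l + r)) (iprod f)"
    by (intro exI[of _ n]) (auto simp: prod_block intro!: iprod_fcong assms)
qed

lemma iprod_nth_0: "convp f \<Longrightarrow> iprod f $ 0 = 1"
  by (auto simp: iprod_def convp_def fcong_def)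

lemma iprod_compose:
  fixes f :: "nat \<Rightarrow> 'a::idom fps"
  assumes "convp f" "h $ 0 = 0"
  shows "iprod (\<lambda>l. f l oo h) = iprod f oo h"
proof (rule iprod_eqI)
  show "convp (\<lambda>l. f l oo h)"
    unfolding convp_def using assms fcong_compose[of _ _ 1 h] by (auto simp: convp_def)
  fix n
  show "\<exists>m\<ge>n. fcong n (\<Prod>l<m. f l oo h) (iprod f oo h)"
    using fcong_compose[OF iprod_fcong[OF assms(1) order_refl], of n h]
    by (intro exI[of _ n]) (auto simp: fps_compose_prod_distrib[OF assms(2)])
qed

lemma less_mult_Suc: "m > 0 \<Longrightarrow> l < m * Suc (l::nat)"
  by (induction m) auto

lemma convp_add_X: "(\<And>l. l < e l) \<Longrightarrow> convp (\<lambda>l. 1 + fps_const (c l) * fps_X ^ e l)"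
  unfolding convp_def fcong_def by (auto) (metis not_less_eq)

lemma convp_plus_X: "(\<And>l. l < e l) \<Longrightarrow> convp (\<lambda>l. 1 + fps_X ^ e l)"
  and convp_minus_X: "(\<And>l. l < e l) \<Longrightarrow> convp (\<lambda>l. 1 - fps_X ^ e l)"
  using convp_add_X[of e "\<lambda>_. 1"] convp_add_X[of e "\<lambda>_. - 1"] by (auto simp flip: fps_const_neg)

subsection \<open>Generating functions of weighted sets\<close>

text \<open>Here \<open>e\<close> is the exponent and \<open>w\<close> the weight of an index. An
  infinite fibre would contribute the default sum 0; \<open>ffib\<close> excludes this wherever sets
  are split or multiplied.\<close>

definition gf :: "('i \<Rightarrow> nat) \<Rightarrow> ('i \<Rightarrow> 'a::comm_ring_1) \<Rightarrow> 'i set \<Rightarrow> 'a fps" where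
  "gf e w A = Abs_fps (\<lambda>n. \<Sum>x\<in>{x\<in>A. e x = n}. w x)"

definition ffib :: "('i \<Rightarrow> nat) \<Rightarrow> 'i set \<Rightarrow> bool" where
  "ffib e A \<longleftrightarrow> (\<forall>n. finite {x\<in>A. e x = n})"

lemma ffib_subset: "ffib e A \<Longrightarrow> B \<subseteq> A \<Longrightarrow> ffib e B"
proof -
  assume *: "ffib e A" "B \<subseteq> A"
  have "{x\<in>B. e x = n} \<subseteq> {x\<in>A. e x = n}" for n using *(2) by auto
  thus ?thesis using *(1) unfolding ffib_def by (meson finite_subset)
qed

lemma gf_cong:
  "A = B \<Longrightarrow> (\<And>x. x \<in> B \<Longrightarrow> e x = e' x) \<Longrightarrow> (\<And>x. x \<in> B \<Longrightarrow> w x = w' x) \<Longrightarrow> gf e w A = gf e' w' B"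
  by (auto simp: gf_def fps_eq_iff intro!: sum.cong)

lemma gf_reindex:
  assumes "bij_betw h B A" "\<And>x. x \<in> B \<Longrightarrow> e (h x) = e' x" "\<And>x. x \<in> B \<Longrightarrow> w (h x) = w' x"
  shows "gf e w A = gf e' w' B"
  unfolding gf_def fps_eq_iff fps_nth_Abs_fps
proof
  fix n
  have "bij_betw h {x\<in>B. e' x = n} {x\<in>A. e x = n}"
    using assms(1,2) by (auto simp: bij_betw_def inj_on_def image_iff)
  from sum.reindex_bij_betw[OF this, of w]
  show "(\<Sum>x | x \<in> A \<and> e x = n. w x) = (\<Sum>x | x \<in> B \<and> e' x = n. w' x)"
    by (subst sum.cong[of _ "{x\<in>B. e' x = n}" w' "\<lambda>x. w (h x)"]) (auto simp: assms(3))
qed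

lemma gf_Un:
  assumes "ffib e (A \<union> B)" "A \<inter> B = {}"
  shows "gf e w (A \<union> B) = gf e w A + gf e w B"
  unfolding gf_def fps_eq_iff fps_nth_Abs_fps fps_add_nth
proof
  fix n
  have "{x \<in> A \<union> B. e x = n} = {x\<in>A. e x = n} \<union> {x\<in>B. e x = n}" by auto
  moreover from this have "finite ({x\<in>A. e x = n} \<union> {x\<in>B. e x = n})"
    using assms(1) by (metis ffib_def)
  ultimately show "(\<Sum>x | x \<in> A \<union> B \<and> e x = n. w x) =
      (\<Sum>x | x \<in> A \<and> e x = n. w x) + (\<Sum>x | x \<in> B \<and> e x = n. w x)"
    using assms(2) by (subst sum.union_disjoint[symmetric]) auto
qed

lemma gf_mult:
  assumes "ffib e A" "ffib e' B"
  shows "gf e w A * gf e' w' B = gf (\<lambda>(x, y). e x + e' y) (\<lambda>(x, y). w x * w' y) (A \<times> B)"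
  unfolding fps_eq_iff
proof
  fix n
  have "(gf e w A * gf e' w' B) $ n =
     (\<Sum>i\<in>{0..n}. \<Sum>(x, y)\<in>{x\<in>A. e x = i} \<times> {x\<in>B. e' x = n - i}. w x * w' y)"
    by (simp add: fps_mult_nth gf_def sum_product sum.cartesian_product)
  also have "\<dots> = (\<Sum>(i, x, y)\<in>(SIGMA i:{0..n}. {x\<in>A. e x = i} \<times> {x\<in>B. e' x = n - i}). w x * w' y)"
    using assms by (subst sum.Sigma) (auto simp: ffib_def)
  also have "\<dots> = (\<Sum>(x, y)\<in>{(x, y). (x, y) \<in> A \<times> B \<and> e x + e' y = n}. w x * w' y)"
    by (rule sum.reindex_bij_witness[of _ "\<lambda>(x, y). (e x, x, y)" snd]) auto
  also have "{(x, y). (x, y) \<in> A \<times> B \<and> e x + e' y = n} =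
     {z \<in> A \<times> B. (case z of (x, y) \<Rightarrow> e x + e' y) = n}" by auto
  finally show "(gf e w A * gf e' w' B) $ n =
      gf (\<lambda>(x, y). e x + e' y) (\<lambda>(x, y). w x * w' y) (A \<times> B) $ n"
    by (simp add: gf_def)
qed

lemma gf_X_power: "fps_X ^ m * gf e w A = gf (\<lambda>x. m + e x) w A"
proof -
  have "{x\<in>A. e x = n - m} = {x\<in>A. m + e x = n}" if "n \<ge> m" for n
    using that by auto
  thus ?thesis
    by (auto simp: fps_eq_iff gf_def fps_X_power_mult_nth intro!: sum.neutral sum.cong)
qed

lemma gf_const: "fps_const c * gf e w A = gf e (\<lambda>x. c * w x) A"
  by (auto simp: gf_def fps_eq_iff sum_distrib_left)

lemma nth_compose_X_power:
  fixes f :: "'a::idom fps"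
  assumes "m > 0"
  shows "(f oo fps_X ^ m) $ n = (if m dvd n then f $ (n div m) else 0)"
proof -
  have "(f oo fps_X ^ m) $ n = (\<Sum>i = 0..n. if n = m * i then f $ i else 0)"
    by (simp add: fps_compose_nth fps_X_power_nth flip: power_mult cong: if_cong)
      (auto intro!: sum.cong)
  also have "\<dots> = (if m dvd n then f $ (n div m) else 0)"
  proof (cases "m dvd n")
    case True
    then obtain k where k: "n = m * k" by auto
    have "(\<Sum>i = 0..n. if n = m * i then f $ i else 0) = (\<Sum>i = 0..n. if i = k then f $ i else 0)"
      using assms k by (intro sum.cong) auto
    thus ?thesis using assms k by simp
  next
    case False
    thus ?thesis by (auto intro!: sum.neutral)
  qed
  finally show ?thesis .
qed

lemma gf_compose_X_power:
  assumes "m > 0"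
  shows "gf e w A oo (fps_X ^ m :: 'a::idom fps) = gf (\<lambda>x. m * e x) w A"
proof -
  have "(gf e w A oo fps_X ^ m) $ n = gf (\<lambda>x. m * e x) w A $ n" for n
  proof (cases "m dvd n")
    case True
    thus ?thesis using assms by (auto simp: nth_compose_X_power gf_def elim!: dvdE)
  next
    case False
    hence "{x\<in>A. m * e x = n} = {}" by auto
    hence "gf (\<lambda>x. m * e x) w A $ n = 0" unfolding gf_def fps_nth_Abs_fps by (simp only: sum.empty)
    thus ?thesis using False assms by (simp add: nth_compose_X_power)
  qed
  thus ?thesis by (simp add: fps_eq_iff)
qed

subsection \<open>The Jacobi triple product\<close>

text \<open>Triangular numbers for all integers j. With \<open>tri (- j)\<close> = j (j - 1) / 2,
  the terms \<open>a ^ tri j * b ^ tri (- j)\<close> are those of Ramanujan's theta function f(a,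
  b).\<close>

definition tri :: "int \<Rightarrow> nat" where "tri j = nat (j * (j + 1) div 2)"

lemma of_nat_tri: "2 * int (tri j) = j * (j + 1)"
proof -
  have "even (j * (j + 1))" by auto
  moreover have "j * (j + 1) \<ge> 0"
    by (cases "j \<ge> 0") (auto intro: mult_nonpos_nonpos)
  ultimately show ?thesis by (simp add: tri_def)
qed

lemma tri_add_1: "int (tri (j + 1)) = int (tri j) + j + 1"
  and tri_minus: "int (tri (- j)) = int (tri j) - j"
  and tri_diff_1: "int (tri (j - 1)) = int (tri j) - j"
  using of_nat_tri[of j] of_nat_tri[of "j + 1"] of_nat_tri[of "-j"] of_nat_tri[of "j - 1"]
  by (simp_all add: algebra_simps)

lemma abs_le_square: "\<bar>j\<bar> \<le> j * (j::int)"
proof (cases "j = 0")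
  case False
  hence "\<bar>j\<bar> * 1 \<le> \<bar>j\<bar> * \<bar>j\<bar>" by (intro mult_left_mono) auto
  thus ?thesis by simp
qed auto

lemma abs_le_tri_add: "nat \<bar>j\<bar> \<le> tri j + tri (- j)"
proof -
  have "int (tri j + tri (-j)) = j * j"
    using of_nat_tri[of j] tri_minus[of j] by (simp add: algebra_simps)
  moreover note abs_le_square[of j]
  ultimately show ?thesis by linarith
qed

section \<open>q-factorials, central q-binomial coefficients and the finite triple product\<close>

definition qq :: "'a::comm_ring_1 fps \<Rightarrow> nat \<Rightarrow> 'a fps" where
  "qq Q n = (\<Prod>l<n. 1 - Q ^ Suc l)"

text \<open>The usual convention that 1 / (Q; Q)_k is 0 for negative k makes \<open>qbin\<close>
  vanish outside -n..n, so that index ranges can be enlarged freely.\<close>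

definition iqq :: "'a::field fps \<Rightarrow> int \<Rightarrow> 'a fps" where
  "iqq Q k = (if k < 0 then 0 else inverse (qq Q (nat k)))"

text \<open>The q-binomial coefficient of 2n over n + r, centred so that it is symmetric in
  r.\<close>

definition qbin :: "'a::field fps \<Rightarrow> nat \<Rightarrow> int \<Rightarrow> 'a fps" where
  "qbin Q n r = qq Q (2 * n) * iqq Q (int n - r) * iqq Q (int n + r)"

lemma qq_nth_0 [simp]: "Q $ 0 = 0 \<Longrightarrow> qq Q n $ 0 = 1"
  by (induction n) (simp_all add: qq_def)

lemma qq_Suc: "qq Q (Suc n) = qq Q n * (1 - Q ^ Suc n)"
  by (simp add: qq_def)

lemma qq_inverse [simp]: "Q $ 0 = 0 \<Longrightarrow> qq Q n * inverse (qq Q n) = 1"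
  for Q :: "'a::field fps"
  by (simp add: inverse_mult_eq_1')

text \<open>For k <= 0 both sides vanish: \<open>nat k\<close> is 0 there, so the factor is 1 -
  1.\<close>

lemma iqq_pred:
  assumes "Q $ 0 = 0"
  shows "iqq Q (k - 1) = (1 - Q ^ nat k) * iqq Q k"
proof (cases "k > 0")
  case True
  define m where "m = nat (k - 1)"
  have m: "nat k = Suc m" using True by (simp add: m_def)
  have "inverse (qq Q m) = inverse (qq Q m) * (qq Q (Suc m) * inverse (qq Q (Suc m)))"
    by (simp only: qq_inverse[OF assms] mult_1_right)
  also have "\<dots> = (qq Q m * inverse (qq Q m)) * ((1 - Q ^ Suc m) * inverse (qq Q (Suc m)))"
    by (simp only: qq_Suc ac_simps)
  also have "\<dots> = (1 - Q ^ Suc m) * inverse (qq Q (Suc m))"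
    by (simp only: qq_inverse[OF assms] mult_1_left)
  finally have "inverse (qq Q m) = (1 - Q ^ Suc m) * inverse (qq Q (Suc m))" .
  thus ?thesis using True m by (simp add: iqq_def m_def[symmetric])
qed (auto simp: iqq_def)

lemma qbin_eq_0: "\<bar>r\<bar> > int n \<Longrightarrow> qbin Q n r = 0"
  by (auto simp: qbin_def iqq_def)

text \<open>The q-Pascal rule applied twice, from row 2n to row 2n + 2. With the common factor
  \<open>I\<close> taken out, it is the polynomial identity \<open>key\<close>.\<close>

lemma qbin_Suc:
  fixes Q :: "'a::field fps"
  assumes Q: "Q $ 0 = 0" and r: "\<bar>r\<bar> \<le> int n + 1"
  shows "qbin Q (Suc n) r = (1 + Q ^ (2 * n + 1)) * qbin Q n r
           + Q ^ nat (int n + 1 - r) * qbin Q n (r - 1) + Q ^ nat (int n + 1 + r) * qbin Q n (r + 1)"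
proof -
  define a where "a = Q ^ nat (int n + 1 - r)"
  define b where "b = Q ^ nat (int n + 1 + r)"
  define a' where "a' = Q ^ nat (int n - r)"
  define b' where "b' = Q ^ nat (int n + r)"
  define I where "I = qq Q (2 * n) * (iqq Q (int n + 1 - r) * iqq Q (int n + 1 + r))"
  define t where "t = Q ^ (2 * n + 1)"
  note pr = iqq_pred[OF Q]
  have 1: "iqq Q (int n - r) = (1 - a) * iqq Q (int n + 1 - r)"
          "iqq Q (int n + r) = (1 - b) * iqq Q (int n + 1 + r)"
    using pr[of "int n + 1 - r"] pr[of "int n + 1 + r"] by (simp_all add: a_def b_def algebra_simps)
  have 2: "iqq Q (int n - r - 1) = (1 - a') * ((1 - a) * iqq Q (int n + 1 - r))"
          "iqq Q (int n + r - 1) = (1 - b') * ((1 - b) * iqq Q (int n + 1 + r))"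
    using pr[of "int n - r"] pr[of "int n + r"] 1 by (simp_all add: a'_def b'_def)
  have ab: "a * b = t * Q"
  proof -
    have "nat (int n + 1 - r) + nat (int n + 1 + r) = (2 * n + 1) + 1" using r by linarith
    thus ?thesis unfolding a_def b_def t_def by (metis power_add power_one_right)
  qed
  \<comment> \<open>At r = n + 1 and r = - n - 1 truncation by \<open>nat\<close> destroys one of
    the relations a b' = t and a' b = t; there a = 1, b' = t or b = 1, a' = t takes over.\<close>
  have key: "(1 - t) * (1 - a * b) = (1 + t) * (1 - a) * (1 - b) + a * ((1 - b') * (1 - b)) + b * ((1 - a') * (1 - a))"
  proof -
    consider "r = int n + 1" | "r = - int n - 1" | "\<bar>r\<bar> \<le> int n" using r by linarith
    thus ?thesis
    proof cases
      case 1
      have "nat (int n + 1 - r) = 0" "nat (int n + r) = 2 * n + 1" using 1 by linarith+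
      hence "a = 1" "b' = t" by (simp_all only: a_def b'_def t_def power_0)
      thus ?thesis by (simp add: algebra_simps)
    next
      case 2
      have "nat (int n + 1 + r) = 0" "nat (int n - r) = 2 * n + 1" using 2 by linarith+
      hence "b = 1" "a' = t" by (simp_all only: b_def a'_def t_def power_0)
      thus ?thesis by (simp add: algebra_simps)
    next
      case 3
      have "nat (int n + 1 - r) + nat (int n + r) = 2 * n + 1"
           "nat (int n - r) + nat (int n + 1 + r) = 2 * n + 1" using 3 by linarith+
      hence "a * b' = t" "a' * b = t"
        unfolding a_def b_def a'_def b'_def t_def by (simp_all only: power_add[symmetric])
      moreover have "a * ((1 - b') * (1 - b)) = (a - a * b') * (1 - b)"
           "b * ((1 - a') * (1 - a)) = (b - a' * b) * (1 - a)"
        by (simp_all add: algebra_simps)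
      ultimately have "a * ((1 - b') * (1 - b)) = (a - t) * (1 - b)"
           "b * ((1 - a') * (1 - a)) = (b - t) * (1 - a)" by simp_all
      thus ?thesis by (simp only:) (simp add: algebra_simps)
    qed
  qed
  have "qbin Q (Suc n) r = (1 - t) * (1 - a * b) * I"
    by (simp add: qbin_def qq_Suc I_def ab t_def algebra_simps)
  also have "\<dots> = (1 + t) * ((1 - a) * (1 - b) * I) + a * ((1 - b') * (1 - b) * I) + b * ((1 - a') * (1 - a) * I)"
    unfolding key by (simp add: algebra_simps)
  also have "(1 - a) * (1 - b) * I = qbin Q n r"
    by (simp add: qbin_def 1 I_def mult_ac)
  also have "(1 - b') * (1 - b) * I = qbin Q n (r - 1)"
  proof -
    have "int n - (r - 1) = int n + 1 - r" "int n + (r - 1) = int n + r - 1" by simp_all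
    thus ?thesis by (simp only: qbin_def I_def 2 mult_ac)
  qed
  also have "(1 - a') * (1 - a) * I = qbin Q n (r + 1)"
  proof -
    have "int n - (r + 1) = int n - r - 1" "int n + (r + 1) = int n + 1 + r" by simp_all
    thus ?thesis by (simp only: qbin_def I_def 2 mult_ac)
  qed
  finally show ?thesis by (simp add: t_def a_def b_def)
qed

text \<open>The hypothesis makes \<open>w\<close> an eigenvector of the two shifts in
  \<open>qbin_Suc\<close>, so passing to the next row multiplies the whole sum by one factor. It
  serves for the triple product and, with eigenvalue 0, for the weight \<open>wt\<close>.\<close>

lemma qbin_sum_Suc:
  fixes Q :: "'a::field fps"
  assumes Q: "Q $ 0 = 0"
    and w: "\<And>s. \<bar>s\<bar> \<le> int n \<Longrightarrow> w (s + 1) * Q ^ nat (int n - s) + w (s - 1) * Q ^ nat (int n + s) = \<kappa> * w s"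
  shows "(\<Sum>r\<in>{- int (Suc n)..int (Suc n)}. qbin Q (Suc n) r * w r) =
         (1 + Q ^ (2 * n + 1) + \<kappa>) * (\<Sum>r\<in>{- int n..int n}. qbin Q n r * w r)"
proof -
  let ?N = "{- int (Suc n)..int (Suc n)}" and ?M = "{- int n..int n}"
  have 1: "(\<Sum>r\<in>?N. qbin Q n r * w r) = (\<Sum>r\<in>?M. qbin Q n r * w r)"
    by (rule sum.mono_neutral_right) (auto intro!: qbin_eq_0)
  have 2: "(\<Sum>r\<in>?N. Q ^ nat (int n + 1 - r) * qbin Q n (r - 1) * w r) =
           (\<Sum>s\<in>?M. Q ^ nat (int n - s) * qbin Q n s * w (s + 1))"
  proof -
    have "(\<Sum>r\<in>?N. Q ^ nat (int n + 1 - r) * qbin Q n (r - 1) * w r) =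
          (\<Sum>r\<in>{- int n + 1..int n + 1}. Q ^ nat (int n + 1 - r) * qbin Q n (r - 1) * w r)"
      by (rule sum.mono_neutral_right) (auto simp: qbin_eq_0)
    also have "\<dots> = (\<Sum>s\<in>?M. Q ^ nat (int n - s) * qbin Q n s * w (s + 1))"
      by (rule sum.reindex_bij_witness[of _ "\<lambda>s. s + 1" "\<lambda>r. r - 1"]) (auto simp: algebra_simps)
    finally show ?thesis .
  qed
  have 3: "(\<Sum>r\<in>?N. Q ^ nat (int n + 1 + r) * qbin Q n (r + 1) * w r) =
           (\<Sum>s\<in>?M. Q ^ nat (int n + s) * qbin Q n s * w (s - 1))"
  proof -
    have "(\<Sum>r\<in>?N. Q ^ nat (int n + 1 + r) * qbin Q n (r + 1) * w r) =
          (\<Sum>r\<in>{- int n - 1..int n - 1}. Q ^ nat (int n + 1 + r) * qbin Q n (r + 1) * w r)"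
      by (rule sum.mono_neutral_right) (auto simp: qbin_eq_0)
    also have "\<dots> = (\<Sum>s\<in>?M. Q ^ nat (int n + s) * qbin Q n s * w (s - 1))"
      by (rule sum.reindex_bij_witness[of _ "\<lambda>s. s - 1" "\<lambda>r. r + 1"]) (auto simp: algebra_simps)
    finally show ?thesis .
  qed
  have "(\<Sum>r\<in>?N. qbin Q (Suc n) r * w r) =
     (\<Sum>r\<in>?N. (1 + Q ^ (2 * n + 1)) * (qbin Q n r * w r) + Q ^ nat (int n + 1 - r) * qbin Q n (r - 1) * w r
         + Q ^ nat (int n + 1 + r) * qbin Q n (r + 1) * w r)"
    by (intro sum.cong refl) (subst qbin_Suc[OF Q], auto simp: algebra_simps)
  also have "\<dots> = (1 + Q ^ (2 * n + 1)) * (\<Sum>r\<in>?M. qbin Q n r * w r)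
     + (\<Sum>s\<in>?M. qbin Q n s * (w (s + 1) * Q ^ nat (int n - s) + w (s - 1) * Q ^ nat (int n + s)))"
    unfolding sum.distrib 2 3 sum_distrib_left[symmetric] 1
    by (simp add: sum.distrib distrib_left mult_ac add.assoc)
  also have "(\<Sum>s\<in>?M. qbin Q n s * (w (s + 1) * Q ^ nat (int n - s) + w (s - 1) * Q ^ nat (int n + s))) =
      \<kappa> * (\<Sum>r\<in>?M. qbin Q n r * w r)"
    by (subst sum_distrib_left, intro sum.cong refl) (auto simp: w)
  finally show ?thesis by (simp add: algebra_simps)
qed

text \<open>The terms satisfy the hypothesis of \<open>qbin_sum_Suc\<close>, and the factor that
  this lemma produces is the next pair of factors of the product.\<close>

lemma finite_jacobi_triple_product:
  fixes a b :: "'a::field fps"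
  assumes "(a * b) $ 0 = 0"
  shows "(\<Prod>l<n. (1 + a * (a * b) ^ l) * (1 + b * (a * b) ^ l)) =
         (\<Sum>r\<in>{- int n..int n}. qbin (a * b) n r * (a ^ tri r * b ^ tri (- r)))"
proof (induction n)
  case 0
  show ?case by (simp add: qbin_def iqq_def qq_def tri_def)
next
  case (Suc n)
  let ?w = "\<lambda>r. a ^ tri r * b ^ tri (- r)"
  have "?w (s + 1) * (a * b) ^ nat (int n - s) + ?w (s - 1) * (a * b) ^ nat (int n + s) =
       (a * (a * b) ^ n + b * (a * b) ^ n) * ?w s" if "\<bar>s\<bar> \<le> int n" for s
  proof -
    have 1: "tri (s + 1) + nat (int n - s) = tri s + n + 1" "tri (- (s + 1)) + nat (int n - s) = tri (- s) + n"
      using that tri_add_1[of s] tri_minus[of "s + 1"] tri_minus[of s] by linarith+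
    have 2: "tri (s - 1) + nat (int n + s) = tri s + n" "tri (- (s - 1)) + nat (int n + s) = tri (- s) + n + 1"
      using that tri_diff_1[of s] tri_minus[of "s - 1"] tri_minus[of s] by linarith+
    have "?w (s + 1) * (a * b) ^ nat (int n - s) =
        a ^ (tri (s + 1) + nat (int n - s)) * b ^ (tri (- (s + 1)) + nat (int n - s))"
      by (simp add: power_add power_mult_distrib mult_ac)
    moreover have "?w (s - 1) * (a * b) ^ nat (int n + s) =
        a ^ (tri (s - 1) + nat (int n + s)) * b ^ (tri (- (s - 1)) + nat (int n + s))"
      by (simp add: power_add power_mult_distrib mult_ac)
    ultimately show ?thesis
      unfolding 1 2 by (simp add: power_add power_mult_distrib algebra_simps)
  qed
  moreover have key: "(1 + a * (a * b) ^ n) * (1 + b * (a * b) ^ n) =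
      1 + (a * b) ^ (2 * n + 1) + (a * (a * b) ^ n + b * (a * b) ^ n)"
  proof -
    have "(a * b) ^ (2 * n + 1) = a * b * ((a * b) ^ n * (a * b) ^ n)"
      by (simp add: mult_2 power_add del: power_mult_distrib)
    thus ?thesis by (simp only: distrib_left distrib_right) (simp only: ac_simps mult_1_left mult_1_right)
  qed
  ultimately show ?case
    using qbin_sum_Suc[OF assms, of n ?w "a * (a * b) ^ n + b * (a * b) ^ n"]
    by (simp only: prod.lessThan_Suc Suc.IH key) (simp only: mult.commute)
qed

lemma qq_fcong:
  assumes "Q $ 0 = 0" "k \<le> m"
  shows "fcong (Suc k) (qq Q m) (qq Q k)"
  using assms(2)
proof (induction m rule: dec_induct)
  case (step m)
  have "fcong (Suc m) (1 - Q ^ Suc m) (1 - 0)"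
    by (intro fcong_diff fcong_refl)
       (use startsby_zero_power_prefix[OF assms(1), of "Suc m"] in \<open>simp only: fcong_def fps_zero_nth\<close>)
  hence "fcong (Suc k) (1 - Q ^ Suc m) 1" using step.hyps by (auto intro: fcong_mono)
  from fcong_mult[OF step.IH this] show ?case by (simp add: qq_Suc)
qed auto

text \<open>All \<open>qq Q m\<close> with m >= n - |r| agree to this order, so the four
  q-factorials cancel.\<close>

lemma qq_qbin_fcong:
  fixes Q :: "'a::field fps"
  assumes Q: "Q $ 0 = 0" and r: "\<bar>r\<bar> \<le> int n"
  shows "fcong (Suc (n - nat \<bar>r\<bar>)) (qq Q n * qbin Q n r) 1"
proof -
  define k where "k = n - nat \<bar>r\<bar>"
  have "fcong (Suc k) (qq Q n * (qq Q (2 * n) * inverse (qq Q (nat (int n - r))) * inverse (qq Q (nat (int n + r)))))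
       (qq Q k * (qq Q k * inverse (qq Q k) * inverse (qq Q k)))"
    using r by (intro fcong_mult fcong_inverse qq_fcong Q) (auto simp: k_def Q)
  moreover have "qbin Q n r = qq Q (2 * n) * inverse (qq Q (nat (int n - r))) * inverse (qq Q (nat (int n + r)))"
    using r by (auto simp: qbin_def iqq_def)
  moreover have "qq Q k * (qq Q k * inverse (qq Q k) * inverse (qq Q k)) = 1"
    using Q by simp
  ultimately show ?thesis unfolding k_def by simp
qed

text \<open>The limit of the finite version. Term r is off by order n - |r| + 1 relative to its
  power X^(e r), and e r >= |r| turns this into an error of order n + 1 uniformly in r. The
  constants s and t carry the signs.\<close>

theorem jacobi_triple_product:
  fixes s t :: complex
  assumes "i > 0" "k > 0"
  defines "a \<equiv> fps_const s * X ^ i" and "b \<equiv> fps_const t * X ^ k"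
  shows "gf (\<lambda>j. i * tri j + k * tri (- j)) (\<lambda>j. s ^ tri j * t ^ tri (- j)) UNIV =
         iprod (\<lambda>l. (1 - (a * b) ^ Suc l) * ((1 + a * (a * b) ^ l) * (1 + b * (a * b) ^ l)))"
proof -
  define Q where "Q = a * b"
  define w where "w = (\<lambda>r. a ^ tri r * b ^ tri (- r))"
  define e where "e = (\<lambda>j. i * tri j + k * tri (- j))"
  have Q: "Q $ 0 = 0" using assms by (simp add: Q_def a_def b_def)
  have Qp: "Q = fps_const (s * t) * X ^ (i + k)"
    by (simp add: Q_def a_def b_def power_add mult_ac flip: fps_const_mult)
  have w: "w r = X ^ e r * fps_const (s ^ tri r * t ^ tri (- r))" for r
    by (simp add: w_def a_def b_def e_def power_mult_distrib power_add power_mult fps_const_power mult_ac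
        flip: fps_const_mult)
  have e: "nat \<bar>j\<bar> \<le> e j" for j
  proof -
    have "tri j \<le> i * tri j" "tri (- j) \<le> k * tri (- j)" using assms by auto
    thus ?thesis unfolding e_def using abs_le_tri_add[of j] by linarith
  qed
  have main: "fcong (Suc n) (\<Prod>l<n. (1 - Q ^ Suc l) * ((1 + a * Q ^ l) * (1 + b * Q ^ l)))
        (gf e (\<lambda>j. s ^ tri j * t ^ tri (- j)) UNIV)" for n
  proof -
    have "(\<Prod>l<n. (1 - Q ^ Suc l) * ((1 + a * Q ^ l) * (1 + b * Q ^ l))) =
        (\<Sum>r\<in>{- int n..int n}. qq Q n * qbin Q n r * w r)"
    proof -
      have "(\<Prod>l<n. (1 - Q ^ Suc l) * ((1 + a * Q ^ l) * (1 + b * Q ^ l))) =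
            qq Q n * (\<Prod>l<n. (1 + a * Q ^ l) * (1 + b * Q ^ l))"
        by (simp only: prod.distrib qq_def)
      also have "\<dots> = qq Q n * (\<Sum>r\<in>{- int n..int n}. qbin Q n r * w r)"
        unfolding Q_def w_def by (subst finite_jacobi_triple_product) (use Q in \<open>simp_all add: Q_def\<close>)
      finally show ?thesis by (simp only: sum_distrib_left mult.assoc)
    qed
    also have "fcong (Suc n) \<dots> (\<Sum>r\<in>{- int n..int n}. w r)"
    proof (rule fcong_sum)
      fix r assume r: "r \<in> {- int n..int n}"
      have "fcong (e r + Suc (n - nat \<bar>r\<bar>)) (X ^ e r * (fps_const (s ^ tri r * t ^ tri (- r)) * (qq Q n * qbin Q n r)))
           (X ^ e r * (fps_const (s ^ tri r * t ^ tri (- r)) * 1))"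
        by (intro fcong_shift fcong_mult fcong_refl qq_qbin_fcong Q) (use r in auto)
      hence "fcong (e r + Suc (n - nat \<bar>r\<bar>)) (qq Q n * qbin Q n r * w r) (w r)"
        by (simp add: w mult_ac)
      moreover have "Suc n \<le> e r + Suc (n - nat \<bar>r\<bar>)" using e[of r] by linarith
      ultimately show "fcong (Suc n) (qq Q n * qbin Q n r * w r) (w r)" by (rule fcong_mono)
    qed
    also have "fcong (Suc n) (\<Sum>r\<in>{- int n..int n}. w r) (gf e (\<lambda>j. s ^ tri j * t ^ tri (- j)) UNIV)"
      unfolding fcong_def
    proof safe
      fix m assume m: "m < Suc n"
      have "(\<Sum>r\<in>{- int n..int n}. w r) $ m =
         (\<Sum>r\<in>{- int n..int n}. if e r = m then s ^ tri r * t ^ tri (- r) else 0)"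
        by (auto simp: fps_sum_nth w fps_X_power_mult_nth intro!: sum.cong)
      also have "\<dots> = (\<Sum>r\<in>{r\<in>{- int n..int n}. e r = m}. s ^ tri r * t ^ tri (- r))"
        by (rule sum.inter_filter[symmetric]) simp
      also have "{r\<in>{- int n..int n}. e r = m} = {r\<in>UNIV. e r = m}"
      proof -
        have "r \<in> {- int n..int n}" if "e r = m" for r
          using e[of r] that m by auto
        thus ?thesis by auto
      qed
      finally show "(\<Sum>r\<in>{- int n..int n}. w r) $ m = gf e (\<lambda>j. s ^ tri j * t ^ tri (- j)) UNIV $ m"
        by (simp add: gf_def)
    qed
    finally show ?thesis .
  qed
  have conv: "convp (\<lambda>l. (1 - Q ^ Suc l) * ((1 + a * Q ^ l) * (1 + b * Q ^ l)))"
  proof (intro convp_mult)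
    have "convp (\<lambda>l. 1 + fps_const (- ((s * t) ^ Suc l)) * X ^ ((i + k) * Suc l))"
      by (rule convp_add_X) (intro less_mult_Suc, use assms in simp)
    moreover have "1 - Q ^ Suc l = 1 + fps_const (- ((s * t) ^ Suc l)) * X ^ ((i + k) * Suc l)" for l
      unfolding Qp power_mult_distrib fps_const_power power_mult[symmetric] fps_const_neg[symmetric] by (simp flip: fps_const_neg)
    ultimately show "convp (\<lambda>l. 1 - Q ^ Suc l)" by (simp flip: fps_const_neg)
  next
    have "convp (\<lambda>l. 1 + fps_const (s * (s * t) ^ l) * X ^ (i + (i + k) * l))"
    proof (rule convp_add_X)
      fix l :: nat
      have "1 * l \<le> (i + k) * l" using assms by (intro mult_right_mono) auto
      thus "l < i + (i + k) * l" using assms by linarith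
    qed
    moreover have "1 + a * Q ^ l = 1 + fps_const (s * (s * t) ^ l) * X ^ (i + (i + k) * l)" for l
      unfolding Qp power_mult_distrib fps_const_power power_mult[symmetric] a_def fps_const_mult[symmetric]
      by (simp add: power_add mult_ac)
    ultimately show "convp (\<lambda>l. 1 + a * Q ^ l)" by simp
  next
    have "convp (\<lambda>l. 1 + fps_const (t * (s * t) ^ l) * X ^ (k + (i + k) * l))"
    proof (rule convp_add_X)
      fix l :: nat
      have "1 * l \<le> (i + k) * l" using assms by (intro mult_right_mono) auto
      thus "l < k + (i + k) * l" using assms by linarith
    qed
    moreover have "1 + b * Q ^ l = 1 + fps_const (t * (s * t) ^ l) * X ^ (k + (i + k) * l)" for l
      unfolding Qp power_mult_distrib fps_const_power power_mult[symmetric] b_def fps_const_mult[symmetric]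
      by (simp add: power_add mult_ac)
    ultimately show "convp (\<lambda>l. 1 + b * Q ^ l)" by simp
  qed
  have "iprod (\<lambda>l. (1 - Q ^ Suc l) * ((1 + a * Q ^ l) * (1 + b * Q ^ l))) =
     gf e (\<lambda>j. s ^ tri j * t ^ tri (- j)) UNIV"
    by (rule iprod_eqI[OF conv]) (use main fcong_mono in \<open>blast intro: le_SucI\<close>)
  thus ?thesis by (simp add: Q_def e_def)
qed

subsection \<open>Theta functions and their products\<close>

lemma gf_partition:
  assumes "ffib e A" "finite R" "\<And>x. x \<in> A \<Longrightarrow> p x \<in> R"
  shows "gf e w A = (\<Sum>r\<in>R. gf e w {x\<in>A. p x = r})"
  unfolding fps_eq_iff
proof
  fix n
  have "(\<Sum>r\<in>R. gf e w {x\<in>A. p x = r}) $ n = (\<Sum>r\<in>R. \<Sum>x\<in>{x\<in>{x\<in>A. e x = n}. p x = r}. w x)"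
    by (simp add: fps_sum_nth gf_def conj_ac)
  also have "\<dots> = (\<Sum>x\<in>{x\<in>A. e x = n}. w x)"
    using assms by (intro sum.group) (auto simp: ffib_def)
  finally show "gf e w A $ n = (\<Sum>r\<in>R. gf e w {x\<in>A. p x = r}) $ n" by (simp add: gf_def)
qed

lemma ffib_prod:
  assumes "ffib e A" "ffib e' B"
  shows "ffib (\<lambda>(x, y). e x + e' y) (A \<times> B)"
  unfolding ffib_def
proof
  fix n
  have "{z \<in> A \<times> B. (case z of (x, y) \<Rightarrow> e x + e' y) = n} \<subseteq>
     (\<Union>i\<le>n. {x\<in>A. e x = i} \<times> {x\<in>B. e' x = n - i})" by auto
  thus "finite {z \<in> A \<times> B. (case z of (x, y) \<Rightarrow> e x + e' y) = n}"
    by (rule finite_subset) (use assms in \<open>auto simp: ffib_def\<close>)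
qed

lemma ffib_int: "(\<And>j::int. nat \<bar>j\<bar> \<le> e j) \<Longrightarrow> ffib e A"
  unfolding ffib_def
proof
  fix n assume *: "\<And>j::int. nat \<bar>j\<bar> \<le> e j"
  have "{x\<in>A. e x = n} \<subseteq> {- int n..int n}"
  proof
    fix j assume "j \<in> {x\<in>A. e x = n}"
    thus "j \<in> {- int n..int n}" using *[of j] by auto
  qed
  thus "finite {x\<in>A. e x = n}" by (rule finite_subset) auto
qed

definition par :: "int \<Rightarrow> complex" where "par j = (if even j then 1 else -1)"

definition sq :: "int \<Rightarrow> nat" where "sq j = nat (j * j)"

text \<open>2 j^2 - j runs through the triangular numbers, each once, as j runs through the
  integers. Summing over all integers makes \<open>psi\<close> a case of the triple product.\<close>

definition psie :: "int \<Rightarrow> nat" where "psie j = nat (2 * (j * j) - j)"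

definition phi :: "complex fps" where "phi = gf sq (\<lambda>_. 1) UNIV"
definition phim :: "complex fps" where "phim = gf sq par UNIV"
definition psi :: "complex fps" where "psi = gf psie (\<lambda>_. 1) UNIV"

lemma par_add: "par (i + j) = par i * par j" and par_minus: "par (- j) = par j"
  by (auto simp: par_def)

lemma of_nat_sq [simp]: "int (sq j) = j * j"
  by (simp add: sq_def)

lemma of_nat_psie [simp]: "int (psie j) = 2 * (j * j) - j"
  using abs_le_square[of j] by (simp add: psie_def)

lemma ffib_sq [simp, intro]: "ffib sq A"
  using abs_le_square by (intro ffib_int) (simp add: sq_def nat_le_eq_zle)

lemma ffib_psie [simp, intro]: "ffib psie A"
proof (rule ffib_int)
  fix j :: int
  show "nat \<bar>j\<bar> \<le> psie j" using abs_le_square[of j] by (simp add: psie_def)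
qed

section \<open>Euler products and the product formulas for the theta functions\<close>

definition eu :: "nat \<Rightarrow> complex fps" where "eu m = iprod (\<lambda>l. 1 - X ^ (m * Suc l))"

lemma convp_eu: "m > 0 \<Longrightarrow> convp (\<lambda>l. 1 - X ^ (m * Suc l))"
  by (intro convp_minus_X less_mult_Suc)

lemma eu_compose:
  assumes "m > 0" "k > 0"
  shows "eu m oo X ^ k = eu (m * k)"
proof -
  have "eu (m * k) = iprod (\<lambda>l. (1 - X ^ (m * Suc l)) oo X ^ k)"
    using assms by (simp add: eu_def fps_compose_sub_distrib fps_X_power_compose mult_ac
        flip: power_mult)
  also have "\<dots> = eu m oo X ^ k"
    unfolding eu_def using assms by (intro iprod_compose convp_eu) auto
  finally show ?thesis ..
qed

lemma eu_nth_0 [simp]: "m > 0 \<Longrightarrow> eu m $ 0 = 1"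
  unfolding eu_def by (rule iprod_nth_0[OF convp_eu])

lemma eu_nonzero [simp]: "m > 0 \<Longrightarrow> eu m \<noteq> 0"
  using eu_nth_0[of m] by force

lemma eu_block:
  assumes "m > 0" "k > 0"
  shows "eu m = iprod (\<lambda>l. \<Prod>r<k. 1 - X ^ (m * Suc (k * l + r)))"
  unfolding eu_def using iprod_block[OF convp_eu[OF assms(1)] assms(2)] by simp

lemma jtp_pos:
  assumes "i > 0" "k > 0"
  shows "gf (\<lambda>j. i * tri j + k * tri (- j)) (\<lambda>j. 1) UNIV =
         iprod (\<lambda>l. (1 - X ^ ((i + k) * Suc l)) * ((1 + X ^ (i + (i + k) * l)) * (1 + X ^ (k + (i + k) * l))))"
  using jacobi_triple_product[OF assms, of 1 1]
  by (simp only: fps_const_1_eq_1 mult_1_left mult_1_right power_one power_add[symmetric] power_mult[symmetric])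

lemma jtp_neg:
  assumes "i > 0" "k > 0"
  shows "gf (\<lambda>j. i * tri j + k * tri (- j)) par UNIV =
         iprod (\<lambda>l. (1 - X ^ ((i + k) * Suc l)) * ((1 - X ^ (i + (i + k) * l)) * (1 - X ^ (k + (i + k) * l))))"
proof -
  have "(- 1 :: complex) ^ tri j * (- 1) ^ tri (- j) = par j" for j
  proof -
    have "int (tri j + tri (- j)) = j * j"
      using of_nat_tri[of j] tri_minus[of j] by (simp add: algebra_simps)
    hence "even (tri j + tri (- j)) \<longleftrightarrow> even j"
      by (metis even_mult_iff even_of_nat)
    thus ?thesis by (simp add: par_def flip: power_add)
  qed
  moreover have "fps_const (- 1) = (- 1 :: complex fps)" by (simp flip: fps_const_neg)
  ultimately show ?thesis
    using jacobi_triple_product[OF assms, of "-1" "-1"]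
    by (simp only: mult_minus1 minus_mult_minus mult_minus_left mult_minus_right minus_minus mult_1_left add_uminus_conv_diff
        power_add[symmetric] power_mult[symmetric])
qed

lemma convp_odd [simp, intro]: "i > 0 \<Longrightarrow> k > 0 \<Longrightarrow> convp (\<lambda>l. 1 + X ^ (i + k * l))"
  "i > 0 \<Longrightarrow> k > 0 \<Longrightarrow> convp (\<lambda>l. 1 - X ^ (i + k * l))"
proof -
  have *: "l < i + k * l" if "i > 0" "k > 0" for i k l :: nat
  proof -
    have "1 * l \<le> k * l" using that by (intro mult_right_mono) auto
    thus ?thesis using that by linarith
  qed
  show "i > 0 \<Longrightarrow> k > 0 \<Longrightarrow> convp (\<lambda>l. 1 + X ^ (i + k * l))"
    "i > 0 \<Longrightarrow> k > 0 \<Longrightarrow> convp (\<lambda>l. 1 - X ^ (i + k * l))"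
    by (intro convp_plus_X convp_minus_X *; assumption)+
qed

text \<open>\<open>opr i k\<close> and \<open>omr i k\<close> are \<open>(-q\<^sup>i; q\<^sup>k)\<^sub>\<infinity>\<close> and \<open>(q\<^sup>i; q\<^sup>k)\<^sub>\<infinity>\<close>.\<close>

definition opr :: "nat \<Rightarrow> nat \<Rightarrow> complex fps" where "opr i k = iprod (\<lambda>l. 1 + X ^ (i + k * l))"
definition omr :: "nat \<Rightarrow> nat \<Rightarrow> complex fps" where "omr i k = iprod (\<lambda>l. 1 - X ^ (i + k * l))"

lemma jtp_pos': "i > 0 \<Longrightarrow> k > 0 \<Longrightarrow> gf (\<lambda>j. i * tri j + k * tri (- j)) (\<lambda>j. 1) UNIV =
    eu (i + k) * opr i (i + k) * opr k (i + k)"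
  and jtp_neg': "i > 0 \<Longrightarrow> k > 0 \<Longrightarrow> gf (\<lambda>j. i * tri j + k * tri (- j)) par UNIV =
    eu (i + k) * omr i (i + k) * omr k (i + k)"
  unfolding jtp_pos jtp_neg eu_def opr_def omr_def
  by (simp_all only: iprod_mult convp_mult convp_eu convp_odd add_pos_pos mult.assoc)

lemma omr_self: "k > 0 \<Longrightarrow> omr k k = eu k"
  by (simp add: omr_def eu_def algebra_simps)

lemma opr_omr: "i > 0 \<Longrightarrow> k > 0 \<Longrightarrow> opr i k * omr i k = omr (2 * i) (2 * k)"
proof -
  assume ik: "i > 0" "k > 0"
  have "(1 + y) * (1 - y) = 1 - y * y" for y :: "complex fps"
    by (simp add: algebra_simps)
  hence "(1 + X ^ n) * (1 - X ^ n) = 1 - X ^ (2 * n)" for n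
    by (simp only: mult_2 power_add)
  moreover have "2 * i + 2 * k * l = 2 * (i + k * l)" for l by (simp add: algebra_simps)
  ultimately show ?thesis
    unfolding opr_def omr_def using ik by (subst iprod_mult[symmetric]) (auto simp: mult.assoc)
qed

text \<open>The factors with exponents i + k n are sorted by n mod m. The product formulas below
  follow by comparing such decompositions.\<close>

lemma omr_split:
  assumes "i > 0" "k > 0" "m > 0"
  shows "omr i k = (\<Prod>r<m. omr (i + k * r) (m * k))"
proof -
  have "(\<Prod>r<n. omr (i + k * r) (m * k)) = iprod (\<lambda>l. \<Prod>r<n. 1 - X ^ (i + k * (m * l + r)))
      \<and> convp (\<lambda>l. \<Prod>r<n. 1 - X ^ (i + k * (m * l + r)))" for n
  proof (induction n)
    case 0
    have "convp (\<lambda>l. 1)" by (auto simp: convp_def)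
    moreover from this have "iprod (\<lambda>l. 1 :: complex fps) = 1"
      by (intro iprod_eqI) auto
    ultimately show ?case by simp
  next
    case (Suc n)
    have eq: "i + k * (m * l + n) = i + k * n + m * k * l" for l by (simp add: algebra_simps)
    have c: "convp (\<lambda>l. 1 - X ^ (i + k * (m * l + n)))" unfolding eq using assms by (intro convp_odd) auto
    show ?case
      using Suc iprod_mult[OF conjunct2[OF Suc] c] convp_mult[OF conjunct2[OF Suc] c]
      by (simp add: omr_def eq)
  qed
  from this[of m] show ?thesis
    using iprod_block[OF convp_odd(2)[OF assms(1,2)] assms(3)] by (simp add: omr_def)
qed

lemma lessThan_2: "{..<2::nat} = {0, 1}"
  by auto

lemma phim_prod: "phim * eu 2 = eu 1 ^ 2"
proof -
  have "phim = gf (\<lambda>j. 1 * tri j + 1 * tri (- j)) par UNIV"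
    unfolding phim_def
  proof (intro gf_cong refl)
    fix j
    have "int (sq j) = int (1 * tri j + 1 * tri (- j))"
      using of_nat_tri[of j] tri_minus[of j] by (simp add: algebra_simps)
    thus "sq j = 1 * tri j + 1 * tri (- j)" by linarith
  qed
  also have "\<dots> = eu 2 * omr 1 2 * omr 1 2" by (subst jtp_neg') (auto simp: numeral_2_eq_2)
  moreover have "eu 1 = omr 1 2 * eu 2"
    using omr_split[of 1 1 2] by (simp add: omr_self lessThan_nat_numeral numeral_2_eq_2 lessThan_Suc)
  ultimately show ?thesis by (simp add: power2_eq_square mult_ac)
qed

lemma phi_prod: "phi * eu 1 ^ 2 * eu 4 ^ 2 = eu 2 ^ 5"
proof -
  have "phi = gf (\<lambda>j. 1 * tri j + 1 * tri (- j)) (\<lambda>_. 1) UNIV"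
    unfolding phi_def
  proof (intro gf_cong refl)
    fix j
    have "int (sq j) = int (1 * tri j + 1 * tri (- j))"
      using of_nat_tri[of j] tri_minus[of j] by (simp add: algebra_simps)
    thus "sq j = 1 * tri j + 1 * tri (- j)" by linarith
  qed
  also have "\<dots> = eu 2 * opr 1 2 * opr 1 2" by (subst jtp_pos') (auto simp: numeral_2_eq_2)
  finally have "phi = eu 2 * opr 1 2 * opr 1 2" .
  moreover have "eu 1 = omr 1 2 * eu 2"
    using omr_split[of 1 1 2] by (simp add: omr_self lessThan_nat_numeral numeral_2_eq_2 lessThan_Suc)
  moreover have "eu 2 = omr 2 4 * eu 4"
    using omr_split[of 2 2 2] by (simp add: omr_self lessThan_2 flip: numeral_2_eq_2)
  moreover have "opr 1 2 * omr 1 2 = omr 2 4" using opr_omr[of 1 2] by simp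
  ultimately show ?thesis by algebra
qed

lemma psi_prod: "psi * eu 1 = eu 2 ^ 2"
proof -
  have "psi = gf (\<lambda>j. 1 * tri j + 3 * tri (- j)) (\<lambda>_. 1) UNIV"
    unfolding psi_def
  proof (intro gf_cong refl)
    fix j
    have "int (psie j) = int (1 * tri j + 3 * tri (- j))"
      using of_nat_tri[of j] tri_minus[of j] by (simp add: algebra_simps)
    thus "psie j = 1 * tri j + 3 * tri (- j)" by linarith
  qed
  also have "\<dots> = eu 4 * opr 1 4 * opr 3 4" by (subst jtp_pos') auto
  finally have "psi = eu 4 * opr 1 4 * opr 3 4" .
  moreover have "eu 1 = omr 1 4 * omr 2 4 * omr 3 4 * eu 4"
    using omr_split[of 1 1 4] by (simp add: omr_self numeral_nat lessThan_Suc mult_ac)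
  moreover have "eu 2 = omr 2 4 * eu 4"
    using omr_split[of 2 2 2] by (simp add: omr_self lessThan_2 flip: numeral_2_eq_2)
  moreover have "opr 1 4 * omr 1 4 = omr 2 8" "opr 3 4 * omr 3 4 = omr 6 8"
    using opr_omr[of 1 4] opr_omr[of 3 4] by simp_all
  moreover have "omr 2 4 = omr 2 8 * omr 6 8"
    using omr_split[of 2 4 2] by (simp add: numeral_nat lessThan_Suc mult_ac)
  ultimately show ?thesis by algebra
qed

text \<open>The triple product turns the two theta functions into the factors with exponents 1, 3,
  7, 9 modulo 10. These are what remains of \<open>eu 1\<close> when the even exponents
  (\<open>eu 2\<close>) and those that are 5 modulo 10 are removed.\<close>

lemma theta10_prod:
  "gf (\<lambda>j. 7 * tri j + 3 * tri (- j)) par UNIV * gf (\<lambda>j. 9 * tri j + 1 * tri (- j)) par UNIV * (eu 2 * eu 5)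
     = eu 1 * eu 10 ^ 3"
proof -
  have "eu 1 = omr 1 10 * omr 2 10 * omr 3 10 * omr 4 10 * omr 5 10 * omr 6 10 * omr 7 10 * omr 8 10 * omr 9 10 * eu 10"
    using omr_split[of 1 1 10] by (simp add: omr_self numeral_nat lessThan_Suc mult_ac)
  moreover have "eu 2 = omr 2 10 * omr 4 10 * omr 6 10 * omr 8 10 * eu 10"
    using omr_split[of 2 2 5] by (simp add: omr_self numeral_nat lessThan_Suc mult_ac)
  moreover have "eu 5 = omr 5 10 * eu 10"
    using omr_split[of 5 5 2] by (simp add: omr_self numeral_nat lessThan_Suc mult_ac)
  ultimately show ?thesis
    by (subst (1 2) jtp_neg') (auto simp: power3_eq_cube mult_ac)
qed

text \<open>The plus-sign factors with exponents 1 to 4 modulo 5 appear here; each is a quotient of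
  minus-sign factors by \<open>opr_omr\<close>, which gives \<open>eu 2\<close> over
  \<open>eu 1\<close> up to multiples of 5.\<close>

lemma theta5_prod:
  "gf (\<lambda>j. 2 * tri j + 3 * tri (- j)) (\<lambda>_. 1) UNIV * gf (\<lambda>j. 4 * tri j + 1 * tri (- j)) (\<lambda>_. 1) UNIV * (eu 1 * eu 10)
     = eu 2 * eu 5 ^ 3"
proof -
  have "eu 1 = omr 1 5 * omr 2 5 * omr 3 5 * omr 4 5 * eu 5"
    using omr_split[of 1 1 5] by (simp add: omr_self numeral_nat lessThan_Suc mult_ac)
  moreover have "eu 2 = omr 2 10 * omr 4 10 * omr 6 10 * omr 8 10 * eu 10"
    using omr_split[of 2 2 5] by (simp add: omr_self numeral_nat lessThan_Suc mult_ac)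
  moreover have "opr 1 5 * omr 1 5 = omr 2 10" "opr 2 5 * omr 2 5 = omr 4 10"
       "opr 3 5 * omr 3 5 = omr 6 10" "opr 4 5 * omr 4 5 = omr 8 10"
    using opr_omr[of _ 5] by force+
  ultimately show ?thesis
    by (subst (1 2) jtp_pos') (auto, algebra)
qed

subsection \<open>Quintic dissections from the lattice of Gaussian integers divisible by \<open>2 + i\<close>\<close>

lemma gf_times_mod:
  assumes "ffib e UNIV"
  shows "gf (\<lambda>(x, y). e x + e y) (\<lambda>(x, y). w x * w y) {z \<in> UNIV. fst z mod m = r \<and> snd z mod m = s} =
     gf e w {x. x mod m = r} * gf e w {x. x mod m = (s::int)}"
  by (subst gf_mult) (auto intro!: gf_cong ffib_subset[OF assms])

lemma mod5_cases: "j mod 5 \<in> {0, 1, 2, 3, 4 :: int}"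
proof -
  have "0 \<le> j mod 5" "j mod 5 < 5" by auto
  thus ?thesis by auto
qed

definition lat :: "(int \<Rightarrow> nat) \<Rightarrow> int \<times> int \<Rightarrow> nat" where "lat e = (\<lambda>(x, y). e x + e y)"
definition wlat :: "(int \<Rightarrow> complex) \<Rightarrow> int \<times> int \<Rightarrow> complex" where "wlat w = (\<lambda>(x, y). w x * w y)"

lemma gf_square_lat: "ffib e UNIV \<Longrightarrow> gf e w UNIV ^ 2 = gf (lat e) (wlat w) UNIV"
  by (simp add: power2_eq_square gf_mult lat_def wlat_def)

text \<open>When y mod 5 determines x mod 5, the lattice is a union of five products of residue
  classes.\<close>

lemma gf_lattice_partition:
  assumes "ffib e UNIV"
    and "\<And>x y. (x, y) \<in> L \<longleftrightarrow> x mod 5 = f (y mod 5)"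
  shows "gf (lat e) (wlat w) L = (\<Sum>r\<in>{0, 1, 2, 3, 4}. gf e w {x. x mod 5 = f r} * gf e w {x. x mod 5 = r})"
proof -
  have "ffib (lat e) UNIV" using ffib_prod[OF assms(1) assms(1)] by (simp add: lat_def)
  hence "gf (lat e) (wlat w) L = (\<Sum>r\<in>{0, 1, 2, 3, 4}. gf (lat e) (wlat w) {z\<in>L. snd z mod 5 = r})"
    using mod5_cases by (intro gf_partition ffib_subset[of "lat e" UNIV L]) auto
  also have "\<dots> = (\<Sum>r\<in>{0, 1, 2, 3, 4}. gf e w {x. x mod 5 = f r} * gf e w {x. x mod 5 = r})"
  proof (intro sum.cong refl)
    fix r
    have "{z\<in>L. snd z mod 5 = r} = {z\<in>UNIV. fst z mod 5 = f r \<and> snd z mod 5 = r}"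
      using assms(2) by auto
    thus "gf (lat e) (wlat w) {z\<in>L. snd z mod 5 = r} = gf e w {x. x mod 5 = f r} * gf e w {x. x mod 5 = r}"
      using gf_times_mod[OF assms(1), of w 5 "f r" r] by (simp add: lat_def wlat_def)
  qed
  finally show ?thesis .
qed

abbreviation ph5 :: "int \<Rightarrow> complex fps" where "ph5 r \<equiv> gf sq par {x. x mod 5 = r}"
abbreviation ps5 :: "int \<Rightarrow> complex fps" where "ps5 r \<equiv> gf psie (\<lambda>_. 1) {x. x mod 5 = r}"

text \<open>Multiplication by 2 + i multiplies the norm x^2 + y^2 by 5 and maps the Gaussian
  integers onto the lattice x = 2y modulo 5. It keeps the parity of x + y, hence the sign.\<close>

lemma phim_square_5:
  "(phim oo X ^ 5) ^ 2 = ph5 0 * ph5 0 + ph5 2 * ph5 1 + ph5 4 * ph5 2 + ph5 1 * ph5 3 + ph5 3 * ph5 4"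
proof -
  let ?L = "{(x, y). x mod 5 = 2 * (y mod 5) mod (5::int)}"
  let ?h = "\<lambda>(x, y). (2 * x - y, x + 2 * y) :: int \<times> int"
  have "(phim oo X ^ 5) ^ 2 = phim ^ 2 oo X ^ 5" by (simp add: fps_compose_power)
  also have "\<dots> = gf (\<lambda>z. 5 * lat sq z) (wlat par) UNIV"
    unfolding phim_def by (simp add: gf_square_lat gf_compose_X_power)
  also have "\<dots> = gf (lat sq) (wlat par) ?L"
  proof (rule gf_reindex[symmetric])
    show "bij_betw ?h UNIV ?L"
    proof (rule bij_betwI[where g = "\<lambda>(x, y). ((2 * x + y) div 5, (2 * y - x) div 5)"])
      show "?h \<in> UNIV \<rightarrow> ?L"
      proof (clarsimp)
        fix x y :: int
        have "(2 * x - y) mod 5 = (2 * (x + 2 * y)) mod 5"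
          by (simp add: mod_eq_dvd_iff algebra_simps)
        thus "(2 * x - y) mod 5 = 2 * ((x + 2 * y) mod 5) mod 5" by (simp add: mod_mult_right_eq)
      qed
    next
      fix z assume "z \<in> ?L"
      then obtain x y where z: "z = (x, y)" "x mod 5 = 2 * (y mod 5) mod 5" by auto
      have "x mod 5 = (2 * y) mod 5" using z(2) by (simp add: mod_mult_right_eq)
      then obtain k where "x - 2 * y = 5 * k" by (auto simp: mod_eq_dvd_iff elim!: dvdE)
      hence "2 * x + y = 5 * (y + 2 * k)" "2 * y - x = 5 * (- k)" and x: "x = 2 * y + 5 * k" by auto
      hence "(2 * x + y) div 5 = y + 2 * k" "(2 * y - x) div 5 = - k" by (simp_all only:) simp_all
      thus "?h (case z of (x, y) \<Rightarrow> ((2 * x + y) div 5, (2 * y - x) div 5)) = z"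
        unfolding z(1) by (simp add: x)
    qed auto
    fix z :: "int \<times> int"
    obtain x y where z: "z = (x, y)" by force
    have "int (lat sq (?h z)) = int (5 * lat sq z)" by (simp add: z lat_def algebra_simps)
    thus "lat sq (?h z) = 5 * lat sq z" by linarith
    show "wlat par (?h z) = wlat par z" by (auto simp: z wlat_def par_def)
  qed
  also have "\<dots> = (\<Sum>r\<in>{0, 1, 2, 3, 4}. ph5 (2 * r mod 5) * ph5 r)"
    by (rule gf_lattice_partition) auto
  also have "\<dots> = ph5 0 * ph5 0 + ph5 2 * ph5 1 + ph5 4 * ph5 2 + ph5 1 * ph5 3 + ph5 3 * ph5 4"
    by (simp add: add.assoc)
  finally show ?thesis .
qed

text \<open>Since 8 (2 j^2 - j) + 1 = (4j - 1)^2, this is again about sums of two squares. In the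
  coordinates 4x - 1, 4y - 1 the map \<open>?h\<close> is multiplication by 2 + i followed by
  conjugation, which keeps both coordinates congruent to 3 modulo 4.\<close>

lemma psi_square_5:
  "X * (psi oo X ^ 5) ^ 2 = ps5 2 * ps5 0 + ps5 0 * ps5 1 + ps5 3 * ps5 2 + ps5 1 * ps5 3 + ps5 4 * ps5 4"
proof -
  let ?L = "{(x, y). x mod 5 = (2 - 2 * (y mod 5)) mod (5::int)}"
  let ?h = "\<lambda>(x, y). (2 * x - y, 1 - x - 2 * y) :: int \<times> int"
  have "(psi oo X ^ 5) ^ 2 = psi ^ 2 oo X ^ 5" by (simp add: fps_compose_power)
  also have "\<dots> = gf (\<lambda>z. 5 * lat psie z) (wlat (\<lambda>_. 1)) UNIV"
    unfolding psi_def by (simp add: gf_square_lat gf_compose_X_power)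
  also have "X * \<dots> = gf (\<lambda>z. 1 + 5 * lat psie z) (wlat (\<lambda>_. 1)) UNIV"
    using gf_X_power[of 1 "\<lambda>z. 5 * lat psie z"] by simp
  also have "\<dots> = gf (lat psie) (wlat (\<lambda>_. 1)) ?L"
  proof (rule gf_reindex[symmetric])
    show "bij_betw ?h UNIV ?L"
    proof (rule bij_betwI[where g = "\<lambda>(x, y). ((2 * x + 1 - y) div 5, (2 - 2 * y - x) div 5)"])
      show "?h \<in> UNIV \<rightarrow> ?L"
      proof (clarsimp)
        fix x y :: int
        have "(2 * x - y) mod 5 = (2 - 2 * (1 - x - 2 * y)) mod 5"
          by (simp add: mod_eq_dvd_iff algebra_simps)
        also have "\<dots> = (2 - 2 * ((1 - x - 2 * y) mod 5)) mod 5" by (metis mod_diff_right_eq mod_mult_right_eq)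
        finally show "(2 * x - y) mod 5 = (2 - 2 * ((1 - x - 2 * y) mod 5)) mod 5" .
      qed
    next
      fix z assume "z \<in> ?L"
      then obtain x y where z: "z = (x, y)" "x mod 5 = (2 - 2 * (y mod 5)) mod 5" by auto
      have "x mod 5 = (2 - 2 * y) mod 5" using z(2) by (metis mod_diff_right_eq mod_mult_right_eq)
      then obtain k where "x - (2 - 2 * y) = 5 * k" by (auto simp: mod_eq_dvd_iff elim!: dvdE)
      hence "2 * x + 1 - y = 5 * (1 - y + 2 * k)" "2 - 2 * y - x = 5 * (- k)" and x: "x = 2 - 2 * y + 5 * k" by auto
      hence "(2 * x + 1 - y) div 5 = 1 - y + 2 * k" "(2 - 2 * y - x) div 5 = - k" by (simp_all only:) simp_all
      thus "?h (case z of (x, y) \<Rightarrow> ((2 * x + 1 - y) div 5, (2 - 2 * y - x) div 5)) = z"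
        unfolding z(1) by (simp add: x)
    qed auto
    fix z :: "int \<times> int"
    obtain x y where z: "z = (x, y)" by force
    have "int (lat psie (?h z)) = int (1 + 5 * lat psie z)" by (simp add: z lat_def algebra_simps)
    thus "lat psie (?h z) = 1 + 5 * lat psie z" by linarith
  qed (auto simp: wlat_def)
  also have "\<dots> = (\<Sum>r\<in>{0, 1, 2, 3, 4}. ps5 ((2 - 2 * r) mod 5) * ps5 r)"
    by (rule gf_lattice_partition) auto
  also have "\<dots> = ps5 2 * ps5 0 + ps5 0 * ps5 1 + ps5 3 * ps5 2 + ps5 1 * ps5 3 + ps5 4 * ps5 4"
    by (simp add: add.assoc)
  finally show ?thesis .
qed

lemma bij_betw_mod5:
  assumes "r \<in> {0..<5}"
  shows "bij_betw (\<lambda>k. 5 * k + r) UNIV {x. x mod 5 = (r::int)}"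
  by (rule bij_betwI[where g = "\<lambda>x. x div 5"]) (use assms in auto)

lemma ph5_reflect: "ph5 4 = ph5 1" "ph5 3 = ph5 2"
proof -
  have 1: "bij_betw uminus {x. x mod 5 = (1::int)} {x. x mod 5 = 4}"
    by (rule bij_betwI[where g = uminus]) (auto, presburger+)
  have 2: "bij_betw uminus {x. x mod 5 = (2::int)} {x. x mod 5 = 3}"
    by (rule bij_betwI[where g = uminus]) (auto, presburger+)
  show "ph5 4 = ph5 1" "ph5 3 = ph5 2"
    by (rule gf_reindex[OF 1] gf_reindex[OF 2]; simp add: par_minus sq_def)+
qed

text \<open>Squares are 0, 1 or 4 modulo 5, so these three terms are the components of
  \<open>phim\<close> in those exponent classes.\<close>

lemma phim_dissect: "phim = ph5 0 + 2 * ph5 1 + 2 * ph5 2"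
proof -
  have "phim = (\<Sum>r\<in>{0, 1, 2, 3, 4}. gf sq par {x\<in>UNIV. x mod 5 = r})"
    unfolding phim_def by (rule gf_partition) (use mod5_cases in auto)
  also have "\<dots> = ph5 0 + 2 * ph5 1 + 2 * ph5 2"
    by (simp add: ph5_reflect algebra_simps)
  finally show ?thesis .
qed

lemma ph5_0: "ph5 0 = phim oo X ^ 25"
  unfolding phim_def
proof (subst gf_compose_X_power, simp, rule gf_reindex[OF bij_betw_mod5])
  fix k :: int
  have "int (sq (5 * k + 0)) = int (25 * sq k)" by (simp add: algebra_simps)
  thus "sq (5 * k + 0) = 25 * sq k" by linarith
  show "par (5 * k + 0) = par k" by (auto simp: par_def)
qed auto

lemma ph5_1: "ph5 1 = - X * (gf (\<lambda>j. 7 * tri j + 3 * tri (- j)) par UNIV oo X ^ 5)"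
proof -
  have "ph5 1 = gf (\<lambda>k. 1 + 5 * (7 * tri k + 3 * tri (- k))) (\<lambda>k. - 1 * par k) UNIV"
  proof (rule gf_reindex[OF bij_betw_mod5])
    fix k :: int
    have "int (sq (5 * k + 1)) = int (1 + 5 * (7 * tri k + 3 * tri (- k)))"
      using of_nat_tri[of k] tri_minus[of k] by (simp add: algebra_simps)
    thus "sq (5 * k + 1) = 1 + 5 * (7 * tri k + 3 * tri (- k))" by linarith
    show "par (5 * k + 1) = - 1 * par k" by (auto simp: par_def)
  qed auto
  also have "\<dots> = fps_const (- 1) * (X ^ 1 * gf (\<lambda>k. 5 * (7 * tri k + 3 * tri (- k))) par UNIV)"
    by (subst gf_X_power, subst gf_const) simp
  finally show ?thesis by (simp add: gf_compose_X_power flip: fps_const_neg)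
qed

lemma ph5_2: "ph5 2 = X ^ 4 * (gf (\<lambda>j. 9 * tri j + 1 * tri (- j)) par UNIV oo X ^ 5)"
proof -
  have "ph5 2 = gf (\<lambda>k. 4 + 5 * (9 * tri k + 1 * tri (- k))) par UNIV"
  proof (rule gf_reindex[OF bij_betw_mod5])
    fix k :: int
    have "int (sq (5 * k + 2)) = int (4 + 5 * (9 * tri k + 1 * tri (- k)))"
      using of_nat_tri[of k] tri_minus[of k] by (simp add: algebra_simps)
    thus "sq (5 * k + 2) = 4 + 5 * (9 * tri k + 1 * tri (- k))" by linarith
    show "par (5 * k + 2) = par k" by (auto simp: par_def)
  qed auto
  also have "\<dots> = X ^ 4 * gf (\<lambda>k. 5 * (9 * tri k + 1 * tri (- k))) par UNIV"
    by (subst gf_X_power) simp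
  finally show ?thesis by (simp add: gf_compose_X_power)
qed

lemma ps5_4: "ps5 4 = X ^ 3 * (psi oo X ^ 25)"
proof -
  have bij: "bij_betw (\<lambda>k. 5 * k - 1) UNIV {x. x mod 5 = (4::int)}"
    by (rule bij_betwI[where g = "\<lambda>x. (x + 1) div 5"]) (auto, presburger+)
  have "ps5 4 = gf (\<lambda>k. 3 + 25 * psie k) (\<lambda>_. 1) UNIV"
  proof (rule gf_reindex[OF bij])
    fix k :: int
    have "int (psie (5 * k - 1)) = int (3 + 25 * psie k)" by (simp add: algebra_simps)
    thus "psie (5 * k - 1) = 3 + 25 * psie k" by linarith
  qed auto
  thus ?thesis by (simp add: psi_def gf_compose_X_power gf_X_power)
qed

text \<open>Two residue classes of j whose exponents are congruent modulo 5 are interleaved into a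
  single theta series: even m run through class a, odd m through class b. The pairs are 0, 3 and 1,
  2.\<close>

lemma ps5_pair:
  fixes a b :: int
  defines "h \<equiv> \<lambda>m. if even m then 5 * (m div 2) + a else b - 5 * ((m + 1) div 2)"
  assumes ab: "0 \<le> a" "a < b" "b < 5" and e: "\<And>m. int (psie (h m)) = int (c + 5 * e m)"
  shows "ps5 a + ps5 b = X ^ c * (gf e (\<lambda>_. 1) UNIV oo X ^ 5)"
proof -
  let ?U = "{x. x mod 5 = a} \<union> {x. x mod 5 = b}"
  let ?g = "\<lambda>x. if x mod 5 = a then 2 * (x div 5) else - 2 * (x div 5) - 1"
  have bij: "bij_betw h UNIV ?U"
  proof (rule bij_betwI[where g = ?g])
    have *: "h m \<in> ?U \<and> ?g (h m) = m" for m
    proof (cases "even m")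
      case True
      then obtain k where "m = 2 * k" by auto
      thus ?thesis using ab by (simp add: h_def)
    next
      case False
      hence "odd (- m)" by simp
      then obtain k where "- m = 2 * k + 1" by (elim oddE)
      hence m: "m = - 2 * k - 1" and "m + 1 = 2 * (- k)" by simp_all
      hence "(m + 1) div 2 = - k" by (simp only: nonzero_mult_div_cancel_left)
      hence h: "h m = b + 5 * k" using False by (simp add: h_def)
      show ?thesis using ab unfolding h unfolding m by simp
    qed
    show "h \<in> UNIV \<rightarrow> ?U" using * by blast
    show "?g (h m) = m" for m using * by blast
    fix y :: int assume y: "y \<in> ?U"
    hence "y = 5 * (y div 5) + a \<or> y = 5 * (y div 5) + b" using mult_div_mod_eq[of 5 y] by auto
    then obtain k where "y = 5 * k + a \<or> y = 5 * k + b" by blast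
    moreover have "(- (2 * k) - 1) div 2 = - k - 1" by presburger
    ultimately show "h (?g y) = y" using ab by (auto simp: h_def)
  qed auto
  have "ps5 a + ps5 b = gf psie (\<lambda>_. 1) ?U"
    using ab by (intro gf_Un[symmetric]) auto
  also have "\<dots> = gf (\<lambda>m. c + 5 * e m) (\<lambda>_. 1) UNIV"
    using e by (intro gf_reindex[OF bij]) (simp_all only: of_nat_eq_iff)
  also have "\<dots> = X ^ c * gf (\<lambda>m. 5 * e m) (\<lambda>_. 1) UNIV"
    by (rule gf_X_power[symmetric])
  finally show ?thesis by (simp add: gf_compose_X_power)
qed

lemma ps5_03: "ps5 0 + ps5 3 = gf (\<lambda>j. 2 * tri j + 3 * tri (- j)) (\<lambda>_. 1) UNIV oo X ^ 5"
  and ps5_12: "ps5 1 + ps5 2 = X * (gf (\<lambda>j. 4 * tri j + 1 * tri (- j)) (\<lambda>_. 1) UNIV oo X ^ 5)"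
proof -
  have "int (psie (if even m then 5 * (m div 2) + 0 else 3 - 5 * ((m + 1) div 2))) =
      int (0 + 5 * (2 * tri m + 3 * tri (- m)))"
    "int (psie (if even m then 5 * (m div 2) + 1 else 2 - 5 * ((m + 1) div 2))) =
      int (1 + 5 * (4 * tri m + 1 * tri (- m)))" for m
  proof -
    consider k where "m = 2 * k" | k where "m = 2 * k + 1" by (cases "even m") (blast elim: evenE oddE)+
    thus "int (psie (if even m then 5 * (m div 2) + 0 else 3 - 5 * ((m + 1) div 2))) =
        int (0 + 5 * (2 * tri m + 3 * tri (- m)))"
      "int (psie (if even m then 5 * (m div 2) + 1 else 2 - 5 * ((m + 1) div 2))) =
        int (1 + 5 * (4 * tri m + 1 * tri (- m)))"
      using of_nat_tri[of m] tri_minus[of m] by (cases; simp add: algebra_simps)+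
  qed
  from ps5_pair[OF _ _ _ this(1)] ps5_pair[OF _ _ _ this(2)]
  show "ps5 0 + ps5 3 = gf (\<lambda>j. 2 * tri j + 3 * tri (- j)) (\<lambda>_. 1) UNIV oo X ^ 5"
    "ps5 1 + ps5 2 = X * (gf (\<lambda>j. 4 * tri j + 1 * tri (- j)) (\<lambda>_. 1) UNIV oo X ^ 5)"
    by simp_all
qed

subsection \<open>Binary dissections\<close>

text \<open>The first two identities split the squares by parity; odd squares come from (4k - 1)^2,
  each twice up to sign. The last two evaluate the sum over the lattice x = y modulo 2 in two
  ways.\<close>

lemma phi_phim_dissect_2:
  defines "a \<equiv> phi oo X ^ 4" and "b \<equiv> 2 * X * (psi oo X ^ 8)"
  shows "phi = a + b" "phim = a - b"
    "a ^ 2 + b ^ 2 = (phi oo X ^ 2) ^ 2" "a ^ 2 - b ^ 2 = (phim oo X ^ 2) ^ 2"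
proof -
  let ?E = "{j::int. even j}" and ?O = "{j::int. odd j}"
  have a: "gf sq (\<lambda>_. 1) ?E = a"
  proof -
    have "bij_betw (\<lambda>k. 2 * k) UNIV ?E" by (rule bij_betwI[where g = "\<lambda>j. j div 2"]) auto
    hence "gf sq (\<lambda>_. 1) ?E = gf (\<lambda>k. 4 * sq k) (\<lambda>_. 1 :: complex) UNIV"
    proof (rule gf_reindex)
      fix k :: int
      have "int (sq (2 * k)) = int (4 * sq k)" by (simp add: algebra_simps)
      thus "sq (2 * k) = 4 * sq k" by linarith
    qed auto
    thus ?thesis by (simp add: a_def phi_def gf_compose_X_power)
  qed
  have b1: "gf sq (\<lambda>_. 1) {j. j mod 4 = 3} = X * (psi oo X ^ 8)"
  proof -
    have "bij_betw (\<lambda>k. 4 * k - 1) UNIV {j. j mod 4 = (3::int)}"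
      by (rule bij_betwI[where g = "\<lambda>j. (j + 1) div 4"]) (auto, presburger+)
    hence "gf sq (\<lambda>_. 1) {j. j mod 4 = 3} = gf (\<lambda>k. 1 + 8 * psie k) (\<lambda>_. 1 :: complex) UNIV"
    proof (rule gf_reindex)
      fix k :: int
      have "int (sq (4 * k - 1)) = int (1 + 8 * psie k)" by (simp add: algebra_simps)
      thus "sq (4 * k - 1) = 1 + 8 * psie k" by linarith
    qed auto
    thus ?thesis using gf_X_power[of 1 "\<lambda>k. 8 * psie k" "\<lambda>_. 1 :: complex" UNIV]
      by (simp add: psi_def gf_compose_X_power)
  qed
  have b2: "gf sq (\<lambda>_. 1 :: complex) {j. j mod 4 = 1} = gf sq (\<lambda>_. 1) {j. j mod 4 = 3}"
  proof -
    have "bij_betw uminus {j. j mod 4 = (3::int)} {j. j mod 4 = 1}"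
      by (rule bij_betwI[where g = uminus]) (auto, presburger+)
    thus ?thesis by (rule gf_reindex) (auto simp: sq_def)
  qed
  have b: "gf sq (\<lambda>_. 1) ?O = b"
  proof -
    have "odd j \<longleftrightarrow> j mod 4 = 3 \<or> j mod 4 = 1" for j :: int
    proof -
      have "0 \<le> j mod 4" "j mod 4 < 4" by auto
      hence "j mod 4 = 0 \<or> j mod 4 = 1 \<or> j mod 4 = 2 \<or> j mod 4 = 3" by linarith
      moreover have "odd j \<longleftrightarrow> odd (j mod 4)" by (simp add: dvd_mod_iff)
      ultimately show ?thesis by auto
    qed
    hence "?O = {j. j mod 4 = 3} \<union> {j. j mod 4 = 1}" by (simp only: Collect_disj_eq[symmetric])
    moreover have "gf sq (\<lambda>_. 1 :: complex) ({j. j mod 4 = 3} \<union> {j. j mod 4 = 1}) =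
        gf sq (\<lambda>_. 1) {j. j mod 4 = 3} + gf sq (\<lambda>_. 1) {j. j mod 4 = 1}"
    proof (rule gf_Un)
      show "ffib sq ({j. j mod 4 = 3} \<union> {j. j mod 4 = 1})" by (rule ffib_sq)
      show "{j. j mod 4 = (3 :: int)} \<inter> {j. j mod 4 = 1} = {}" by force
    qed
    ultimately have "gf sq (\<lambda>_. 1 :: complex) ?O =
        gf sq (\<lambda>_. 1) {j. j mod 4 = 3} + gf sq (\<lambda>_. 1) {j. j mod 4 = 1}" by (rule ssubst)
    thus ?thesis by (simp add: b1 b2 b_def)
  qed
  have am: "gf sq par ?E = a"
    unfolding a[symmetric] by (rule gf_cong) (auto simp: par_def)
  have bm: "gf sq par ?O = - b"
  proof -
    have "gf sq par ?O = gf sq (\<lambda>_. - 1 * 1) ?O" by (rule gf_cong) (auto simp: par_def)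
    also have "\<dots> = fps_const (- 1) * gf sq (\<lambda>_. 1) ?O" by (simp only: gf_const)
    finally show ?thesis by (simp add: b flip: fps_const_neg)
  qed
  have U: "(UNIV :: int set) = ?E \<union> ?O" by auto
  show "phi = a + b"
    unfolding phi_def a[symmetric] b[symmetric] by (subst U, rule gf_Un) auto
  have "phim = gf sq par ?E + gf sq par ?O"
    unfolding phim_def by (subst U, rule gf_Un) auto
  thus "phim = a - b" by (simp add: am bm)

  \<comment> \<open>This lattice consists of the multiples of 1 + i; \<open>?h\<close> is the
    corresponding parametrization and doubles the norm. The sign of s + t becomes the sign of x
    alone.\<close>
  let ?L = "{(x, y). even x = even (y :: int)} :: (int \<times> int) set"
  let ?h = "\<lambda>(s, t). (s + t, s - t) :: int \<times> int"
  have ff: "ffib (lat sq) UNIV" using ffib_prod[OF ffib_sq ffib_sq, of UNIV UNIV] by (simp add: lat_def)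
  have bij: "bij_betw ?h UNIV ?L"
  proof (rule bij_betwI[where g = "\<lambda>(x, y). ((x + y) div 2, (x - y) div 2)"])
    fix z assume "z \<in> ?L"
    then obtain x y where z: "z = (x, y)" "even x = even y" by auto
    hence "even (x - y)" by simp
    then obtain k where "x - y = 2 * k" by (elim evenE)
    hence "x = y + 2 * k" by simp
    thus "?h (case z of (x, y) \<Rightarrow> ((x + y) div 2, (x - y) div 2)) = z" by (simp add: z(1))
  qed auto
  have L: "?L = ?E \<times> ?E \<union> ?O \<times> ?O" by auto
  have e: "lat sq (?h z) = 2 * lat sq z" for z
  proof -
    obtain s t where z: "z = (s, t)" by force
    have "int (lat sq (?h z)) = int (2 * lat sq z)" by (simp add: z lat_def algebra_simps)
    thus ?thesis by linarith
  qed
  have "(phi oo X ^ 2) ^ 2 = phi ^ 2 oo X ^ 2" by (simp add: fps_compose_power)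
  also have "\<dots> = gf (\<lambda>z. 2 * lat sq z) (wlat (\<lambda>_. 1)) UNIV"
    unfolding phi_def by (simp add: gf_square_lat gf_compose_X_power)
  also have "\<dots> = gf (lat sq) (\<lambda>_. 1) ?L"
    by (rule gf_reindex[OF bij, symmetric]) (auto simp: e wlat_def)
  also have "\<dots> = gf (lat sq) (\<lambda>_. 1) (?E \<times> ?E) + gf (lat sq) (\<lambda>_. 1) (?O \<times> ?O)"
    unfolding L by (rule gf_Un) (auto intro: ffib_subset[OF ff])
  also have "gf (lat sq) (\<lambda>_. 1) (?E \<times> ?E) = a ^ 2"
    unfolding a[symmetric] power2_eq_square by (subst gf_mult) (auto simp: lat_def intro!: gf_cong)
  also have "gf (lat sq) (\<lambda>_. 1) (?O \<times> ?O) = b ^ 2"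
    unfolding b[symmetric] power2_eq_square by (subst gf_mult) (auto simp: lat_def intro!: gf_cong)
  finally show "a ^ 2 + b ^ 2 = (phi oo X ^ 2) ^ 2" ..
  have "(phim oo X ^ 2) ^ 2 = phim ^ 2 oo X ^ 2" by (simp add: fps_compose_power)
  also have "\<dots> = gf (\<lambda>z. 2 * lat sq z) (wlat par) UNIV"
    unfolding phim_def by (simp add: gf_square_lat gf_compose_X_power)
  also have "\<dots> = gf (lat sq) (\<lambda>(x, y). par x) ?L"
    by (rule gf_reindex[OF bij, symmetric]) (auto simp: e wlat_def par_add)
  also have "\<dots> = gf (lat sq) (\<lambda>(x, y). par x) (?E \<times> ?E) + gf (lat sq) (\<lambda>(x, y). par x) (?O \<times> ?O)"
    unfolding L by (rule gf_Un) (auto intro: ffib_subset[OF ff])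
  also have "gf (lat sq) (\<lambda>(x, y). par x) (?E \<times> ?E) = a ^ 2"
    unfolding a[symmetric] power2_eq_square
    by (subst gf_mult) (auto simp: lat_def par_def intro!: gf_cong)
  also have "gf (lat sq) (\<lambda>(x, y). par x) (?O \<times> ?O) = (- b) * b"
    unfolding bm[symmetric] unfolding b[symmetric]
    by (subst gf_mult) (auto simp: lat_def intro!: gf_cong)
  finally show "a ^ 2 - b ^ 2 = (phim oo X ^ 2) ^ 2" by (simp add: power2_eq_square)
qed

lemma phi_nth_0 [simp]: "phi $ 0 = 1" and phim_nth_0 [simp]: "phim $ 0 = 1" and psi_nth_0 [simp]: "psi $ 0 = 1"
  and phi_nth_1: "phi $ 1 = 2" and phim_nth_1: "phim $ 1 = - 2"
proof -
  have s0: "{j. sq j = 0} = {0}" "{j. sq j = Suc 0} = {1, -1}"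
    by (auto simp: sq_def nat_eq_iff zmult_eq_1_iff intro: antisym abs_le_square
         dest!: arg_cong[of _ _ int])
  have p0: "{j. psie j = 0} = {0}"
  proof -
    have "j = 0" if "psie j = 0" for j
    proof -
      have "2 * (j * j) - j = 0" using of_nat_psie[of j] that by simp
      thus ?thesis using abs_le_square[of j] by linarith
    qed
    thus ?thesis by (auto simp: psie_def)
  qed
  show "phi $ 0 = 1" "phim $ 0 = 1" "psi $ 0 = 1" "phi $ 1 = 2" "phim $ 1 = - 2"
    unfolding phi_def phim_def psi_def gf_def fps_nth_Abs_fps
    by (simp_all add: s0 p0 par_def)
qed

lemma compose_X_power_nonzero [simp]: "k > 0 \<Longrightarrow> f \<noteq> 0 \<Longrightarrow> f oo X ^ k \<noteq> 0"
  by (simp add: fps_compose_eq_0_iff)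

lemma theta_nonzero [simp]: "phi \<noteq> 0" "phim \<noteq> 0" "psi \<noteq> 0"
  using phi_nth_0 phim_nth_0 psi_nth_0 by (metis fps_zero_nth zero_neq_one)+

lemma psi_square_eq: "psi ^ 2 = phi * (psi oo X ^ 2)"
proof -
  have "(psi * eu 1) oo X ^ 2 = eu 2 ^ 2 oo X ^ 2" by (simp only: psi_prod)
  hence "(psi oo X ^ 2) * eu 2 = eu 4 ^ 2"
    by (simp add: fps_compose_mult_distrib eu_compose flip: fps_compose_power)
  hence "(psi ^ 2 - phi * (psi oo X ^ 2)) * (eu 1 ^ 2 * eu 4 ^ 2 * eu 2) = 0"
    using phi_prod psi_prod by algebra
  thus ?thesis by simp
qed

text \<open>Jacobi's quartic theta identity. The difference (a + b)^4 - (a - b)^4 is 8 a b (a^2 +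
  b^2), and \<open>psi_square_eq\<close> at q^4 and at q^2 collects the factors.\<close>

lemma phi4_minus_phim4: "phi ^ 4 - phim ^ 4 = 16 * X * (psi oo X ^ 2) ^ 4"
proof -
  define a b where "a = phi oo X ^ 4" and "b = 2 * X * (psi oo X ^ 8)"
  note d = phi_phim_dissect_2[folded a_def b_def]
  have c: "X ^ 2 oo X ^ k = X ^ (2 * k)" if "k > 0" for k
    using that by (simp add: fps_X_power_compose power_mult mult.commute flip: power_mult)
  have "psi ^ 2 oo X ^ k = (phi * (psi oo X ^ 2)) oo X ^ k" for k by (simp add: psi_square_eq)
  hence *: "(psi oo X ^ k) ^ 2 = (phi oo X ^ k) * (psi oo X ^ (2 * k))" if "k > 0" for k
    using that
    by (simp add: fps_compose_power fps_compose_mult_distrib fps_compose_assoc[symmetric] c)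
  have "phi ^ 4 - phim ^ 4 = 8 * a * b * (a ^ 2 + b ^ 2)"
    unfolding d(1,2) by (simp add: algebra_simps power2_eq_square power4_eq_xxxx)
  also have "\<dots> = 16 * X * (((phi oo X ^ 4) * (psi oo X ^ 8)) * (phi oo X ^ 2) ^ 2)"
    unfolding d(3) by (simp add: a_def b_def)
  also have "(phi oo X ^ 4) * (psi oo X ^ 8) = (psi oo X ^ 4) ^ 2" using *[of 4] by simp
  also have "(psi oo X ^ 4) ^ 2 * (phi oo X ^ 2) ^ 2 = (psi oo X ^ 2) ^ 4"
  proof -
    have "(psi oo X ^ 2) ^ 4 = ((psi oo X ^ 2) ^ 2) ^ 2" by (simp flip: power_mult)
    also have "(psi oo X ^ 2) ^ 2 = (phi oo X ^ 2) * (psi oo X ^ 4)" using *[of 2] by simp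
    finally show ?thesis by (simp only: power_mult_distrib mult.commute)
  qed
  finally show ?thesis .
qed

subsection \<open>Four triangular numbers via the arithmetic-geometric mean\<close>

definition theta :: "complex fps \<Rightarrow> complex fps" where "theta f = X * fps_deriv f"

lemma theta_mult: "theta (f * g) = theta f * g + f * theta g"
  and theta_add: "theta (f + g) = theta f + theta g"
  by (simp_all add: theta_def algebra_simps)

lemma theta_square: "theta (f ^ 2) = 2 * f * theta f"
  by (simp add: theta_def fps_deriv_power algebra_simps power2_eq_square)

lemma theta_compose_square: "theta (f oo X ^ 2) = 2 * (theta f oo X ^ 2)"
  by (simp add: theta_def fps_compose_deriv fps_compose_mult_distrib fps_deriv_power power2_eq_square
      algebra_simps numeral_fps_const)

lemma theta_nth [simp]: "theta f $ n = of_nat n * f $ n"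
  by (cases n) (simp_all add: theta_def)

text \<open>Let \<open>W\<close> be the Wronskian of \<open>phi\<close> and \<open>phim\<close> and \<open>C = (phi\<^sup>4 - phim\<^sup>4) phi phim\<close>. The difference
  \<open>F = 4 W - C\<close> satisfies \<open>8 phi (q\<^sup>2) phim (q\<^sup>2) F (q\<^sup>2) = (phi\<^sup>2 - phim\<^sup>2) F (q)\<close>, which is the
  arithmetic-geometric mean step; comparing lowest exponents leaves only \<open>F = 0\<close>.\<close>

lemma log_deriv_phi_phim:
  "theta phi * phim - theta phim * phi = 4 * X * (psi oo X ^ 2) ^ 4 * phi * phim"
proof -
  define p m where "p = phi" and "m = phim"
  define p1 m1 where "p1 = p oo X ^ 2" and "m1 = m oo X ^ 2"
  define W where "W = theta p * m - theta m * p"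
  define C where "C = (p ^ 4 - m ^ 4) * (p * m)"
  define F where "F = 4 * W - C"
  define a b where "a = phi oo X ^ 4" and "b = 2 * X * (psi oo X ^ 8)"
  note d = phi_phim_dissect_2[folded a_def b_def p_def m_def, folded p1_def m1_def]
  \<comment> \<open>The squares of the theta functions at q^2 are the arithmetic and the geometric
    mean of the squares at q.\<close>
  have 1: "2 * p1 ^ 2 = p ^ 2 + m ^ 2" "m1 ^ 2 = p * m"
    unfolding d(3,4)[symmetric] d(1,2) by (simp_all add: algebra_simps power2_eq_square)
  have "theta (p1 ^ 2 + p1 ^ 2) = theta (p ^ 2 + m ^ 2)" and t2: "theta (m1 ^ 2) = theta (p * m)"
    using 1 by (simp_all only: mult_2)
  hence "2 * (2 * p1 * theta p1) = 2 * (p * theta p + m * theta m)"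
    unfolding theta_add theta_square by algebra
  hence "2 * p1 * theta p1 = p * theta p + m * theta m"
    by (rule mult_left_cancel[THEN iffD1, rotated]) simp
  moreover have "2 * m1 * theta m1 = theta p * m + p * theta m"
    using t2 by (simp only: theta_square theta_mult)
  ultimately have 2: "4 * (theta p1 * m1 - theta m1 * p1) * (p1 * m1) = W * (p ^ 2 - m ^ 2)"
    using 1 unfolding W_def by algebra
  have W1: "theta p1 * m1 - theta m1 * p1 = 2 * (W oo X ^ 2)"
    by (simp add: p1_def m1_def W_def theta_compose_square fps_compose_sub_distrib
        fps_compose_mult_distrib algebra_simps)
  have C1: "C oo X ^ 2 = (p1 ^ 4 - m1 ^ 4) * (p1 * m1)"
    by (simp add: C_def p1_def m1_def fps_compose_sub_distrib fps_compose_mult_distrib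
        flip: fps_compose_power)
  have w8: "8 * (W oo X ^ 2) * (p1 * m1) = W * (p ^ 2 - m ^ 2)"
    using 2 W1 by algebra
  have c8: "8 * (C oo X ^ 2) * (p1 * m1) = C * (p ^ 2 - m ^ 2)"
    using 1 C1 C_def by algebra
  have Fc: "F oo X ^ 2 = 4 * (W oo X ^ 2) - (C oo X ^ 2)"
    by (simp add: F_def fps_compose_sub_distrib fps_compose_mult_distrib)
  have "8 * (F oo X ^ 2) * (p1 * m1) = 4 * (8 * (W oo X ^ 2) * (p1 * m1)) - 8 * (C oo X ^ 2) * (p1 * m1)"
    unfolding Fc by (simp only: left_diff_distrib right_diff_distrib mult.assoc mult.left_commute)
  also have "\<dots> = F * (p ^ 2 - m ^ 2)"
    unfolding w8 c8 F_def by (simp only: left_diff_distrib mult.assoc)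
  finally have eq: "8 * (F oo X ^ 2) * (p1 * m1) = F * (p ^ 2 - m ^ 2)" .
  have Ceq: "C = 16 * X * (psi oo X ^ 2) ^ 4 * (p * m)"
    using phi4_minus_phim4 by (simp add: C_def p_def m_def)
  have c1: "(X * f) $ 1 = f $ 0" for f :: "complex fps" by simp
  \<comment> \<open>Comparing orders in \<open>eq\<close> allows a nonzero F only the order 1, so it
    is these two coefficients that must be seen to vanish.\<close>
  have F1: "F $ 0 = 0" "F $ 1 = 0"
  proof -
    have "W $ 0 = 0" by (simp add: W_def fps_mult_nth)
    moreover have "C $ 0 = 0" by (simp add: Ceq)
    ultimately show "F $ 0 = 0" by (simp add: F_def)
    have "W $ 1 = 4"
      using phi_nth_1 phim_nth_1 by (simp add: W_def fps_mult_nth p_def m_def)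
    moreover have "C $ 1 = 16"
    proof -
      have "C = X * (16 * (psi oo X ^ 2) ^ 4 * (p * m))" by (simp add: Ceq mult_ac)
      hence "C $ 1 = (16 * (psi oo X ^ 2) ^ 4 * (p * m)) $ 0" by (simp only: c1)
      also have "\<dots> = 16" by (simp add: p_def m_def fps_power_zeroth)
      finally show ?thesis .
    qed
    ultimately show "F $ 1 = 0" by (simp add: F_def numeral_fps_const)
  qed
  have "F = 0"
  proof (rule ccontr)
    assume F: "F \<noteq> 0"
    have pm0: "p \<noteq> 0" "m \<noteq> 0" "p1 \<noteq> 0" "m1 \<noteq> 0" by (simp_all add: p_def m_def p1_def m1_def)
    have s0: "subdegree (p1 * m1) = 0"
      by (rule subdegree_eq_0) (simp add: p1_def m1_def p_def m_def)
    have pm: "p ^ 2 - m ^ 2 = 4 * a * b" unfolding d(1,2) by (simp add: algebra_simps power2_eq_square)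
    have "(p ^ 2 - m ^ 2) $ 0 = 0" by (simp add: p_def m_def fps_power_zeroth)
    moreover have "(p ^ 2 - m ^ 2) $ 1 = 8"
      using phi_nth_1 phim_nth_1 by (simp add: p_def m_def power2_eq_square fps_mult_nth)
    ultimately have s1: "subdegree (p ^ 2 - m ^ 2) = 1"
      by (intro subdegreeI) auto
    have nz: "p ^ 2 - m ^ 2 \<noteq> 0" using s1 by force
    have "subdegree (8 * (F oo X ^ 2) * (p1 * m1)) = 2 * subdegree F"
    proof -
      have "F oo X ^ 2 \<noteq> 0" using F by simp
      moreover have "subdegree (8 :: complex fps) = 0" by (rule subdegree_eq_0) (simp add: numeral_fps_const)
      ultimately show ?thesis using F pm0 s0 by (simp add: mult.commute)
    qed
    moreover have "subdegree (F * (p ^ 2 - m ^ 2)) = subdegree F + 1"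
      using F nz s1 by simp
    ultimately have "subdegree F = 1" using eq by simp
    thus False using F F1 by (metis nth_subdegree_nonzero)
  qed
  hence "4 * W = 4 * (4 * X * (psi oo X ^ 2) ^ 4 * phi * phim)"
    using Ceq by (simp add: F_def p_def m_def mult_ac)
  hence "W = 4 * X * (psi oo X ^ 2) ^ 4 * phi * phim"
    by (rule mult_left_cancel[THEN iffD1, rotated]) simp
  thus ?thesis by (simp only: W_def p_def m_def)
qed

definition sg :: "nat \<Rightarrow> nat" where "sg n = (\<Sum>d | d dvd n. d)"

definition divs :: "complex fps" where "divs = Abs_fps (\<lambda>n. if n = 0 then 0 else of_nat (sg n))"

text \<open>The logarithmic derivative of Euler's product: factor l contributes minus the Lambert
  series \<open>g l\<close> = (l+1) q^(l+1) / (1 - q^(l+1)), and these add up to divisor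
  sums.\<close>

lemma theta_eu_1: "theta (eu 1) = - divs * eu 1"
proof -
  define P where "P n = (\<Prod>l<n. 1 - X ^ Suc l)" for n
  define g where "g l = Abs_fps (\<lambda>m. if m > 0 \<and> Suc l dvd m then of_nat (Suc l) else 0 :: complex)" for l
  have th: "theta (1 - X ^ Suc l) = - g l * (1 - X ^ Suc l)" for l
  proof -
    have "theta (1 - X ^ Suc l) $ m = (- g l * (1 - X ^ Suc l)) $ m" for m
    proof -
      have "(- g l * (1 - X ^ Suc l)) $ m = (X ^ Suc l * g l) $ m - g l $ m"
        by (simp add: algebra_simps)
      also have "\<dots> = (if m < Suc l then 0 else g l $ (m - Suc l)) - g l $ m"
        by (simp only: fps_X_power_mult_nth)
      also have "\<dots> = theta (1 - X ^ Suc l) $ m"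
      proof -
        consider "m < Suc l" | "m = Suc l" | "m > Suc l" by linarith
        thus ?thesis
        proof cases
          case 3
          hence "Suc l dvd m - Suc l \<longleftrightarrow> Suc l dvd m" by (simp add: dvd_minus_self)
          thus ?thesis using 3 by (simp add: g_def fps_X_power_nth del: power_Suc)
        qed (auto simp: g_def fps_X_power_nth dest: dvd_imp_le simp del: power_Suc)
      qed
      finally show ?thesis ..
    qed
    thus ?thesis by (simp add: fps_eq_iff)
  qed
  have P: "theta (P n) = - (\<Sum>l<n. g l) * P n" for n
  proof (induction n)
    case (Suc n)
    have "theta (P (Suc n)) = theta (P n) * (1 - X ^ Suc n) + P n * theta (1 - X ^ Suc n)"
      by (simp add: P_def theta_mult)
    also have "\<dots> = - (\<Sum>l<Suc n. g l) * (P n * (1 - X ^ Suc n))"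
      unfolding Suc th by (simp only: sum.lessThan_Suc) (simp add: algebra_simps)
    finally show ?case by (simp add: P_def)
  qed (simp add: P_def theta_def)
  have fth: "fcong n f h \<Longrightarrow> fcong n (theta f) (theta h)" for n f h by (simp add: fcong_def)
  have Pe: "fcong n (P n) (eu 1)" for n
    using iprod_fcong[OF convp_eu[of 1], of n n] by (simp add: P_def eu_def)
  have gd: "fcong n (\<Sum>l<n. g l) divs" for n
    unfolding fcong_def
  proof safe
    fix m assume m: "m < n"
    have "(\<Sum>l<n. g l) $ m = (\<Sum>l<n. if m > 0 \<and> Suc l dvd m then of_nat (Suc l) else 0)"
      by (simp add: fps_sum_nth g_def)
    also have "\<dots> = divs $ m"
    proof (cases "m = 0")
      case False
      have "(\<Sum>l<n. if m > 0 \<and> Suc l dvd m then of_nat (Suc l) else 0) =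
            (\<Sum>l\<in>{l\<in>{..<n}. Suc l dvd m}. of_nat (Suc l) :: complex)"
        using False by (subst sum.inter_filter) auto
      also have "\<dots> = (\<Sum>d | d dvd m. of_nat d)"
      proof (rule sum.reindex_bij_witness[of _ "\<lambda>d. d - 1" Suc])
        fix d assume "d \<in> {d. d dvd m}"
        hence "d > 0" "d \<le> m" using False by (auto intro!: Nat.gr0I dest: dvd_imp_le)
        thus "Suc (d - 1) = d" "d - 1 \<in> {l\<in>{..<n}. Suc l dvd m}" using \<open>d \<in> _\<close> m by auto
      qed auto
      finally show ?thesis using False by (simp add: divs_def sg_def)
    qed (simp add: divs_def)
    finally show "(\<Sum>l<n. g l) $ m = divs $ m" .
  qed
  show ?thesis
  proof (rule fcong_eqI)
    fix n
    have "fcong (Suc n) (theta (eu 1)) (theta (P (Suc n)))" by (intro fth fcong_sym[OF Pe])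
    also have "theta (P (Suc n)) = (0 - (\<Sum>l<Suc n. g l)) * P (Suc n)" by (simp add: P)
    also have "fcong (Suc n) \<dots> ((0 - divs) * eu 1)"
      by (intro fcong_mult fcong_diff gd Pe fcong_refl)
    finally show "fcong (Suc n) (theta (eu 1)) (- divs * eu 1)" by simp
  qed
qed

text \<open>Let G be the logarithmic derivative of \<open>phim\<close>, known from its eta quotient.
  As phi(q) = phim(-q), \<open>log_deriv_phi_phim\<close> says G(-q) - G(q) = 4 q psi(q^2)^4. At odd
  exponents the part of G in q^2 is absent and only divisor sums remain.\<close>

theorem psi_fourth_power: "psi ^ 4 = Abs_fps (\<lambda>n. of_nat (sg (2 * n + 1)))"
proof -
  define G where "G = 2 * (divs oo X ^ 2) - 2 * divs"
  have e2: "eu 2 = eu 1 oo X ^ 2" by (simp add: eu_compose)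
  have "theta (eu 2) = - 2 * (divs oo X ^ 2) * eu 2"
    unfolding e2 theta_compose_square theta_eu_1
    by (simp add: fps_compose_mult_distrib fps_compose_uminus)
  moreover have "theta phim * eu 2 + phim * theta (eu 2) = 2 * eu 1 * theta (eu 1)"
    unfolding theta_mult[symmetric] theta_square[symmetric] phim_prod ..
  ultimately have "(theta phim - phim * G) * eu 2 = 0"
    using phim_prod theta_eu_1 unfolding G_def by algebra
  hence m: "theta phim = phim * G" by simp
  define s where "s = fps_const (- 1) * X"
  have p: "phi = phim oo s"
  proof -
    have "phi $ n = (- 1) ^ n * phim $ n" for n
    proof -
      have sgn: "(- 1) ^ sq j = par j" for j
      proof -
        have "even (sq j) \<longleftrightarrow> even j" by (metis even_mult_iff even_of_nat of_nat_sq)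
        thus ?thesis by (simp add: par_def)
      qed
      have "(\<Sum>j | sq j = n. 1) = (\<Sum>j | sq j = n. (- 1) ^ n * par j)"
      proof (rule sum.cong)
        fix j assume "j \<in> {j. sq j = n}"
        hence "(- 1) ^ n = par j" using sgn[of j] by simp
        thus "1 = (- 1) ^ n * par j" by (simp add: par_def)
      qed simp
      hence "(\<Sum>j | sq j = n. 1) = (- 1) ^ n * (\<Sum>j | sq j = n. par j)"
        by (simp only: sum_distrib_left)
      thus ?thesis by (simp add: phi_def phim_def gf_def)
    qed
    thus ?thesis unfolding s_def by (simp add: fps_eq_iff fps_nth_compose_linear)
  qed
  have "theta phi = theta phim oo s"
    unfolding p s_def by (simp add: fps_eq_iff fps_nth_compose_linear)
  also have "\<dots> = phi * (G oo s)"
    unfolding m p by (subst fps_compose_mult_distrib) (auto simp: s_def)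
  finally have "(phi * phim) * ((G oo s) - G) = (phi * phim) * (4 * X * (psi oo X ^ 2) ^ 4)"
    using log_deriv_phi_phim m by algebra
  hence eq: "(G oo s) - G = 4 * (X * (psi oo X ^ 2) ^ 4)" by (simp add: mult.assoc)
  have psi4: "(X * (psi oo X ^ 2) ^ 4) $ (2 * n + 1) = (psi ^ 4) $ n" for n
  proof -
    have "(psi oo X ^ 2) ^ 4 = psi ^ 4 oo X ^ 2" by (simp add: fps_compose_power)
    thus ?thesis by (simp add: nth_compose_X_power)
  qed
  have "(psi ^ 4) $ n = of_nat (sg (2 * n + 1))" for n
  proof -
    have "4 * (psi ^ 4) $ n = ((G oo s) - G) $ (2 * n + 1)"
      unfolding eq psi4[symmetric] by (simp add: numeral_fps_const)
    also have "\<dots> = - 2 * G $ (2 * n + 1)"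
      unfolding s_def by (simp add: fps_nth_compose_linear)
    also have "(divs oo X ^ 2) $ (2 * n + 1) = 0" by (simp add: nth_compose_X_power)
    hence "- 2 * G $ (2 * n + 1) = 4 * of_nat (sg (2 * n + 1))"
      by (simp add: G_def divs_def numeral_fps_const)
    finally show ?thesis by simp
  qed
  thus ?thesis by (simp add: fps_eq_iff)
qed

subsection \<open>The relation between \<open>psi\<close> and \<open>phim\<close> at level ten\<close>

lemma compose_X_power_inj:
  fixes f g :: "'a::idom fps"
  assumes "m > 0" "f oo fps_X ^ m = g oo fps_X ^ m"
  shows "f = g"
proof -
  have "f $ n = g $ n" for n
    using arg_cong[OF assms(2), of "\<lambda>h. h $ (m * n)"] assms(1) by (simp add: nth_compose_X_power)
  thus ?thesis by (simp add: fps_eq_iff)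
qed

lemma compose_X_power_X_power:
  fixes f :: "'a::idom fps"
  assumes "a > 0" "b > 0"
  shows "(f oo fps_X ^ a) oo fps_X ^ b = f oo fps_X ^ (a * b)"
  using assms by (simp add: fps_compose_assoc[symmetric] fps_X_power_compose mult.commute flip: power_mult)

lemmas compose_hom = fps_compose_add_distrib fps_compose_sub_distrib fps_compose_mult_distrib
  fps_compose_power[symmetric] fps_compose_uminus

definition ht1 :: "complex fps" where "ht1 = gf (\<lambda>j. 7 * tri j + 3 * tri (- j)) par UNIV"
definition ht2 :: "complex fps" where "ht2 = gf (\<lambda>j. 9 * tri j + 1 * tri (- j)) par UNIV"

text \<open>In \<open>phim_square_5\<close> the powers q and q^4 of the two components combine, so
  every term is a series in q^5 and q^5 may be replaced by q. The analogue for \<open>psi\<close>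
  follows in the same way.\<close>

lemma phim_square_diff: "(phim oo X ^ 5) ^ 2 - phim ^ 2 = 4 * X * (ht1 * ht2)"
proof -
  have "(phim oo X ^ 5) ^ 2 = ph5 0 ^ 2 + 4 * (ph5 1 * ph5 2)"
    unfolding phim_square_5 ph5_reflect by (simp add: power2_eq_square algebra_simps)
  also have "\<dots> = (phim oo X ^ 25) ^ 2 - 4 * X ^ 5 * ((ht1 * ht2) oo X ^ 5)"
    unfolding ph5_0 ph5_1 ph5_2 ht1_def[symmetric] ht2_def[symmetric]
    by (simp add: compose_hom power_Suc[symmetric] algebra_simps del: power_Suc flip: power_Suc2 power_add)
  also have "\<dots> = ((phim oo X ^ 5) ^ 2 - 4 * X * (ht1 * ht2)) oo X ^ 5"
    by (simp add: compose_hom compose_X_power_X_power)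
  finally have eq: "(phim oo X ^ 5) ^ 2 = ((phim oo X ^ 5) ^ 2 - 4 * X * (ht1 * ht2)) oo X ^ 5" .
  have "phim ^ 2 oo X ^ 5 = (phim oo X ^ 5) ^ 2" by (simp add: fps_compose_power)
  from this eq have "phim ^ 2 oo X ^ 5 = ((phim oo X ^ 5) ^ 2 - 4 * X * (ht1 * ht2)) oo X ^ 5" by (rule trans)
  hence "phim ^ 2 = (phim oo X ^ 5) ^ 2 - 4 * X * (ht1 * ht2)"
    by (rule compose_X_power_inj[rotated]) simp
  thus ?thesis by simp
qed

lemma psi_square_diff:
  "psi ^ 2 - X * (psi oo X ^ 5) ^ 2 =
     gf (\<lambda>j. 2 * tri j + 3 * tri (- j)) (\<lambda>_. 1) UNIV * gf (\<lambda>j. 4 * tri j + 1 * tri (- j)) (\<lambda>_. 1) UNIV"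
  (is "_ = ?k1 * ?k2")
proof -
  have "X * (psi oo X ^ 5) ^ 2 = (ps5 0 + ps5 3) * (ps5 1 + ps5 2) + ps5 4 ^ 2"
    unfolding psi_square_5 by (simp add: power2_eq_square algebra_simps)
  also have "\<dots> = X * (((?k1 * ?k2) oo X ^ 5) + X ^ 5 * (psi oo X ^ 25) ^ 2)"
    unfolding ps5_03 ps5_12 ps5_4 by (simp add: compose_hom algebra_simps power2_eq_square)
      (simp add: eval_nat_numeral algebra_simps)
  also have "\<dots> = X * ((?k1 * ?k2 + X * (psi oo X ^ 5) ^ 2) oo X ^ 5)"
    by (simp add: compose_hom compose_X_power_X_power)
  finally have "(psi oo X ^ 5) ^ 2 = (?k1 * ?k2 + X * (psi oo X ^ 5) ^ 2) oo X ^ 5"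
    by (rule mult_left_cancel[THEN iffD1, rotated]) simp
  note eq = this
  have "psi ^ 2 oo X ^ 5 = (psi oo X ^ 5) ^ 2" by (simp add: fps_compose_power)
  from this eq have "psi ^ 2 oo X ^ 5 = (?k1 * ?k2 + X * (psi oo X ^ 5) ^ 2) oo X ^ 5" by (rule trans)
  hence "psi ^ 2 = ?k1 * ?k2 + X * (psi oo X ^ 5) ^ 2"
    by (rule compose_X_power_inj[rotated]) simp
  thus ?thesis by simp
qed

text \<open>The eta products yield psi(q^5)^2 phim(q^5)^2 = H K. By the two preceding lemmas 4 q H
  and K are differences of squares of theta functions; inserting them and rearranging produces the
  5.\<close>

theorem psi_phim_level_10:
  "((phim oo X ^ 5) ^ 2 - phim ^ 2) * psi ^ 2 = X * (psi oo X ^ 5) ^ 2 * (5 * (phim oo X ^ 5) ^ 2 - phim ^ 2)"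
proof -
  define P5 s5 where "P5 = phim oo X ^ 5" and "s5 = psi oo X ^ 5"
  define K where "K = gf (\<lambda>j. 2 * tri j + 3 * tri (- j)) (\<lambda>_. 1 :: complex) UNIV *
     gf (\<lambda>j. 4 * tri j + 1 * tri (- j)) (\<lambda>_. 1) UNIV"
  define H where "H = ht1 * ht2"
  have H: "H * (eu 2 * eu 5) = eu 1 * eu 10 ^ 3"
    using theta10_prod unfolding H_def ht1_def ht2_def .
  have K: "K * (eu 1 * eu 10) = eu 2 * eu 5 ^ 3"
    using theta5_prod unfolding K_def .
  have "phim * eu 2 oo X ^ 5 = eu 1 ^ 2 oo X ^ 5" "psi * eu 1 oo X ^ 5 = eu 2 ^ 2 oo X ^ 5"
    by (simp_all only: phim_prod psi_prod)
  hence "P5 * eu 10 = eu 5 ^ 2" "s5 * eu 5 = eu 10 ^ 2"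
    by (simp_all only: compose_hom fps_X_power_nth eu_compose P5_def s5_def) (simp_all add: eu_compose compose_hom)
  hence "(s5 ^ 2 * P5 ^ 2 - H * K) * (eu 1 * eu 10 ^ 2 * eu 2 * eu 5 ^ 2) = 0"
    using H K by algebra
  hence "s5 ^ 2 * P5 ^ 2 = H * K" by simp
  moreover have "P5 ^ 2 - phim ^ 2 = 4 * X * H" "psi ^ 2 - X * s5 ^ 2 = K"
    using phim_square_diff psi_square_diff by (simp_all only: P5_def s5_def H_def K_def)
  ultimately show ?thesis unfolding P5_def[symmetric] s5_def[symmetric] by algebra
qed

subsection \<open>The quintic norm\<close>

definition w5 :: complex where "w5 = cis (2 * pi / 5)"

lemma w5_power_5: "w5 ^ 5 = 1"
  by (simp add: w5_def DeMoivre)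

lemma w5_not_1: "w5 \<noteq> 1"
proof
  assume "w5 = 1"
  hence "Im w5 = 0" by simp
  moreover have "sin (2 * pi / 5) > 0" by (rule sin_gt_zero) auto
  ultimately show False by (simp add: w5_def)
qed

lemma w5_power_mod: "w5 ^ k = w5 ^ (k mod 5)"
proof -
  have "w5 ^ k = w5 ^ (5 * (k div 5) + k mod 5)" by simp
  also have "\<dots> = w5 ^ (k mod 5)" unfolding power_add power_mult w5_power_5 by simp
  finally show ?thesis .
qed

lemma w5_power_eq_1_iff: "w5 ^ k = 1 \<longleftrightarrow> 5 dvd k"
proof
  assume "w5 ^ k = 1"
  hence *: "w5 ^ (k mod 5) = 1" by (simp only: w5_power_mod[of k, symmetric])
  have "r = 0 \<or> r = 1 \<or> r = 2 \<or> r = 3 \<or> r = 4" if "r < 5" for r :: nat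
    using that by arith
  from this[of "k mod 5"]
  consider "k mod 5 = 0" | "k mod 5 = 1" | "k mod 5 = 2" | "k mod 5 = 3" | "k mod 5 = 4" by fastforce
  thus "5 dvd k"
  proof cases
    case 3
    have "w5 ^ 5 = w5 ^ 2 * w5 ^ 2 * w5" by (simp add: eval_nat_numeral mult.assoc)
    also have "w5 ^ 2 = 1" using * unfolding 3 .
    finally show ?thesis using w5_not_1 w5_power_5 by simp
  next
    case 4
    have "w5 ^ 5 * w5 = w5 ^ 3 * w5 ^ 3" by (simp add: eval_nat_numeral mult.assoc)
    also have "w5 ^ 3 = 1" using * unfolding 4 .
    finally show ?thesis using w5_not_1 w5_power_5 by simp
  next
    case 5
    have "w5 ^ 5 = w5 ^ 4 * w5" by (simp add: eval_nat_numeral mult.assoc)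
    also have "w5 ^ 4 = 1" using * unfolding 5 .
    finally show ?thesis using w5_not_1 w5_power_5 by simp
  next
    case 2
    have "w5 ^ 1 = 1" using * unfolding 2 .
    thus ?thesis using w5_not_1 by simp
  next
    case 1
    thus ?thesis by (simp only: dvd_eq_mod_eq_0)
  qed
next
  assume "5 dvd k"
  then obtain j where "k = 5 * j" by (elim dvdE)
  thus "w5 ^ k = 1" by (simp add: power_mult w5_power_5)
qed

lemma w5_sum:
  assumes "\<not> 5 dvd k"
  defines "z \<equiv> w5 ^ k"
  shows "1 + z + z ^ 2 + z ^ 3 + z ^ 4 = 0"
proof -
  have "z ^ 5 = (w5 ^ 5) ^ k" unfolding z_def by (simp only: power_mult[symmetric] mult.commute)
  hence "z ^ 5 = 1" by (simp only: w5_power_5 power_one)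
  hence "(z - 1) * (1 + z + z ^ 2 + z ^ 3 + z ^ 4) = 0" by algebra
  moreover have "z \<noteq> 1" using assms w5_power_eq_1_iff by simp
  ultimately show ?thesis by simp
qed

text \<open>The product over the conjugates q -> w5^i q, that is, the norm down to series in
  q^5.\<close>

definition nrm :: "complex fps \<Rightarrow> complex fps" where
  "nrm f = (\<Prod>i<5. f oo (fps_const (w5 ^ i) * X))"

lemma nrm_mult: "nrm (f * g) = nrm f * nrm g"
  by (simp add: nrm_def fps_compose_mult_distrib prod.distrib)

lemma lessThan_5: "{..<5::nat} = {0, 1, 2, 3, 4}"
  by auto

lemma nrm_1_minus_X_power:
  "nrm (1 - X ^ k) = (if 5 dvd k then (1 - X ^ k) ^ 5 else 1 - X ^ (5 * k))"
proof -
  have c: "(1 - X ^ k) oo (fps_const (w5 ^ i) * X) = 1 - fps_const (w5 ^ k) ^ i * X ^ k" for i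
    by (simp add: compose_hom fps_X_power_compose power_mult_distrib mult.commute[of i] flip: power_mult)
  define z where "z = fps_const (w5 ^ k)"
  have n: "nrm (1 - X ^ k) = (1 - X ^ k) * (1 - z * X ^ k) * (1 - z ^ 2 * X ^ k) * (1 - z ^ 3 * X ^ k) * (1 - z ^ 4 * X ^ k)"
    unfolding nrm_def c lessThan_5 z_def by (simp add: mult.assoc)
  show ?thesis
  proof (cases "5 dvd k")
    case True
    hence "z = 1" by (simp add: z_def w5_power_eq_1_iff)
    thus ?thesis using True n by (simp add: eval_nat_numeral)
  next
    case False
    have "fps_const (1 + w5 ^ k + (w5 ^ k) ^ 2 + (w5 ^ k) ^ 3 + (w5 ^ k) ^ 4) = 0"
      by (simp only: w5_sum[OF False] fps_const_0_eq_0)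
    hence "1 + z + z ^ 2 + z ^ 3 + z ^ 4 = 0"
      unfolding z_def by (simp only: fps_const_add[symmetric] fps_const_power[symmetric] fps_const_1_eq_1)
    hence "(1 - y) * (1 - z * y) * (1 - z ^ 2 * y) * (1 - z ^ 3 * y) * (1 - z ^ 4 * y) = 1 - y ^ 5"
      for y :: "complex fps" by algebra
    hence "nrm (1 - X ^ k) = 1 - (X ^ k) ^ 5" unfolding n .
    thus ?thesis using False by (simp add: mult.commute flip: power_mult)
  qed
qed

lemma iprod_prod:
  fixes F :: "nat \<Rightarrow> nat \<Rightarrow> 'a::comm_ring_1 fps"
  assumes "\<And>i. convp (F i)"
  shows "convp (\<lambda>l. \<Prod>i<n. F i l) \<and> iprod (\<lambda>l. \<Prod>i<n. F i l) = (\<Prod>i<n. iprod (F i))"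
proof (induction n)
  case 0
  have "convp (\<lambda>l. 1 :: 'a fps)" by (auto simp: convp_def)
  moreover from this have "iprod (\<lambda>l. 1 :: 'a fps) = 1" by (intro iprod_eqI) auto
  ultimately show ?case by simp
next
  case (Suc n)
  thus ?case using assms[of n] by (simp add: iprod_mult convp_mult)
qed

text \<open>Factors with exponent prime to 5 have norm 1 - q^(5k), which gives
  \<open>eu (5 * m)\<close> over \<open>eu (25 * m)\<close>; those with exponent divisible by 5 are
  merely raised to the fifth power, which gives \<open>eu (5 * m) ^ 5\<close>.\<close>

lemma nrm_eu:
  assumes m: "m > 0" "coprime 5 m"
  shows "nrm (eu m) * eu (25 * m) = eu (5 * m) ^ 6"
proof -
  let ?s = "\<lambda>i. fps_const (w5 ^ i) * X"
  define F where "F l = 1 - X ^ (m * Suc l)" for l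
  have F: "convp F" unfolding F_def by (rule convp_eu) fact
  have Fc: "convp (\<lambda>l. F l oo ?s i)" for i
    using F fcong_compose[of _ _ 1 "?s i"] by (auto simp: convp_def)
  note pr = iprod_prod[of "\<lambda>i l. F l oo ?s i" 5, OF Fc]
  have "eu m = iprod F" unfolding eu_def by (rule arg_cong[of _ _ iprod]) (simp add: F_def fun_eq_iff)
  hence "nrm (eu m) = (\<Prod>i<5. iprod (\<lambda>l. F l oo ?s i))"
    using iprod_compose[OF F] by (simp add: nrm_def)
  also have "\<dots> = iprod (\<lambda>l. \<Prod>i<5. F l oo ?s i)" using pr by simp
  also have "\<dots> = iprod (\<lambda>l. nrm (F l))" by (simp add: nrm_def)
  also have "\<dots> = iprod (\<lambda>l. \<Prod>r<5. nrm (F (5 * l + r)))"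
    by (rule iprod_block[symmetric]) (use pr in \<open>simp_all add: nrm_def\<close>)
  also have "\<dots> * eu (25 * m) = iprod (\<lambda>l. (\<Prod>r<5. nrm (F (5 * l + r))) * (1 - X ^ (25 * m * Suc l)))"
    unfolding eu_def using m convp_block[of "\<lambda>l. nrm (F l)" 5] pr
    by (intro iprod_mult[symmetric] convp_eu) (simp_all add: nrm_def)
  also have "\<dots> = iprod (\<lambda>l. (\<Prod>r<5. 1 - X ^ (5 * m * Suc (5 * l + r))) * (1 - X ^ (5 * m * Suc l)) ^ 5)"
  proof (rule arg_cong[of _ _ iprod], rule ext)
    fix l
    have dv: "5 dvd m * Suc (5 * l + r) \<longleftrightarrow> 5 dvd Suc (5 * l + r)" for r
      using m(2) by (rule coprime_dvd_mult_right_iff)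
    have 1: "nrm (F (5 * l + r)) = 1 - X ^ (5 * m * Suc (5 * l + r))" if "r \<in> {0, 1, 2, 3}" for r
    proof -
      have "\<not> 5 dvd Suc (5 * l + r)" using that by (auto simp: dvd_eq_mod_eq_0 mod_Suc)
      thus ?thesis unfolding F_def nrm_1_minus_X_power dv by (simp add: mult.assoc)
    qed
    have 2: "nrm (F (5 * l + 4)) = (1 - X ^ (5 * m * Suc l)) ^ 5"
    proof -
      have "Suc (5 * l + 4) = 5 * Suc l" by simp
      thus ?thesis unfolding F_def nrm_1_minus_X_power by (simp only:) (simp add: mult_ac)
    qed
    have 3: "5 * m * Suc (5 * l + 4) = 25 * m * Suc l" by (simp add: algebra_simps)
    show "(\<Prod>r<5. nrm (F (5 * l + r))) * (1 - X ^ (25 * m * Suc l)) =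
        (\<Prod>r<5. 1 - X ^ (5 * m * Suc (5 * l + r))) * (1 - X ^ (5 * m * Suc l)) ^ 5"
    proof -
      have P: "(\<Prod>r<5. f r) = f 0 * f 1 * f 2 * f 3 * f 4" for f :: "nat \<Rightarrow> complex fps"
        by (simp add: lessThan_5 mult.assoc)
      have q: "nrm (F (5 * l + 0)) = 1 - X ^ (5 * m * Suc (5 * l + 0))"
        "nrm (F (5 * l + 1)) = 1 - X ^ (5 * m * Suc (5 * l + 1))"
        "nrm (F (5 * l + 2)) = 1 - X ^ (5 * m * Suc (5 * l + 2))"
        "nrm (F (5 * l + 3)) = 1 - X ^ (5 * m * Suc (5 * l + 3))"
        by (rule 1, simp)+
      show ?thesis unfolding P q 2 3[symmetric] by (simp only: mult_ac)
    qed
  qed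
  also have "\<dots> = eu (5 * m) * eu (5 * m) ^ 5"
    using m convp_block[OF convp_eu[of "5 * m"], of 5]
    by (subst iprod_mult; (subst iprod_power)?)
       (auto intro!: convp_power convp_eu simp: eu_def eu_block[of "5 * m" 5, unfolded eu_def] simp del: mult_Suc_right)
  also have "\<dots> = eu (5 * m) ^ 6" by (simp add: eval_nat_numeral)
  finally show ?thesis .
qed

lemma nrm_phim: "nrm phim * (phim oo X ^ 25) = (phim oo X ^ 5) ^ 6"
proof -
  define P5 P25 where "P5 = phim oo X ^ 5" and "P25 = phim oo X ^ 25"
  have "phim * eu 2 oo X ^ 5 = eu 1 ^ 2 oo X ^ 5" "phim * eu 2 oo X ^ 25 = eu 1 ^ 2 oo X ^ 25"
    by (simp_all only: phim_prod)
  hence "P5 * eu 10 = eu 5 ^ 2" "P25 * eu 50 = eu 25 ^ 2"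
    by (simp_all only: compose_hom fps_X_power_nth eu_compose P5_def P25_def) (simp_all add: eu_compose compose_hom)
  moreover have "nrm phim * nrm (eu 2) = nrm (eu 1) ^ 2"
    unfolding power2_eq_square nrm_mult[symmetric] phim_prod[unfolded power2_eq_square] ..
  moreover have "nrm (eu 1) * eu 25 = eu 5 ^ 6" "nrm (eu 2) * eu 50 = eu 10 ^ 6"
    using nrm_eu[of 1] nrm_eu[of 2] by simp_all
  ultimately have "(nrm phim * P25 - P5 ^ 6) * (eu 10 ^ 6 * eu 50 * eu 25 ^ 2) = 0" by algebra
  thus ?thesis by (simp add: P5_def P25_def)
qed

lemma compose_X5_root:
  assumes "c ^ 5 = 1"
  shows "(f oo X ^ 5) oo (fps_const c * X) = f oo X ^ 5"
proof -
  have "c ^ n * (f oo X ^ 5) $ n = (f oo X ^ 5) $ n" for n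
    using assms by (auto simp: nth_compose_X_power power_mult elim!: dvdE)
  thus ?thesis by (simp add: fps_eq_iff fps_nth_compose_linear)
qed

text \<open>The norm of A + a + b: as a and b have exponents 1 and 4 modulo 5, its conjugates are A
  + w^i a + w^(4i) b.\<close>

theorem phim_norm_relation:
  defines "A \<equiv> phim oo X ^ 25" and "a \<equiv> 2 * ph5 1" and "b \<equiv> 2 * ph5 2"
  shows "A * (A ^ 5 + a ^ 5 + b ^ 5 - 5 * A ^ 3 * (a * b) + 5 * A * (a * b) ^ 2) = (phim oo X ^ 5) ^ 6"
proof -
  have c: "phim oo (fps_const (w5 ^ i) * X) = A + fps_const w5 ^ i * a + fps_const w5 ^ (4 * i) * b" for i
  proof -
    have "(w5 ^ i) ^ 5 = (w5 ^ 5) ^ i" by (simp only: power_mult[symmetric] mult.commute)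
    hence "(w5 ^ i) ^ 5 = 1" by (simp only: w5_power_5 power_one)
    note r = compose_X5_root[OF this]
    have A5: "A = (phim oo X ^ 5) oo X ^ 5" by (simp add: A_def compose_X_power_X_power)
    have "phim = A + a + b" using phim_dissect by (simp add: A_def a_def b_def ph5_0)
    hence "phim oo (fps_const (w5 ^ i) * X) = (A + a + b) oo (fps_const (w5 ^ i) * X)"
      by (rule arg_cong)
    also have "\<dots> = (A oo (fps_const (w5 ^ i) * X)) + (a oo (fps_const (w5 ^ i) * X)) + (b oo (fps_const (w5 ^ i) * X))"
      by (simp only: fps_compose_add_distrib)
    also have "A oo (fps_const (w5 ^ i) * X) = A" unfolding A5 by (rule r)
    also have "a oo (fps_const (w5 ^ i) * X) = fps_const w5 ^ i * a"
      unfolding a_def ph5_1 by (simp add: compose_hom r; simp add: mult_ac)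
    also have "b oo (fps_const (w5 ^ i) * X) = fps_const w5 ^ (4 * i) * b"
      unfolding b_def ph5_2
      by (simp add: compose_hom r fps_X_power_compose power_mult_distrib;
          simp add: mult_ac flip: power_mult)
    finally show ?thesis .
  qed
  define w where "w = fps_const w5"
  have w5: "w ^ 5 = 1" by (simp add: w_def w5_power_5)
  have "fps_const (1 + w5 ^ 1 + (w5 ^ 1) ^ 2 + (w5 ^ 1) ^ 3 + (w5 ^ 1) ^ 4) = 0"
  proof -
    have "\<not> (5 :: nat) dvd 1" by simp
    from w5_sum[OF this] show ?thesis by (simp only: fps_const_0_eq_0)
  qed
  hence w1: "1 + w + w ^ 2 + w ^ 3 + w ^ 4 = 0"
    unfolding w_def by (simp only: fps_const_add[symmetric] fps_const_power[symmetric] fps_const_1_eq_1 power_one_right)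
  have p: "w ^ 8 = w ^ 3" "w ^ 12 = w ^ 2" "w ^ 16 = w"
    using w5 by algebra+
  have "nrm phim = (A + a + b) * (A + w * a + w ^ 4 * b) * (A + w ^ 2 * a + w ^ 3 * b)
       * (A + w ^ 3 * a + w ^ 2 * b) * (A + w ^ 4 * a + w * b)"
    unfolding nrm_def c lessThan_5 w_def[symmetric] using p by (simp add: mult.assoc)
  \<comment> \<open>The conjugates i and 5 - i are multiplied. Then only w + w^4 and w^2 + w^3
    occur, the two roots of z^2 + z - 1.\<close>
  also have "\<dots> = (A + a + b) * ((A ^ 2 + (w + w ^ 4) * (A * (a + b) ) + a ^ 2 + b ^ 2 + (w ^ 2 + w ^ 3) * (a * b))
       * (A ^ 2 + (w ^ 2 + w ^ 3) * (A * (a + b)) + a ^ 2 + b ^ 2 + (w + w ^ 4) * (a * b)))"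
    using w5 by algebra
  also have "\<dots> = A ^ 5 + a ^ 5 + b ^ 5 - 5 * A ^ 3 * (a * b) + 5 * A * (a * b) ^ 2"
  proof -
    define s t where "s = w + w ^ 4" and "t = w ^ 2 + w ^ 3"
    have "s + t = - 1" "s * t = - 1" unfolding s_def t_def using w1 w5 by algebra+
    thus ?thesis unfolding s_def[symmetric] t_def[symmetric] by algebra
  qed
  finally show ?thesis using nrm_phim by (simp add: A_def mult.commute)
qed

subsection \<open>The generating function of \<open>spt_omega\<close>\<close>

lemma ffib_reindex:
  assumes "bij_betw h B A" "\<And>x. x \<in> B \<Longrightarrow> e (h x) = e' x" "ffib e' B"
  shows "ffib e A"
  unfolding ffib_def
proof
  fix n
  have "{x\<in>A. e x = n} \<subseteq> h ` {x\<in>B. e' x = n}"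
  proof
    fix x assume x: "x \<in> {x\<in>A. e x = n}"
    then obtain y where "y \<in> B" "x = h y" using assms(1) by (auto simp: bij_betw_def)
    thus "x \<in> h ` {x\<in>B. e' x = n}" using x assms(2) by auto
  qed
  thus "finite {x\<in>A. e x = n}" by (rule finite_subset) (use assms(3) in \<open>auto simp: ffib_def\<close>)
qed

section \<open>Overpartitions with parts in a given set, and the decomposition by the smallest
  part\<close>

type_synonym opart = "nat multiset \<times> nat set"

definition opsum :: "opart \<Rightarrow> nat" where "opsum = (\<lambda>(P, S). sum_mset P)"

definition oparts :: "nat set \<Rightarrow> opart set" where
  "oparts K = {(P, S). set_mset P \<subseteq> K \<and> S \<subseteq> set_mset P}"

text \<open>The generating function of the overpartitions whose only part size is k: 1 + 2 q^k + 2
  q^(2k) + ...\<close>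

definition opp :: "nat \<Rightarrow> complex fps" where "opp k = (1 + X ^ k) * inverse (1 - X ^ k)"

lemma inverse_1_minus [simp]: "k > 0 \<Longrightarrow> (1 - X ^ k) * inverse (1 - X ^ k) = 1"
  and inverse_1_plus [simp]: "k > 0 \<Longrightarrow> (1 + X ^ k) * inverse (1 + X ^ k) = 1"
  by (rule inverse_mult_eq_1', simp)+

lemma opp_mult: "k > 0 \<Longrightarrow> opp k * (1 - X ^ k) = 1 + X ^ k"
  using inverse_1_minus[of k] by (simp add: opp_def mult.assoc mult.commute[of "inverse _"])

lemma gf_single_part:
  assumes "k > 0"
  shows "gf (\<lambda>(c, b). k * c) (\<lambda>_. 1) {(c, b). b \<longrightarrow> c > 0} = opp k" (is "gf ?e _ ?D = _")
    and "ffib (\<lambda>(c, b). k * c) {(c :: nat, b). b \<longrightarrow> c > 0}"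
proof -
  define G where "G = gf fst (\<lambda>_. 1 :: complex) ?D"
  have D: "{x\<in>?D. fst x = n} = (if n = 0 then {(0, False)} else {(n, False), (n, True)})" for n
    by auto
  have Gn: "G $ n = (if n = 0 then 1 else 2)" for n
    unfolding G_def gf_def fps_nth_Abs_fps D by auto
  have "G * (1 - X) = 1 + X"
  proof -
    have "(G * (1 - X)) $ n = (1 + X) $ n" for n
      by (cases n) (auto simp: algebra_simps Gn)
    thus ?thesis by (simp add: fps_eq_iff)
  qed
  hence "(G * (1 - X)) oo X ^ k = (1 + X) oo X ^ k" by simp
  hence "(G oo X ^ k) * (1 - X ^ k) = 1 + X ^ k"
    using assms by (simp add: fps_compose_mult_distrib fps_compose_sub_distrib fps_compose_add_distrib)
  hence "(G oo X ^ k) * (1 - X ^ k) = opp k * (1 - X ^ k)" using opp_mult[OF assms] by simp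
  moreover have "1 - X ^ k \<noteq> 0" using inverse_1_minus[OF assms] by force
  ultimately have "G oo X ^ k = opp k" by simp
  moreover have "G oo X ^ k = gf ?e (\<lambda>_. 1) ?D"
    unfolding G_def gf_compose_X_power[OF assms] by (rule gf_cong) auto
  ultimately show "gf ?e (\<lambda>_. 1) ?D = opp k" by simp
  show "ffib ?e ?D"
    unfolding ffib_def
  proof
    fix n
    have "{x\<in>?D. ?e x = n} \<subseteq> {..n} \<times> UNIV" using assms by auto
    thus "finite {x\<in>?D. ?e x = n}" by (rule finite_subset) auto
  qed
qed

lemma oparts_insert_bij:
  assumes "k \<notin> K"
  shows "bij_betw (\<lambda>((c, b), (P, S)). (replicate_mset c k + P, if b then insert k S else S))
     ({(c, b). b \<longrightarrow> c > 0} \<times> oparts K) (oparts (insert k K))"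
proof -
  let ?h = "\<lambda>((c, b), (P, S)). (replicate_mset c k + P, if b then insert k S else S)"
  let ?g = "\<lambda>(P, S). ((count P k, k \<in> S), (filter_mset (\<lambda>p. p \<noteq> k) P, S - {k}))"
  have gh: "?g (?h z) = z" if "z \<in> {(c :: nat, b). b \<longrightarrow> c > 0} \<times> oparts K" for z
  proof -
    from that obtain c b P S where z: "z = ((c, b), (P, S))" "set_mset P \<subseteq> K" "S \<subseteq> set_mset P"
      by (auto simp: oparts_def)
    hence "k \<notin># P" "k \<notin> S" using assms by auto
    moreover from this have "filter_mset (\<lambda>p. p \<noteq> k) P = P" by (auto simp: filter_mset_eq_conv)
    ultimately show ?thesis by (auto simp: z(1) not_in_iff)
  qed
  have hg: "?h (?g z) = z" if "z \<in> oparts (insert k K)" for z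
  proof -
    from that obtain P S where z: "z = (P, S)" by (auto simp: oparts_def)
    have "replicate_mset (count P k) k + filter_mset (\<lambda>p. p \<noteq> k) P = P"
      by (rule multiset_eqI) auto
    thus ?thesis by (auto simp: z)
  qed
  have h: "?h \<in> {(c, b). b \<longrightarrow> c > 0} \<times> oparts K \<rightarrow> oparts (insert k K)"
    by (auto simp: oparts_def split: if_splits)
  have g: "?g \<in> oparts (insert k K) \<rightarrow> {(c, b). b \<longrightarrow> c > 0} \<times> oparts K"
    by (auto simp: oparts_def)
  show ?thesis by (rule bij_betwI[OF h g gh hg])
qed

lemma gf_oparts:
  assumes "finite K" "0 \<notin> K"
  shows "ffib opsum (oparts K) \<and> gf opsum (\<lambda>_. 1) (oparts K) = (\<Prod>k\<in>K. opp k)"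
  using assms
proof (induction K)
  case empty
  have o: "oparts {} = {({#}, {})}" by (auto simp: oparts_def)
  have "{x\<in>oparts {}. opsum x = n} = (if n = 0 then {({#}, {})} else {})" for n
    unfolding o by (auto simp: opsum_def)
  thus ?case by (auto simp: ffib_def gf_def fps_eq_iff)
next
  case (insert k K)
  let ?D = "{(c :: nat, b). b \<longrightarrow> c > 0}"
  have k: "k > 0" using insert.prems by auto
  note IH = insert.IH[OF insert.prems[simplified, THEN conjunct2]]
  note bij = oparts_insert_bij[OF insert.hyps(2)]
  have e: "opsum ((\<lambda>((c, b), (P, S)). (replicate_mset c k + P, if b then insert k S else S)) z) =
     (\<lambda>(x, y). (\<lambda>(c, b). k * c) x + opsum y) z" for z
    by (cases z) (auto simp: opsum_def sum_mset_replicate_mset)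
  have ff: "ffib opsum (oparts (insert k K))"
    by (rule ffib_reindex[OF bij]) (rule e, rule ffib_prod[OF gf_single_part(2)[OF k] conjunct1[OF IH]])
  have "gf opsum (\<lambda>_. 1) (oparts (insert k K)) = gf (\<lambda>(x, y). (\<lambda>(c, b). k * c) x + opsum y)
      (\<lambda>(x, y). 1 * 1) (?D \<times> oparts K)"
    by (rule gf_reindex[OF bij]) (rule e, auto)
  also have "\<dots> = opp k * (\<Prod>k\<in>K. opp k)"
    using gf_mult[OF gf_single_part(2)[OF k] conjunct1[OF IH], of "\<lambda>_. 1 :: complex" "\<lambda>_. 1"]
      gf_single_part(1)[OF k] IH by simp
  finally show ?case using ff insert.hyps by simp
qed

text \<open>The contribution of the smallest part m: its multiplicity c is the weight, and the
  overlining is forced, so that there is no factor 2. In closed form it is q^m / (1 -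
  q^m)^2.\<close>

definition dd :: "nat \<Rightarrow> complex fps" where "dd m = gf (\<lambda>c. m * c) of_nat {c. c > 0}"

lemma dd_nth: "m > 0 \<Longrightarrow> dd m $ n = (if m dvd n then of_nat (n div m) else 0)"
proof -
  assume m: "m > 0"
  have "{c\<in>{c. c > 0}. m * c = n} = (if m dvd n \<and> n > 0 then {n div m} else {})"
    using m by (auto elim!: dvdE)
  thus ?thesis by (auto simp: dd_def gf_def)
qed

lemma dd_mult:
  assumes "m > 0"
  shows "dd m * (1 - X ^ m) ^ 2 = X ^ m"
proof -
  define D :: "complex fps" where "D = Abs_fps of_nat"
  have "D * (1 - X) = Abs_fps (\<lambda>n. if n = 0 then 0 else 1)"
  proof -
    have "(D * (1 - X)) $ n = (if n = 0 then 0 else 1)" for n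
      by (cases n) (auto simp: algebra_simps D_def)
    thus ?thesis by (simp add: fps_eq_iff)
  qed
  moreover have "Abs_fps (\<lambda>n. if n = 0 then 0 else 1) * (1 - X) = X"
  proof -
    have "(Abs_fps (\<lambda>n. if n = 0 then 0 else 1) * (1 - X)) $ n = X $ n" for n
      by (cases n) (auto simp: algebra_simps)
    thus ?thesis by (simp add: fps_eq_iff)
  qed
  ultimately have "D * (1 - X) * (1 - X) = X" by simp
  hence "(D * (1 - X) * (1 - X)) oo X ^ m = X oo X ^ m" by simp
  hence "(D oo X ^ m) * (1 - X ^ m) ^ 2 = X ^ m"
    using assms by (simp add: fps_compose_mult_distrib fps_compose_sub_distrib power2_eq_square mult.assoc)
  moreover have "D oo X ^ m = dd m"
    using assms by (auto simp: fps_eq_iff nth_compose_X_power D_def dd_nth)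
  ultimately show ?thesis by simp
qed

lemma ffib_dd: "m > 0 \<Longrightarrow> ffib (\<lambda>c. m * c) {c :: nat. c > 0}"
  unfolding ffib_def
proof
  fix n assume "m > 0"
  hence "{c\<in>{c. c > 0}. m * c = n} \<subseteq> {..n}" by auto
  thus "finite {c\<in>{c. c > 0}. m * c = n}" by (rule finite_subset) auto
qed

text \<open>The sizes allowed above the smallest part m. The cut-off N keeps the products finite and
  is invisible in coefficients up to N.\<close>

definition bigparts :: "nat \<Rightarrow> nat \<Rightarrow> nat set" where
  "bigparts m N = {k\<in>{m<..N}. odd k \<longrightarrow> k < 2 * m}"

definition omegas :: "nat \<Rightarrow> nat \<Rightarrow> opart set" where
  "omegas m N = {(P, S). P \<noteq> {#} \<and> Min (set_mset P) = m \<and> m \<in> S \<and> S \<subseteq> set_mset P \<and>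
     (\<forall>p\<in>#P. p \<le> N \<and> (odd p \<longrightarrow> p < 2 * m))}"

lemma omegas_bij:
  assumes m: "m > 0" "m \<le> N"
  shows "bij_betw (\<lambda>(c, (P, S)). (replicate_mset c m + P, insert m S))
     ({c. c > 0} \<times> oparts (bigparts m N)) (omegas m N)"
proof (rule bij_betwI[where g = "\<lambda>(P, S). (count P m, (filter_mset (\<lambda>p. p \<noteq> m) P, S - {m}))"])
  have Min: "Min (insert m A) = m" if "finite A" "A \<subseteq> bigparts m N" for A
    using that by (intro Min_eqI) (auto simp: bigparts_def)
  show "(\<lambda>(c, (P, S)). (replicate_mset c m + P, insert m S)) \<in> {c. c > 0} \<times> oparts (bigparts m N) \<rightarrow> omegas m N"
  proof
    fix z :: "nat \<times> opart" assume "z \<in> {c. c > 0} \<times> oparts (bigparts m N)"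
    then obtain c P S where z: "z = (c, (P, S))" "c > 0" "set_mset P \<subseteq> bigparts m N" "S \<subseteq> set_mset P"
      by (auto simp: oparts_def)
    have s: "set_mset (replicate_mset c m + P) = insert m (set_mset P)" using z(2) by auto
    show "(case z of (c, (P, S)) \<Rightarrow> (replicate_mset c m + P, insert m S)) \<in> omegas m N"
      unfolding z(1) omegas_def using z(2-4) m
      by (auto simp: s Min simp del: set_mset_union) (auto simp: bigparts_def)
  qed
  show "(\<lambda>(P, S). (count P m, (filter_mset (\<lambda>p. p \<noteq> m) P, S - {m}))) \<in>
      omegas m N \<rightarrow> {c. c > 0} \<times> oparts (bigparts m N)"
  proof
    fix z assume "z \<in> omegas m N"
    then obtain P S where z: "z = (P, S)" "P \<noteq> {#}" "Min (set_mset P) = m" "m \<in> S" "S \<subseteq> set_mset P"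
      "\<forall>p\<in>#P. p \<le> N \<and> (odd p \<longrightarrow> p < 2 * m)" by (auto simp: omegas_def)
    have "m \<le> p" if "p \<in># P" for p using z(3) that by (metis Min_le finite_set_mset)
    thus "(case z of (P, S) \<Rightarrow> (count P m, (filter_mset (\<lambda>p. p \<noteq> m) P, S - {m}))) \<in>
        {c. c > 0} \<times> oparts (bigparts m N)"
      using z by (auto simp: oparts_def bigparts_def le_less)
  qed
next
  fix z assume "z \<in> {c :: nat. c > 0} \<times> oparts (bigparts m N)"
  then obtain c P S where z: "z = (c, (P, S))" "set_mset P \<subseteq> bigparts m N" "S \<subseteq> set_mset P"
    by (auto simp: oparts_def)
  hence "m \<notin># P" "m \<notin> S" by (auto simp: bigparts_def)
  moreover from this have "filter_mset (\<lambda>p. p \<noteq> m) P = P" by (auto simp: filter_mset_eq_conv)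
  ultimately show "(case (case z of (c, (P, S)) \<Rightarrow> (replicate_mset c m + P, insert m S)) of
      (P, S) \<Rightarrow> (count P m, (filter_mset (\<lambda>p. p \<noteq> m) P, S - {m}))) = z"
    by (auto simp: z(1) not_in_iff)
next
  fix z assume "z \<in> omegas m N"
  then obtain P S where z: "z = (P, S)" "m \<in> S" by (auto simp: omegas_def)
  have "replicate_mset (count P m) m + filter_mset (\<lambda>p. p \<noteq> m) P = P"
    by (rule multiset_eqI) auto
  thus "(case (case z of (P, S) \<Rightarrow> (count P m, (filter_mset (\<lambda>p. p \<noteq> m) P, S - {m}))) of
      (c, (P, S)) \<Rightarrow> (replicate_mset c m + P, insert m S)) = z"
    using z(2) by (auto simp: z(1))
qed

definition optw :: "nat \<Rightarrow> opart \<Rightarrow> complex" where "optw m = (\<lambda>(P, S). of_nat (count P m))"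

lemma gf_omegas:
  assumes m: "m > 0" "m \<le> N"
  shows "gf opsum (optw m) (omegas m N) = dd m * (\<Prod>k\<in>bigparts m N. opp k)"
proof -
  have K: "finite (bigparts m N)" "0 \<notin> bigparts m N" by (auto simp: bigparts_def)
  note g = gf_oparts[OF K]
  have "gf opsum (optw m) (omegas m N) = gf (\<lambda>(x, y). m * x + opsum y)
      (\<lambda>(x, y). of_nat x * 1) ({c. c > 0} \<times> oparts (bigparts m N))"
  proof (rule gf_reindex[OF omegas_bij[OF m]])
    fix z :: "nat \<times> opart" assume "z \<in> {c. c > 0} \<times> oparts (bigparts m N)"
    then obtain c P S where z: "z = (c, (P, S))" "set_mset P \<subseteq> bigparts m N" by (auto simp: oparts_def)
    show "opsum (case z of (c, (P, S)) \<Rightarrow> (replicate_mset c m + P, insert m S)) = (\<lambda>(x, y). m * x + opsum y) z"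
      by (auto simp: z(1) opsum_def sum_mset_replicate_mset)
    have "m \<notin># P" using z(2) by (auto simp: bigparts_def)
    thus "optw m (case z of (c, (P, S)) \<Rightarrow> (replicate_mset c m + P, insert m S)) = (\<lambda>(x, y). of_nat x * 1) z"
      by (auto simp: z(1) optw_def not_in_iff)
  qed
  also have "\<dots> = dd m * (\<Prod>k\<in>bigparts m N. opp k)"
    using gf_mult[OF ffib_dd[OF m(1)] conjunct1[OF g], of of_nat "\<lambda>_. 1 :: complex"] g
    by (simp add: dd_def)
  finally show ?thesis .
qed

lemma spt_omega_eq:
  assumes "n \<le> M" "M \<le> N"
  shows "of_nat (spt_omega n) = (\<Sum>m\<in>{1..M}. gf opsum (optw m) (omegas m N) $ n)"
proof -
  let ?O = "omega_overpartitions n"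
  have O: "{z\<in>?O. Min (set_mset (fst z)) = m} = {z\<in>omegas m N. opsum z = n}" if "m \<in> {1..M}" for m
  proof (rule set_eqI)
    fix z :: opart
    obtain P S where z: "z = (P, S)" by force
    have le: "p \<le> N" if "p \<in># P" "sum_mset P = n" for p
      using that assms by (auto dest!: multi_member_split)
    have pos: "p > 0" if "p \<in># P" "Min (set_mset P) = m" for p
      using that \<open>m \<in> _\<close> by (metis Min_le atLeastAtMost_iff finite_set_mset le_trans less_le_trans zero_less_one)
    show "z \<in> {z\<in>?O. Min (set_mset (fst z)) = m} \<longleftrightarrow> z \<in> {z\<in>omegas m N. opsum z = n}"
      unfolding z using le pos
      by (auto simp: omega_overpartitions_def overpartitions_def omegas_def opsum_def)
  qed
  have "of_nat (spt_omega n) = (\<Sum>z\<in>?O. of_nat (count (fst z) (Min (set_mset (fst z)))) :: complex)"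
    by (simp add: spt_omega_def case_prod_unfold)
  also have "\<dots> = (\<Sum>m\<in>{1..M}. \<Sum>z\<in>{z\<in>?O. Min (set_mset (fst z)) = m}. of_nat (count (fst z) (Min (set_mset (fst z)))))"
  proof (rule sum.group[symmetric])
    show "(\<lambda>z. Min (set_mset (fst z))) ` ?O \<subseteq> {1..M}"
    proof
      fix m assume "m \<in> (\<lambda>z. Min (set_mset (fst z))) ` ?O"
      then obtain P S where z: "(P, S) \<in> ?O" "m = Min (set_mset P)" by force
      hence P: "P \<noteq> {#}" "sum_mset P = n" "\<forall>p\<in>#P. 0 < p"
        by (auto simp: omega_overpartitions_def overpartitions_def)
      hence "m \<in># P" using z(2) Min_in[of "set_mset P"] by auto
      moreover from this have "m \<le> n" using P(2) by (auto dest!: multi_member_split)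
      ultimately show "m \<in> {1..M}" using P(3) assms(1) by auto
    qed
  qed (auto simp: finite_omega_overpartitions)
  also have "\<dots> = (\<Sum>m\<in>{1..M}. gf opsum (optw m) (omegas m N) $ n)"
  proof (rule sum.cong[OF refl])
    fix m assume m: "m \<in> {1..M}"
    show "(\<Sum>z\<in>{z\<in>?O. Min (set_mset (fst z)) = m}. of_nat (count (fst z) (Min (set_mset (fst z))))) =
        gf opsum (optw m) (omegas m N) $ n"
      unfolding O[OF m] gf_def fps_nth_Abs_fps
      by (rule sum.cong) (auto simp: omegas_def optw_def)
  qed
  finally show ?thesis .
qed

section \<open>Expansion and telescoping of the sum over the smallest part\<close>

lemma X_nth_0: "X $ 0 = 0"
  by simp

lemma opp_nth_0 [simp]: "k > 0 \<Longrightarrow> opp k $ 0 = 1"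
  by (simp add: opp_def)

lemma opp_nonzero: "k > 0 \<Longrightarrow> opp k \<noteq> 0"
  using opp_nth_0[of k] by (metis fps_zero_nth zero_neq_one)

lemma inverse_opp_mult:
  assumes "k > 0"
  shows "inverse (opp k) * (1 + X ^ k) = 1 - X ^ k"
proof -
  have "inverse (opp k) * opp k = 1" by (rule inverse_mult_eq_1) (use assms in simp)
  moreover have "i * (1 + y) = 1 - y" if "i * p = 1" "p * (1 - y) = 1 + y" for i p y :: "complex fps"
    using that by algebra
  ultimately show ?thesis using opp_mult[OF assms] by blast
qed

text \<open>What is left of the product over \<open>bigparts\<close> after multiplication by
  \<open>Phi\<close>; the even parts above 2m have cancelled.\<close>

definition ratio :: "nat \<Rightarrow> complex fps" where
  "ratio m = (\<Prod>k\<in>{m<..2 * m}. opp k) * (\<Prod>j\<in>{1..m}. inverse (opp (2 * j)))"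

lemma ratio_Suc: "ratio (Suc m) * opp (Suc m) = ratio m * opp (2 * m + 1)"
proof -
  let ?o = "\<lambda>A. \<Prod>k\<in>A. opp k"
  have 1: "{m<..2 * Suc m} = insert (2 * m + 2) (insert (2 * m + 1) {m<..2 * m})" by auto
  have 2: "{m<..2 * Suc m} = insert (Suc m) {Suc m<..2 * Suc m}" by auto
  have "opp (Suc m) * ?o {Suc m<..2 * Suc m} = ?o {m<..2 * Suc m}"
    unfolding 2 by (subst prod.insert) auto
  also have "\<dots> = opp (2 * m + 2) * (opp (2 * m + 1) * ?o {m<..2 * m})"
    unfolding 1 by (subst prod.insert; simp)+
  finally have 3: "opp (Suc m) * ?o {Suc m<..2 * Suc m} = opp (2 * m + 2) * (opp (2 * m + 1) * ?o {m<..2 * m})" .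
  have 4: "opp (2 * m + 2) * inverse (opp (2 * m + 2)) = 1"
    by (rule inverse_mult_eq_1') simp
  have 5: "(\<Prod>j\<in>{1..Suc m}. inverse (opp (2 * j))) = (\<Prod>j\<in>{1..m}. inverse (opp (2 * j))) * inverse (opp (2 * m + 2))"
    by simp
  show ?thesis unfolding ratio_def 5 using 3 4 by algebra
qed

text \<open>Behind this are (-q; q)_(2m) / (-q^2; q^2)_m = (-q; q^2)_m and (q^2; q^2)_m / (-q; q)_m
  = (q; q)_m.\<close>

lemma ratio_eq: "ratio m * qq X (2 * m) = qq X m ^ 2 * (\<Prod>l<m. 1 + X ^ (2 * l + 1))"
proof (induction m)
  case 0
  show ?case by (simp add: ratio_def qq_def)
next
  case (Suc m)
  define Z where "Z = (\<Prod>l<m. 1 + X ^ (2 * l + 1))"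
  have q: "qq X (2 * Suc m) = qq X (2 * m) * (1 - X ^ (2 * m + 1)) * (1 - X ^ (2 * m + 2))"
    by (simp add: qq_Suc)
  have o: "opp (Suc m) * (1 - X ^ Suc m) = 1 + X ^ Suc m"
     "opp (2 * m + 1) * (1 - X ^ (2 * m + 1)) = 1 + X ^ (2 * m + 1)"
    by (rule opp_mult; simp)+
  have x: "1 - X ^ (2 * m + 2) = (1 - X ^ Suc m) * (1 + X ^ Suc m)"
  proof -
    have "2 * m + 2 = Suc m + Suc m" by simp
    hence "X ^ (2 * m + 2) = X ^ Suc m * X ^ Suc m" by (simp only: power_add)
    moreover have "1 - y * y = (1 - y) * (1 + y)" for y :: "complex fps" by (simp add: algebra_simps)
    ultimately show ?thesis by (simp only:)
  qed
  have alg: "(r' * (Q * (1 - z) * ((1 - y) * (1 + y))) - (P * (1 - y)) ^ 2 * (Z * (1 + z))) * p = 0"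
    if "r' * p = r * p'" "p * (1 - y) = 1 + y" "p' * (1 - z) = 1 + z" "r * Q = P ^ 2 * Z"
    for r r' p p' y z P Q Z :: "complex fps"
    using that by algebra
  have "(ratio (Suc m) * qq X (2 * Suc m) - qq X (Suc m) ^ 2 * (Z * (1 + X ^ (2 * m + 1)))) * opp (Suc m) = 0"
    unfolding q x qq_Suc[of X m] by (rule alg[OF ratio_Suc o Suc.IH[folded Z_def]])
  hence "ratio (Suc m) * qq X (2 * Suc m) = qq X (Suc m) ^ 2 * (Z * (1 + X ^ (2 * m + 1)))"
    using opp_nonzero[of "Suc m"] by (simp del: power_Suc)
  thus ?case by (simp add: Z_def)
qed

text \<open>The weight of the finite triple product at a = i q^(1/2), b = - i q^(1/2), where the
  factors pair up to 1 + q^(2l+1). Its term is i^r q^(r^2/2), and odd r cancel against - r. Checking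
  the recurrence directly avoids half-integral powers.\<close>

definition wt :: "int \<Rightarrow> complex fps" where
  "wt r = (if even r then fps_const (par (r div 2)) * X ^ (2 * sq (r div 2)) else 0)"

lemma sum_qbin_wt: "(\<Sum>r\<in>{- int n..int n}. qbin X n r * wt r) = (\<Prod>l<n. 1 + X ^ (2 * l + 1))"
proof (induction n)
  case 0
  show ?case by (simp add: qbin_def iqq_def qq_def wt_def par_def sq_def)
next
  case (Suc n)
  have "wt (s + 1) * X ^ nat (int n - s) + wt (s - 1) * X ^ nat (int n + s) = 0 * wt s"
    if s: "\<bar>s\<bar> \<le> int n" for s
  proof (cases "even s")
    case True
    thus ?thesis by (simp add: wt_def)
  next
    case False
    then obtain j where j: "s = 2 * j + 1" by (elim oddE)
    hence d: "(s + 1) div 2 = j + 1" "(s - 1) div 2 = j" by simp_all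
    have "int (sq (j + 1)) = int (sq j) + 2 * j + 1" by (simp add: algebra_simps)
    hence e: "2 * sq (j + 1) + nat (int n - s) = 2 * sq j + nat (int n + s)" using s j by linarith
    have "wt (s + 1) * X ^ nat (int n - s) = fps_const (par (j + 1)) * X ^ (2 * sq (j + 1) + nat (int n - s))"
      using False by (simp add: wt_def d power_add mult.assoc)
    moreover have "wt (s - 1) * X ^ nat (int n + s) = fps_const (par j) * X ^ (2 * sq j + nat (int n + s))"
      using False by (simp add: wt_def d power_add mult.assoc)
    moreover have "par (j + 1) = - par j" by (simp add: par_def)
    ultimately show ?thesis unfolding e by (simp flip: fps_const_neg)
  qed
  from qbin_sum_Suc[of X n wt 0, OF X_nth_0 this] show ?case
    by (simp only: Suc.IH add_0_right prod.lessThan_Suc mult.commute[of "1 + X ^ (2 * n + 1)"])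
qed

text \<open>The numerator (q; q)_(2m) of \<open>qbin\<close> cancels the denominator in
  \<open>ratio_eq\<close>, and \<open>dd m\<close> reduces (q; q)_m^2 to q^m (q; q)_(m-1)^2.\<close>

lemma dd_ratio:
  assumes "m > 0"
  shows "dd m * ratio m = (\<Sum>r\<in>{- int m..int m}. wt r * (X ^ m * qq X (m - 1) ^ 2 * iqq X (int m - r) * iqq X (int m + r)))"
proof -
  have q: "qq X m = qq X (m - 1) * (1 - X ^ m)"
    using qq_Suc[of X "m - 1"] assms by simp
  have i: "qq X (2 * m) * inverse (qq X (2 * m)) = 1" by (rule qq_inverse) simp
  have "dd m * ratio m * qq X (2 * m) = X ^ m * qq X (m - 1) ^ 2 * (\<Prod>l<m. 1 + X ^ (2 * l + 1))"
  proof -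
    have "d * r * Q = y * P ^ 2 * Z" if "r * Q = P' ^ 2 * Z" "d * (1 - y) ^ 2 = y" "P' = P * (1 - y)"
      for d r Q y P P' Z :: "complex fps" using that by algebra
    from this[OF ratio_eq[of m] dd_mult[OF assms] q] show ?thesis .
  qed
  also have "\<dots> = qq X (2 * m) * (\<Sum>r\<in>{- int m..int m}.
      wt r * (X ^ m * qq X (m - 1) ^ 2 * iqq X (int m - r) * iqq X (int m + r)))"
    unfolding sum_qbin_wt[symmetric] sum_distrib_left
    by (intro sum.cong refl) (simp add: qbin_def mult_ac)
  finally have "qq X (2 * m) * (dd m * ratio m) = qq X (2 * m) * (\<Sum>r\<in>{- int m..int m}.
      wt r * (X ^ m * qq X (m - 1) ^ 2 * iqq X (int m - r) * iqq X (int m + r)))" by (simp only: mult.commute)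
  moreover have "qq X (2 * m) \<noteq> 0" using i by force
  ultimately show ?thesis by (rule mult_left_cancel[THEN iffD1, rotated])
qed

definition inner :: "nat \<Rightarrow> int \<Rightarrow> complex fps" where
  "inner n r = (\<Sum>m\<in>{1..n}. X ^ m * qq X (m - 1) ^ 2 * iqq X (int m - r) * iqq X (int m + r))"

lemma inner_minus: "inner n (- r) = inner n r"
  by (simp add: inner_def mult_ac)

text \<open>For p > 0 each summand of \<open>inner\<close> is the difference of consecutive values
  of the closed form on the right, up to the factor (1 - q^p)^2.\<close>

lemma inner_telescope:
  assumes "p > 0"
  shows "(1 - X ^ p) ^ 2 * inner n (int p) = X ^ p * qq X n ^ 2 * iqq X (int n - int p) * iqq X (int n + int p)"
proof (induction n)
  case 0
  show ?case using assms by (simp add: inner_def iqq_def)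
next
  case (Suc n)
  define I J where "I = iqq X (int n + 1 - int p)" and "J = iqq X (int n + 1 + int p)"
  define a t where "a = X ^ nat (int n + 1 - int p)" and "t = X ^ Suc n"
  have 1: "iqq X (int n - int p) = (1 - a) * I"
    using iqq_pred[of X "int n + 1 - int p"] by (simp add: I_def a_def algebra_simps)
  have 2: "iqq X (int n + int p) = (1 - t * X ^ p) * J"
  proof -
    have "nat (int n + 1 + int p) = Suc n + p" by simp
    thus ?thesis using iqq_pred[of X "int n + 1 + int p"]
      by (simp only: J_def t_def power_add[symmetric]) (simp add: algebra_simps)
  qed
  \<comment> \<open>The factor I is kept because for p > n + 1 the exponent in a is truncated to 0;
    in that case I = 0.\<close>
  have 3: "I * (a * X ^ p) = I * t"
  proof (cases "p \<le> Suc n")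
    case True
    hence "nat (int n + 1 - int p) + p = Suc n" by linarith
    thus ?thesis by (simp only: a_def t_def power_add[symmetric])
  next
    case False
    thus ?thesis by (simp add: I_def iqq_def)
  qed
  have "inner (Suc n) (int p) = inner n (int p) + t * qq X n ^ 2 * I * J"
    by (simp add: inner_def I_def J_def t_def algebra_simps)
  hence "(1 - X ^ p) ^ 2 * inner (Suc n) (int p) =
      X ^ p * qq X n ^ 2 * ((1 - a) * I) * ((1 - t * X ^ p) * J) + (1 - X ^ p) ^ 2 * (t * qq X n ^ 2 * I * J)"
    using Suc.IH unfolding 1 2 by (simp only: distrib_left)
  also have "\<dots> = X ^ p * (qq X n * (1 - t)) ^ 2 * I * J"
  proof -
    have "y * q ^ 2 * ((1 - a) * I) * ((1 - t * y) * J) + (1 - y) ^ 2 * (t * q ^ 2 * I * J) = y * (q * (1 - t)) ^ 2 * I * J"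
      if "I * (a * y) = I * t" for y q a I J t :: "complex fps" using that by algebra
    from this[OF 3] show ?thesis .
  qed
  finally show ?case by (simp add: qq_Suc t_def I_def J_def algebra_simps)
qed

text \<open>As n grows, the q-factorials in the closed form cancel and q^p / (1 - q^p)^2 remains;
  the factor q^p raises the precision to n + 1.\<close>

lemma inner_fcong:
  assumes "p > 0" "p \<le> n"
  shows "fcong (Suc n) (inner n (int p)) (dd p)"
proof -
  define Z where "Z = qq X n ^ 2 * iqq X (int n - int p) * iqq X (int n + int p)"
  have nz: "(1 - X ^ p) ^ 2 \<noteq> 0" using inverse_1_minus[OF assms(1)] by force
  have "(1 - X ^ p) ^ 2 * inner n (int p) = (1 - X ^ p) ^ 2 * (dd p * Z)"
  proof -
    have "y * q * i * j = z * (d * (q * i * j))" if "d * z = y" for y q i j z d :: "complex fps"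
      unfolding that[symmetric] by (simp only: mult_ac)
    from this[OF dd_mult[OF assms(1)]] show ?thesis unfolding inner_telescope[OF assms(1)] Z_def .
  qed
  hence i: "inner n (int p) = dd p * Z" using nz by simp
  have "fcong (Suc (n - p)) (qq X n ^ 2 * inverse (qq X (n - p)) * inverse (qq X (n + p)))
      (qq X (n - p) ^ 2 * inverse (qq X (n - p)) * inverse (qq X (n - p)))"
    by (intro fcong_mult fcong_power fcong_inverse qq_fcong fcong_refl) auto
  moreover have "Z = qq X n ^ 2 * inverse (qq X (n - p)) * inverse (qq X (n + p))"
  proof -
    have "nat (int n - int p) = n - p" "nat (int n + int p) = n + p" "\<not> int n - int p < 0"
      using assms(2) by linarith+
    thus ?thesis by (simp add: Z_def iqq_def)
  qed
  moreover have "qq X (n - p) ^ 2 * inverse (qq X (n - p)) * inverse (qq X (n - p)) = 1"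
    using qq_inverse[of X "n - p"] by (simp add: power2_eq_square mult.assoc)
  ultimately have Z: "fcong (Suc (n - p)) Z 1" by simp
  have d: "dd p = X ^ p * (inverse ((1 - X ^ p) ^ 2))"
  proof -
    have "(1 - X ^ p) ^ 2 * inverse ((1 - X ^ p) ^ 2) = 1"
      by (rule inverse_mult_eq_1') (use assms(1) in \<open>simp add: fps_power_zeroth zero_power\<close>)
    moreover have "d = y * i" if "z * i = 1" "d * z = y" for d y z i :: "complex fps"
      using that by algebra
    ultimately show ?thesis using dd_mult[OF assms(1)] by blast
  qed
  have "fcong (p + Suc (n - p)) (X ^ p * (inverse ((1 - X ^ p) ^ 2) * Z)) (X ^ p * (inverse ((1 - X ^ p) ^ 2) * 1))"
    by (intro fcong_shift fcong_mult fcong_refl Z)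
  moreover have "p + Suc (n - p) = Suc n" using assms by simp
  ultimately show ?thesis by (simp add: i d mult_ac)
qed

text \<open>The index 0 is the one that does not telescope, and it is the source of the divisor
  sums.\<close>

lemma inner_0: "inner n 0 = (\<Sum>m\<in>{1..n}. dd m)"
  unfolding inner_def
proof (rule sum.cong[OF refl])
  fix m assume "m \<in> {1..n}"
  hence m: "m > 0" by simp
  have q: "qq X m = qq X (m - 1) * (1 - X ^ m)" using qq_Suc[of X "m - 1"] m by simp
  have i: "qq X m * inverse (qq X m) = 1" by (rule qq_inverse) simp
  have nz: "(1 - X ^ m) ^ 2 \<noteq> 0" using inverse_1_minus[OF m] by force
  have "(1 - X ^ m) ^ 2 * (X ^ m * qq X (m - 1) ^ 2 * inverse (qq X m) * inverse (qq X m)) = (1 - X ^ m) ^ 2 * dd m"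
  proof -
    have "(1 - y) ^ 2 * (y * P ^ 2 * i * i) = (1 - y) ^ 2 * d"
      if "Q = P * (1 - y)" "Q * i = 1" "d * (1 - y) ^ 2 = y" for y P Q i d :: "complex fps"
      using that by algebra
    from this[OF q i dd_mult[OF m]] show ?thesis .
  qed
  thus "X ^ m * qq X (m - 1) ^ 2 * iqq X (int m - 0) * iqq X (int m + 0) = dd m"
    using nz by (simp add: iqq_def)
qed

text \<open>A truncation of phim(q^2) in Gauss's product form, the product of (1 - q^(2j)) / (1 +
  q^(2j)).\<close>

definition Phi :: "nat \<Rightarrow> complex fps" where "Phi M = (\<Prod>j\<in>{1..M}. inverse (opp (2 * j)))"

lemma Phi_bigparts:
  assumes "m > 0" "m \<le> M"
  shows "Phi M * (\<Prod>k\<in>bigparts m (2 * M). opp k) = ratio m"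
proof -
  have b: "bigparts m (2 * M) = {m<..2 * m} \<union> (\<lambda>j. 2 * j) ` {m<..M}"
  proof (rule set_eqI)
    fix k
    show "k \<in> bigparts m (2 * M) \<longleftrightarrow> k \<in> {m<..2 * m} \<union> (\<lambda>j. 2 * j) ` {m<..M}"
    proof (cases "even k")
      case True
      then obtain j where "k = 2 * j" by auto
      thus ?thesis using assms by (auto simp: bigparts_def)
    next
      case False
      hence "k \<notin> (\<lambda>j. 2 * j) ` {m<..M}" "k \<noteq> 2 * m" by auto
      thus ?thesis using False assms by (auto simp: bigparts_def)
    qed
  qed
  have "(\<Prod>k\<in>bigparts m (2 * M). opp k) = (\<Prod>k\<in>{m<..2 * m}. opp k) * (\<Prod>k\<in>(\<lambda>j. 2 * j) ` {m<..M}. opp k)"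
    unfolding b by (rule prod.union_disjoint) auto
  also have "(\<Prod>k\<in>(\<lambda>j. 2 * j) ` {m<..M}. opp k) = (\<Prod>j\<in>{m<..M}. opp (2 * j))"
    by (subst prod.reindex) (auto simp: inj_on_def)
  finally have 1: "(\<Prod>k\<in>bigparts m (2 * M). opp k) = (\<Prod>k\<in>{m<..2 * m}. opp k) * (\<Prod>j\<in>{m<..M}. opp (2 * j))" .
  have "{1..M} = {1..m} \<union> {m<..M}" using assms by auto
  hence 2: "Phi M = (\<Prod>j\<in>{1..m}. inverse (opp (2 * j))) * (\<Prod>j\<in>{m<..M}. inverse (opp (2 * j)))"
    unfolding Phi_def by (simp only:) (rule prod.union_disjoint, auto)
  have "(\<Prod>j\<in>{m<..M}. inverse (opp (2 * j))) * (\<Prod>j\<in>{m<..M}. opp (2 * j)) = (\<Prod>j\<in>{m<..M}. 1)"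
    unfolding prod.distrib[symmetric]
    by (intro prod.cong refl inverse_mult_eq_1) auto
  thus ?thesis unfolding 1 2 ratio_def by (simp add: mult_ac)
qed

lemma Phi_fcong: "fcong n (Phi n) (phim oo X ^ 2)"
proof -
  have e2: "fcong n (\<Prod>l<n. 1 - X ^ (k * Suc l)) (eu k)" if "k > 0" for k
    unfolding eu_def using that by (intro iprod_fcong convp_eu) auto
  have P: "Phi n = (\<Prod>l<n. inverse (opp (2 * Suc l)))"
    unfolding Phi_def by (rule prod.reindex_bij_witness[of _ Suc "\<lambda>j. j - 1"]) auto
  have "Phi n * (\<Prod>l<n. 1 - X ^ (4 * Suc l)) = (\<Prod>l<n. 1 - X ^ (2 * Suc l)) ^ 2"
    unfolding P prod_power_distrib prod.distrib[symmetric]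
  proof (rule prod.cong[OF refl])
    fix l
    have "4 * Suc l = 2 * Suc l + 2 * Suc l" by simp
    hence "X ^ (4 * Suc l) = X ^ (2 * Suc l) * X ^ (2 * Suc l)" by (simp only: power_add)
    thus "inverse (opp (2 * Suc l)) * (1 - X ^ (4 * Suc l)) = (1 - X ^ (2 * Suc l)) ^ 2"
    proof -
      have "i * (1 - y4) = (1 - y) ^ 2" if "y4 = y * y" "i * (1 + y) = 1 - y" for i y y4 :: "complex fps"
        using that by algebra
      from this[OF \<open>X ^ (4 * Suc l) = _\<close> inverse_opp_mult] show ?thesis by simp
    qed
  qed
  moreover have "fcong n (Phi n * (\<Prod>l<n. 1 - X ^ (4 * Suc l))) (Phi n * eu 4)"
    by (intro fcong_mult fcong_refl e2) simp
  moreover have "fcong n ((\<Prod>l<n. 1 - X ^ (2 * Suc l)) ^ 2) (eu 2 ^ 2)"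
    by (intro fcong_power e2) simp
  ultimately have "fcong n (Phi n * eu 4) (eu 2 ^ 2)" by (metis fcong_sym fcong_trans)
  also have "eu 2 ^ 2 = (phim oo X ^ 2) * eu 4"
  proof -
    have "phim * eu 2 oo X ^ 2 = eu 1 ^ 2 oo X ^ 2" by (simp only: phim_prod)
    thus ?thesis by (simp add: compose_hom eu_compose)
  qed
  finally have e: "fcong n (Phi n * eu 4) ((phim oo X ^ 2) * eu 4)" .
  have "fcong n (Phi n * eu 4 * inverse (eu 4)) ((phim oo X ^ 2) * eu 4 * inverse (eu 4))"
    by (rule fcong_mult[OF e fcong_refl])
  moreover have "eu 4 * inverse (eu 4) = 1" by (rule inverse_mult_eq_1') simp
  ultimately show ?thesis by (simp only: mult.assoc mult_1_right)
qed

definition sptgf :: "complex fps" where "sptgf = Abs_fps (\<lambda>n. of_nat (spt_omega n))"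

text \<open>Interchanging the sums leaves the terms \<open>wt r * inner M r\<close>. For even r
  other than 0 the limit \<open>wt r * dd p\<close> has only even exponents, and odd r have weight
  0, so at odd n only r = 0 counts.\<close>

lemma sptgf_odd:
  assumes n: "odd n"
  shows "((phim oo X ^ 2) * sptgf) $ n = of_nat (sg n)"
proof -
  define M where "M = Suc n"
  define T where "T = (\<Sum>m\<in>{1..M}. gf opsum (optw m) (omegas m (2 * M)))"
  have T: "fcong (Suc n) sptgf T"
    unfolding fcong_def
  proof safe
    fix i assume "i < Suc n"
    thus "sptgf $ i = T $ i"
      using spt_omega_eq[of i M "2 * M"] by (simp add: sptgf_def T_def M_def fps_sum_nth)
  qed
  have "Phi M * T = (\<Sum>m\<in>{1..M}. dd m * ratio m)"
    unfolding T_def sum_distrib_left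
  proof (rule sum.cong[OF refl])
    fix m assume "m \<in> {1..M}"
    thus "Phi M * gf opsum (optw m) (omegas m (2 * M)) = dd m * ratio m"
      using Phi_bigparts[of m M] gf_omegas[of m "2 * M"] by (simp add: mult_ac)
  qed
  also have "\<dots> = (\<Sum>m\<in>{1..M}. \<Sum>r\<in>{- int M..int M}.
      wt r * (X ^ m * qq X (m - 1) ^ 2 * iqq X (int m - r) * iqq X (int m + r)))"
  proof (rule sum.cong[OF refl])
    fix m assume m: "m \<in> {1..M}"
    show "dd m * ratio m = (\<Sum>r\<in>{- int M..int M}.
      wt r * (X ^ m * qq X (m - 1) ^ 2 * iqq X (int m - r) * iqq X (int m + r)))"
    proof -
      have "dd m * ratio m = (\<Sum>r\<in>{- int m..int m}.
          wt r * (X ^ m * qq X (m - 1) ^ 2 * iqq X (int m - r) * iqq X (int m + r)))"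
        by (rule dd_ratio) (use m in simp)
      also have "\<dots> = (\<Sum>r\<in>{- int M..int M}.
          wt r * (X ^ m * qq X (m - 1) ^ 2 * iqq X (int m - r) * iqq X (int m + r)))"
      proof (rule sum.mono_neutral_left)
        show "\<forall>r\<in>{- int M..int M} - {- int m..int m}.
            wt r * (X ^ m * qq X (m - 1) ^ 2 * iqq X (int m - r) * iqq X (int m + r)) = 0"
          by (auto simp: iqq_def)
      qed (use m in auto)
      finally show ?thesis .
    qed
  qed
  also have "\<dots> = (\<Sum>r\<in>{- int M..int M}. wt r * inner M r)"
    by (subst sum.swap) (simp add: inner_def sum_distrib_left)
  finally have eq: "Phi M * T = (\<Sum>r\<in>{- int M..int M}. wt r * inner M r)" .
  have "fcong (Suc n) ((phim oo X ^ 2) * sptgf) (Phi M * T)"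
    using Phi_fcong[of M] by (intro fcong_mult T) (auto simp: M_def intro: fcong_sym)
  hence "((phim oo X ^ 2) * sptgf) $ n = (\<Sum>r\<in>{- int M..int M}. (wt r * inner M r) $ n)"
    unfolding eq by (simp add: fcong_def fps_sum_nth)
  also have "\<dots> = (wt 0 * inner M 0) $ n + (\<Sum>r\<in>{- int M..int M} - {0}. (wt r * inner M r) $ n)"
    by (rule sum.remove) auto
  also have "(\<Sum>r\<in>{- int M..int M} - {0}. (wt r * inner M r) $ n) = 0"
  proof (rule sum.neutral, rule ballI)
    fix r assume "r \<in> {- int M..int M} - {0}"
    hence r: "r \<in> {- int M..int M}" "r \<noteq> 0" by auto
    define p where "p = nat \<bar>r\<bar>"
    have p: "p > 0" "p \<le> M" "inner M r = inner M (int p)" "even p \<longleftrightarrow> even r"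
      using r inner_minus[of M "- r"] by (auto simp: p_def abs_if even_nat_iff)
    show "(wt r * inner M r) $ n = 0"
    proof (cases "even r")
      case True
      have "fcong (Suc M) (wt r * inner M r) (wt r * dd p)"
        unfolding p(3) by (intro fcong_mult fcong_refl inner_fcong p)
      hence "(wt r * inner M r) $ n = (wt r * dd p) $ n" by (rule fcong_nth) (simp add: M_def)
      also have "wt r * dd p = fps_const (par (r div 2)) * (X ^ (2 * sq (r div 2)) * dd p)"
        using True by (simp add: wt_def mult.assoc)
      also have "\<dots> $ n = 0"
      proof -
        have "\<not> p dvd n - 2 * k" if "\<not> n < 2 * k" for k
        proof
          assume "p dvd n - 2 * k"
          moreover have "2 dvd p" using p(4) True by simp
          ultimately have "2 dvd n - 2 * k" by (rule dvd_trans[rotated])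
          thus False using n that by simp
        qed
        thus ?thesis using p(1) by (simp add: fps_X_power_mult_nth dd_nth)
      qed
      finally show ?thesis .
    qed (simp add: wt_def)
  qed
  also have "wt 0 = 1" by (simp add: wt_def par_def sq_def)
  also have "(1 * inner M 0) $ n = (\<Sum>m\<in>{1..M}. if m dvd n then of_nat (n div m) else 0)"
    by (simp add: inner_0 fps_sum_nth dd_nth)
  also have "\<dots> = (\<Sum>m\<in>{m\<in>{1..M}. m dvd n}. of_nat (n div m))"
    by (rule sum.inter_filter[symmetric]) simp
  also have "{m\<in>{1..M}. m dvd n} = {m. m dvd n}"
  proof -
    have "n > 0" using n by (auto elim: oddE)
    thus ?thesis by (auto simp: M_def dest: dvd_imp_le intro!: Nat.gr0I)
  qed
  also have "(\<Sum>m | m dvd n. of_nat (n div m)) = of_nat (sg n)"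
  proof -
    have "n > 0" using n by (auto elim: oddE)
    hence "(\<Sum>m | m dvd n. n div m) = sg n"
      unfolding sg_def
      by (intro sum.reindex_bij_witness[of _ "\<lambda>d. n div d" "\<lambda>d. n div d"]) (auto elim!: dvdE)
    thus ?thesis by (simp flip: of_nat_sum)
  qed
  finally show ?thesis by simp
qed

definition oddspt :: "complex fps" where "oddspt = Abs_fps (\<lambda>n. of_nat (spt_omega (2 * n + 1)))"

theorem oddspt_phim: "oddspt * phim = psi ^ 4"
proof -
  have "(oddspt * phim) $ k = (psi ^ 4) $ k" for k
  proof -
    have "(oddspt * phim) $ k = (\<Sum>i\<le>k. phim $ i * oddspt $ (k - i))"
      by (simp add: mult.commute[of oddspt] fps_mult_nth atLeast0AtMost)
    also have "\<dots> = (\<Sum>i\<in>{i\<in>{..2 * k + 1}. even i}. phim $ (i div 2) * sptgf $ (2 * k + 1 - i))"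
    proof (rule sum.reindex_bij_witness[of _ "\<lambda>i. i div 2" "\<lambda>i. 2 * i"])
      fix i assume "i \<in> {..k}"
      hence "2 * k + 1 - 2 * i = 2 * (k - i) + 1" by auto
      thus "phim $ (2 * i div 2) * sptgf $ (2 * k + 1 - 2 * i) = phim $ i * oddspt $ (k - i)"
        by (simp add: sptgf_def oddspt_def)
    qed auto
    also have "\<dots> = (\<Sum>i\<le>2 * k + 1. if even i then phim $ (i div 2) * sptgf $ (2 * k + 1 - i) else 0)"
      by (rule sum.inter_filter) simp
    also have "\<dots> = ((phim oo X ^ 2) * sptgf) $ (2 * k + 1)"
      unfolding fps_mult_nth atLeast0AtMost by (intro sum.cong refl) (simp add: nth_compose_X_power)
    also have "\<dots> = (psi ^ 4) $ k" by (simp add: sptgf_odd psi_fourth_power)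
    finally show ?thesis .
  qed
  thus ?thesis by (simp add: fps_eq_iff)
qed

subsection \<open>Extraction of residue classes\<close>

text \<open>Dissection modulo 5. For r = 2 it multiplies the argument of \<open>spt_omega\<close> in
  \<open>oddspt\<close> by 5.\<close>

definition us :: "nat \<Rightarrow> complex fps \<Rightarrow> complex fps" where
  "us r f = Abs_fps (\<lambda>n. f $ (5 * n + r))"

lemma us_nth [simp]: "us r f $ n = f $ (5 * n + r)"
  by (simp add: us_def)

lemma us_add: "us r (f + g) = us r f + us r g"
  and us_diff: "us r (f - g) = us r f - us r g"
  and us_const: "us r (fps_const c * f) = fps_const c * us r f"
  by (simp_all add: fps_eq_iff)

lemma us_numeral: "us r (numeral k * f) = numeral k * us r f"
  using us_const[of r "numeral k"] by (simp add: numeral_fps_const)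

lemma us_compose_mult:
  assumes "r < 5"
  shows "us r ((f oo X ^ 5) * g) = f * us r g"
proof -
  have "((f oo X ^ 5) * g) $ (5 * n + r) = (f * us r g) $ n" for n
  proof -
    have "((f oo X ^ 5) * g) $ (5 * n + r) =
        (\<Sum>i\<in>{0..5 * n + r}. if 5 dvd i then f $ (i div 5) * g $ (5 * n + r - i) else 0)"
      by (auto simp: fps_mult_nth nth_compose_X_power intro!: sum.cong)
    also have "\<dots> = (\<Sum>i\<in>{i\<in>{0..5 * n + r}. 5 dvd i}. f $ (i div 5) * g $ (5 * n + r - i))"
      by (rule sum.inter_filter[symmetric]) simp
    also have "\<dots> = (\<Sum>i\<in>{0..n}. f $ i * g $ (5 * (n - i) + r))"
    proof (rule sum.reindex_bij_witness[of _ "\<lambda>i. 5 * i" "\<lambda>i. i div 5"])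
      fix a assume "a \<in> {i\<in>{0..5 * n + r}. 5 dvd i}"
      then obtain b where b: "a = 5 * b" "5 * b \<le> 5 * n + r" by auto
      hence "b \<le> n" using assms by linarith
      thus "a div 5 \<in> {0..n}" "f $ (a div 5) * g $ (5 * (n - a div 5) + r) = f $ (a div 5) * g $ (5 * n + r - a)"
        using b by (auto simp: diff_mult_distrib2)
    qed auto
    finally show ?thesis by (simp add: fps_mult_nth)
  qed
  thus ?thesis by (simp add: fps_eq_iff)
qed

lemma us_compose: "r < 5 \<Longrightarrow> us r (f oo X ^ 5) = (if r = 0 then f else 0)"
  by (auto simp: fps_eq_iff nth_compose_X_power dvd_add_right_iff dest: dvd_imp_le)

lemma us_X_power_mult:
  assumes "k \<le> r"
  shows "us r (X ^ k * f) = us (r - k) f"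
  using assms by (auto simp: fps_eq_iff fps_X_power_mult_nth)

text \<open>The shift passes a multiple of 5, which costs one power of X.\<close>

lemma us_X_power_mult':
  assumes "r < 5" "r < k" "k \<le> r + 5"
  shows "us r (X ^ k * f) = X * us (r + 5 - k) f"
proof -
  have "us r (X ^ k * f) $ n = (X * us (r + 5 - k) f) $ n" for n
  proof (cases n)
    case 0
    thus ?thesis using assms by (simp add: fps_X_power_mult_nth)
  next
    case (Suc m)
    hence "5 * n + r - k = 5 * m + (r + 5 - k)" "\<not> 5 * n + r < k" using assms by auto
    thus ?thesis using Suc by (simp add: fps_X_power_mult_nth)
  qed
  thus ?thesis by (simp add: fps_eq_iff)
qed

lemma us_X_power_compose_0:
  assumes "\<not> 5 dvd k"
  shows "us 0 (X ^ k * (f oo X ^ 5)) = 0"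
proof -
  have "us 0 (X ^ k * (f oo X ^ 5)) $ n = 0" for n
  proof (cases "5 * n < k")
    case False
    hence "\<not> 5 dvd 5 * n - k" using assms by (metis dvd_diff_nat dvd_triv_left diff_diff_cancel not_less)
    thus ?thesis using False by (simp add: fps_X_power_mult_nth nth_compose_X_power)
  qed (simp add: fps_X_power_mult_nth)
  thus ?thesis by (simp add: fps_eq_iff)
qed

subsection \<open>The function field of level ten\<close>

definition P5 :: "complex fps" where "P5 = phim oo X ^ 5"
definition A25 :: "complex fps" where "A25 = phim oo X ^ 25"
text \<open>The class-1 and class-4 parts of S are q al'(q^5) and q^4 be'(q^5).\<close>

definition al' :: "complex fps" where "al' = - 2 * ht1 * inverse P5"
definition be' :: "complex fps" where "be' = 2 * ht2 * inverse P5"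
definition al :: "complex fps" where "al = X * (al' oo X ^ 5)"
definition be :: "complex fps" where "be = X ^ 4 * (be' oo X ^ 5)"
definition S :: "complex fps" where "S = phim * inverse A25"
definition R :: "complex fps" where "R = A25 * inverse phim"
text \<open>u and x are mutually inverse, and so are v and y, their versions at q^5. A factor v or y
  therefore leaves the extraction as u or x.\<close>

definition u :: "complex fps" where "u = phim ^ 2 * inverse P5 ^ 2"
definition x :: "complex fps" where "x = P5 ^ 2 * inverse phim ^ 2"
definition v :: "complex fps" where "v = u oo X ^ 5"
definition y :: "complex fps" where "y = x oo X ^ 5"

lemma A25_eq: "A25 = P5 oo X ^ 5"
  by (simp add: A25_def P5_def compose_X_power_X_power)

lemma P5_nth_0 [simp]: "P5 $ 0 = 1" and A25_nth_0 [simp]: "A25 $ 0 = 1"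
  by (simp_all add: P5_def A25_def)

lemma inverse_mult_unit:
  "phim * inverse phim = 1" "P5 * inverse P5 = 1" "A25 * inverse A25 = 1"
  by (rule inverse_mult_eq_1', simp)+

lemma inverse_A25: "inverse A25 = inverse P5 oo X ^ 5"
  unfolding A25_eq by (rule fps_inverse_compose[symmetric]) simp_all

lemma al_eq: "al = 2 * ph5 1 * inverse A25"
  unfolding al_def al'_def inverse_A25 ph5_1 ht1_def[symmetric]
  by (simp add: compose_hom)

lemma be_eq: "be = 2 * ph5 2 * inverse A25"
  unfolding be_def be'_def inverse_A25 ph5_2 ht2_def[symmetric]
  by (simp add: compose_hom)

lemma S_eq: "S = 1 + al + be"
proof -
  have "phim = A25 + 2 * ph5 1 + 2 * ph5 2" using phim_dissect by (simp add: ph5_0 A25_def)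
  thus ?thesis using inverse_mult_unit(3) unfolding S_def al_eq be_eq by algebra
qed

lemma S_R: "S * R = 1"
  using inverse_mult_unit unfolding S_def R_def by algebra

lemma u_x: "u * x = 1"
  using inverse_mult_unit unfolding u_def x_def by algebra

lemma v_y: "v * y = 1"
proof -
  have "(u * x) oo X ^ 5 = 1" by (simp add: u_x)
  thus ?thesis by (simp add: v_def y_def compose_hom)
qed

lemma v_eq: "v = P5 ^ 2 * inverse A25 ^ 2"
  unfolding v_def u_def inverse_A25 by (simp add: compose_hom P5_def[symmetric])

lemma S_square: "S ^ 2 = u * v"
  using inverse_mult_unit unfolding v_eq u_def S_def by algebra

lemma al_be: "al * be = v - 1"
proof -
  have "P5 ^ 2 = A25 ^ 2 + 4 * (ph5 1 * ph5 2)"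
    unfolding P5_def phim_square_5 ph5_reflect A25_def ph5_0[symmetric] by (simp add: power2_eq_square algebra_simps)
  thus ?thesis using inverse_mult_unit(3) unfolding al_eq be_eq v_eq by algebra
qed

lemma al_be_norm: "1 + al ^ 5 + be ^ 5 - 5 * (al * be) + 5 * (al * be) ^ 2 = v ^ 3"
proof -
  have "A25 * (A25 ^ 5 + (2 * ph5 1) ^ 5 + (2 * ph5 2) ^ 5 - 5 * A25 ^ 3 * ((2 * ph5 1) * (2 * ph5 2))
      + 5 * A25 * ((2 * ph5 1) * (2 * ph5 2)) ^ 2) = P5 ^ 6"
    using phim_norm_relation unfolding A25_def P5_def .
  moreover have "2 * ph5 1 = A25 * al" "2 * ph5 2 = A25 * be" "P5 ^ 2 = A25 ^ 2 * v"
    using inverse_mult_unit(3) unfolding al_eq be_eq v_eq by algebra+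
  ultimately have "A25 ^ 6 * (1 + al ^ 5 + be ^ 5 - 5 * (al * be) + 5 * (al * be) ^ 2 - v ^ 3) = 0"
    by algebra
  moreover have "A25 \<noteq> 0" using A25_nth_0 by force
  ultimately show ?thesis by simp
qed

text \<open>The norm relation rewritten: al^5 + be^5 is a polynomial in the sum al + be = S - 1 and
  the product al be = v - 1.\<close>

lemma S_equation:
  "S ^ 5 = 5 * S ^ 4 - (15 - 5 * v) * S ^ 3 + (25 - 15 * v) * S ^ 2 - (25 - 25 * v + 5 * v ^ 2) * S + v ^ 3"
  using S_eq al_be al_be_norm by algebra

lemma u_not_1: "1 - u \<noteq> 0"
proof
  assume "1 - u = 0"
  hence "u = 1" by simp
  hence "phim ^ 2 = P5 ^ 2" using inverse_mult_unit unfolding u_def by algebra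
  hence "(phim ^ 2) $ 1 = (P5 ^ 2) $ 1" by simp
  thus False using phim_nth_1 by (simp add: power2_eq_square fps_mult_nth P5_def nth_compose_X_power)
qed

lemma u_nth_0: "u $ 0 = 1"
  by (simp add: u_def fps_power_zeroth)

lemma u_nonzero: "u \<noteq> 0" "5 - u \<noteq> 0" "u - 5 \<noteq> 0"
proof -
  show "u \<noteq> 0" using u_nth_0 by force
  have "(5 - u) $ 0 = 4" by (simp add: u_nth_0 numeral_fps_const)
  thus "5 - u \<noteq> 0" by force
  thus "u - 5 \<noteq> 0" by (metis eq_iff_diff_eq_0)
qed

text \<open>The five-dissection of \<open>S\<^sup>k\<close> is read off from \<open>S = 1 + al + be\<close>: the monomial
  \<open>al\<^sup>i be\<^sup>j\<close> lives in the residue class \<open>i - j\<close> modulo 5.\<close>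

lemma us_mono:
  assumes "\<not> 5 dvd i + 4 * j"
  shows "us 0 (al ^ i * be ^ j) = 0"
proof -
  have "al ^ i = X ^ i * (al' ^ i oo X ^ 5)" "be ^ j = X ^ (4 * j) * (be' ^ j oo X ^ 5)"
    by (simp_all add: al_def be_def compose_hom power_mult_distrib power_mult)
  hence "al ^ i * be ^ j = X ^ (i + 4 * j) * ((al' ^ i * be' ^ j) oo X ^ 5)"
    by (simp add: compose_hom power_add mult_ac)
  thus ?thesis using us_X_power_compose_0[OF assms] by simp
qed

lemma us_monos:
  "us 0 al = 0" "us 0 be = 0" "us 0 (al ^ 2) = 0" "us 0 (be ^ 2) = 0" "us 0 (al ^ 3) = 0" "us 0 (be ^ 3) = 0"
  "us 0 (al ^ 4) = 0" "us 0 (be ^ 4) = 0" "us 0 (al ^ 2 * be) = 0" "us 0 (al * be ^ 2) = 0"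
  "us 0 (al ^ 3 * be) = 0" "us 0 (al * be ^ 3) = 0"
  "us 0 (al ^ 1 * be ^ 2) = 0" "us 0 (al ^ 2 * be ^ 1) = 0"
  using us_mono[of 1 0] us_mono[of 0 1] us_mono[of 2 0] us_mono[of 0 2] us_mono[of 3 0] us_mono[of 0 3]
    us_mono[of 4 0] us_mono[of 0 4] us_mono[of 2 1] us_mono[of 1 2] us_mono[of 3 1] us_mono[of 1 3]
  by simp_all

lemma us_v: "us 0 1 = 1" "us 0 (v ^ k) = u ^ k" "us 0 v = u"
  using us_compose[of 0 1] us_compose[of 0 "u ^ k"] us_compose[of 0 u] by (simp_all add: v_def compose_hom)

lemma us_0_numeral: "us 0 (numeral k) = numeral k"
  using us_numeral[of 0 k 1] by (simp add: us_v)

lemma us_v_mult: "r < 5 \<Longrightarrow> us r (v * f) = u * us r f" "r < 5 \<Longrightarrow> us r (v ^ k * f) = u ^ k * us r f"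
  using us_compose_mult[of r u f] us_compose_mult[of r "u ^ k" f] by (simp_all add: v_def compose_hom)

lemma us_y_mult: "r < 5 \<Longrightarrow> us r (y * f) = x * us r f" "r < 5 \<Longrightarrow> us r (y ^ k * f) = x ^ k * us r f"
  using us_compose_mult[of r x f] us_compose_mult[of r "x ^ k" f] by (simp_all add: y_def compose_hom)

lemma us_rec:
  assumes "r < 5"
  shows "us r (h * S ^ (k + 5)) = 5 * us r (h * S ^ (k + 4)) - (15 - 5 * u) * us r (h * S ^ (k + 3))
    + (25 - 15 * u) * us r (h * S ^ (k + 2)) - (25 - 25 * u + 5 * u ^ 2) * us r (h * S ^ (k + 1)) + u ^ 3 * us r (h * S ^ k)"
proof -
  have "h * S ^ (k + 5) = (h * S ^ k) * S ^ 5" by (simp add: power_add mult_ac)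
  also have "\<dots> = 5 * (h * S ^ (k + 4)) - (15 * (h * S ^ (k + 3)) - 5 * (v * (h * S ^ (k + 3))))
    + (25 * (h * S ^ (k + 2)) - 15 * (v * (h * S ^ (k + 2))))
    - (25 * (h * S ^ (k + 1)) - 25 * (v * (h * S ^ (k + 1))) + 5 * (v ^ 2 * (h * S ^ (k + 1)))) + v ^ 3 * (h * S ^ k)"
    unfolding S_equation power_add power_one_right by (simp add: algebra_simps)
  finally have "us r (h * S ^ (k + 5)) = us r \<dots>" by (rule arg_cong)
  thus ?thesis
    unfolding us_add us_diff us_numeral us_v_mult[OF assms] by (simp add: algebra_simps)
qed

definition sig :: "nat \<Rightarrow> complex fps" where "sig k = us 0 (S ^ k)"

text \<open>Up to k = 4 only powers of al be = v - 1 survive in the expansion of (1 + al + be)^k; k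
  = 5 and k = 6 follow from the quintic.\<close>

lemma sig_values:
  "sig 0 = 1" "sig 1 = 1" "sig 2 = 2 * u - 1" "sig 3 = 6 * u - 5" "sig 4 = 6 * u ^ 2 - 5"
  "sig 5 = u ^ 3 + 25 * u ^ 2 - 25 * u" "sig 6 = 26 * u ^ 3 - 25"
proof -
  show 0: "sig 0 = 1" by (simp add: sig_def us_v)
  show 1: "sig 1 = 1" unfolding sig_def power_one_right S_eq us_add us_v us_monos by simp
  have "S ^ 2 = (2 * v - 1) + 2 * al + 2 * be + al ^ 2 + be ^ 2"
    using S_eq al_be by algebra
  thus 2: "sig 2 = 2 * u - 1"
    unfolding sig_def by (simp add: us_add us_diff us_numeral us_v us_monos)
  have "S ^ 3 = (6 * v - 5) + 3 * al + 3 * be + 3 * al ^ 2 + 3 * be ^ 2 + al ^ 3 + be ^ 3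
       + 3 * (al ^ 2 * be) + 3 * (al * be ^ 2)"
    using S_eq al_be by algebra
  thus 3: "sig 3 = 6 * u - 5"
    unfolding sig_def by (simp add: us_add us_diff us_numeral us_v us_monos us_0_numeral)
  have "S ^ 4 = (6 * v ^ 2 - 5) + 4 * al + 4 * be + 6 * al ^ 2 + 6 * be ^ 2 + 4 * al ^ 3 + 4 * be ^ 3
       + al ^ 4 + be ^ 4 + 12 * (al ^ 2 * be) + 12 * (al * be ^ 2) + 4 * (al ^ 3 * be) + 4 * (al * be ^ 3)"
    using S_eq al_be by algebra
  thus 4: "sig 4 = 6 * u ^ 2 - 5"
    unfolding sig_def by (simp add: us_add us_diff us_numeral us_v us_monos us_0_numeral)
  have r: "sig k5 = 5 * sig k4 - (15 - 5 * u) * sig k3 + (25 - 15 * u) * sig k2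
      - (25 - 25 * u + 5 * u ^ 2) * sig k1 + u ^ 3 * sig k"
    if "k1 = k + 1" "k2 = k + 2" "k3 = k + 3" "k4 = k + 4" "k5 = k + 5" for k k1 k2 k3 k4 k5
    using us_rec[of 0 1 k] unfolding that by (simp only: sig_def mult_1_left)
  show 5: "sig 5 = u ^ 3 + 25 * u ^ 2 - 25 * u"
  proof -
    have "sig 5 = 5 * sig 4 - (15 - 5 * u) * sig 3 + (25 - 15 * u) * sig 2
        - (25 - 25 * u + 5 * u ^ 2) * sig 1 + u ^ 3 * sig 0"
      by (rule r) simp_all
    thus ?thesis using 0 1 2 3 4 by algebra
  qed
  show "sig 6 = 26 * u ^ 3 - 25"
  proof -
    have "sig 6 = 5 * sig 5 - (15 - 5 * u) * sig 4 + (25 - 15 * u) * sig 3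
        - (25 - 25 * u + 5 * u ^ 2) * sig 2 + u ^ 3 * sig 1"
      by (rule r) simp_all
    thus ?thesis using 1 2 3 4 5 by algebra
  qed
qed

section \<open>Extraction of psi^2 S^k and psi^4 S^k\<close>

definition T1 :: "nat \<Rightarrow> complex fps" where "T1 k = us 1 (psi ^ 2 * S ^ k)"
definition T2 :: "nat \<Rightarrow> complex fps" where "T2 k = us 2 (psi ^ 4 * S ^ k)"

lemma T_rec:
  assumes "k1 = k + 1" "k2 = k + 2" "k3 = k + 3" "k4 = k + 4" "k5 = k + 5"
  shows "T1 k5 = 5 * T1 k4 - (15 - 5 * u) * T1 k3 + (25 - 15 * u) * T1 k2 - (25 - 25 * u + 5 * u ^ 2) * T1 k1 + u ^ 3 * T1 k"
    and "T2 k5 = 5 * T2 k4 - (15 - 5 * u) * T2 k3 + (25 - 15 * u) * T2 k2 - (25 - 25 * u + 5 * u ^ 2) * T2 k1 + u ^ 3 * T2 k"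
  unfolding T1_def T2_def assms by (rule us_rec, simp)+

text \<open>Multiplying \<open>psi\<^sup>2 S\<^sup>k\<close> by \<open>v - S\<^sup>2\<close> trades one factor \<open>psi\<^sup>2\<close> for a series in \<open>q\<^sup>5\<close>. In this
  way \<open>T2\<close> reduces to \<open>T1\<close>, and \<open>T1\<close> to \<open>sig\<close>.\<close>

lemma psi_S: "(v - S ^ 2) * psi ^ 2 = X * ((psi oo X ^ 5) ^ 2 * (5 * v - S ^ 2))"
proof -
  have "(P5 ^ 2 - phim ^ 2) * psi ^ 2 = X * (psi oo X ^ 5) ^ 2 * (5 * P5 ^ 2 - phim ^ 2)"
    using psi_phim_level_10 unfolding P5_def .
  moreover have "v = P5 ^ 2 * inverse A25 ^ 2" "S ^ 2 = phim ^ 2 * inverse A25 ^ 2"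
    by (simp_all add: v_eq S_def power_mult_distrib)
  ultimately show ?thesis by algebra
qed

lemma psi_power_mult: "us 0 ((psi oo X ^ 5) ^ k * f) = psi ^ k * us 0 f"
  "us 1 ((psi oo X ^ 5) ^ k * f) = psi ^ k * us 1 f"
  using us_compose_mult[of 0 "psi ^ k" f] us_compose_mult[of 1 "psi ^ k" f] by (simp_all add: compose_hom)

lemma T1_rel:
  assumes m: "m = k + 2"
  shows "u * T1 k - T1 m = psi ^ 2 * (5 * u * sig k - sig m)"
proof -
  have "v * (psi ^ 2 * S ^ k) - psi ^ 2 * S ^ (k + 2) =
     X ^ 1 * ((psi oo X ^ 5) ^ 2 * (5 * (v * S ^ k) - S ^ (k + 2)))"
  proof -
    have "v * (psi ^ 2 * S ^ k) - psi ^ 2 * S ^ (k + 2) = ((v - S ^ 2) * psi ^ 2) * S ^ k"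
      by (simp add: power_add power2_eq_square algebra_simps)
    thus ?thesis unfolding psi_S by (simp add: power_add power2_eq_square algebra_simps)
  qed
  hence "us 1 (v * (psi ^ 2 * S ^ k) - psi ^ 2 * S ^ (k + 2)) =
     us 1 (X ^ 1 * ((psi oo X ^ 5) ^ 2 * (5 * (v * S ^ k) - S ^ (k + 2))))" by (rule arg_cong)
  moreover have "us 1 (X ^ 1 * f) = us 0 f" for f using us_X_power_mult[of 1 1 f] by simp
  moreover have "us 1 (v * f) = u * us 1 f" "us 0 (v * f) = u * us 0 f" for f
    by (rule us_v_mult, simp)+
  ultimately show ?thesis
    unfolding us_diff T1_def sig_def m by (simp only: us_diff us_numeral psi_power_mult mult.assoc)
qed

lemma T2_rel:
  assumes m: "m = k + 2"
  shows "u * T2 k - T2 m = psi ^ 2 * (5 * u * T1 k - T1 m)"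
proof -
  have "v * (psi ^ 4 * S ^ k) - psi ^ 4 * S ^ (k + 2) =
     X ^ 1 * ((psi oo X ^ 5) ^ 2 * (5 * (v * (psi ^ 2 * S ^ k)) - psi ^ 2 * S ^ (k + 2)))"
  proof -
    have "psi ^ 4 = psi ^ 2 * psi ^ 2" by (simp flip: power_add)
    hence "v * (psi ^ 4 * S ^ k) - psi ^ 4 * S ^ (k + 2) = ((v - S ^ 2) * psi ^ 2) * (psi ^ 2 * S ^ k)"
      by (simp add: power_add power2_eq_square algebra_simps)
    thus ?thesis unfolding psi_S by (simp add: power_add power2_eq_square algebra_simps)
  qed
  hence "us 2 (v * (psi ^ 4 * S ^ k) - psi ^ 4 * S ^ (k + 2)) =
     us 2 (X ^ 1 * ((psi oo X ^ 5) ^ 2 * (5 * (v * (psi ^ 2 * S ^ k)) - psi ^ 2 * S ^ (k + 2))))" by (rule arg_cong)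
  moreover have "us 2 (X ^ 1 * f) = us 1 f" for f using us_X_power_mult[of 1 2 f] by simp
  moreover have "us 2 (v * f) = u * us 2 f" "us 1 (v * f) = u * us 1 f" for f
    by (rule us_v_mult, simp)+
  ultimately show ?thesis
    unfolding us_diff T1_def T2_def m by (simp only: us_diff us_numeral psi_power_mult mult.assoc)
qed

text \<open>The differences express t2 to t6 through t0 and t1; the two instances of the quintic
  recurrence then become linear equations, one for t1 - u t0 and one for t0 - t1. Combining them
  leaves the factor 1 - u at t0.\<close>

lemma solve_rec:
  fixes u t0 t1 t2 t3 t4 t5 t6 :: "complex fps"
  assumes "u * t0 - t2 = r0" "u * t1 - t3 = r1" "u * t2 - t4 = r2" "u * t3 - t5 = r3" "u * t4 - t6 = r4"
    and rec: "t5 = 5 * t4 - (15 - 5 * u) * t3 + (25 - 15 * u) * t2 - (25 - 25 * u + 5 * u ^ 2) * t1 + u ^ 3 * t0"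
    "t6 = 5 * t5 - (15 - 5 * u) * t4 + (25 - 15 * u) * t3 - (25 - 25 * u + 5 * u ^ 2) * t2 + u ^ 3 * t1"
  shows "((1 - u) * u * (u - 5) ^ 2) * t0 = u * ((10 * u - 25) * r0 + (15 - 4 * u) * r1 - 5 * r2 + r3)
      + ((u - 5) ^ 2 * r0 + (10 * u - 25) * r1 + (15 - 4 * u) * r2 - 5 * r3 + r4)" (is ?A)
    and "(u * (u - 5) ^ 2) * t1 = (u * (u - 5) ^ 2) * t0
      - ((u - 5) ^ 2 * r0 + (10 * u - 25) * r1 + (15 - 4 * u) * r2 - 5 * r3 + r4)" (is ?B)
proof -
  have r: "r0 = u * t0 - t2" "r1 = u * t1 - t3" "r2 = u * t2 - t4" "r3 = u * t3 - t5" "r4 = u * t4 - t6"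
    using assms by simp_all
  have 0: "(u - 5) ^ 2 * (t1 - u * t0) = (10 * u - 25) * r0 + (15 - 4 * u) * r1 - 5 * r2 + r3"
    unfolding r rec(1) by (simp add: algebra_simps power2_eq_square power3_eq_cube)
  have 1: "u * (u - 5) ^ 2 * (t0 - t1) =
      (u - 5) ^ 2 * r0 + (10 * u - 25) * r1 + (15 - 4 * u) * r2 - 5 * r3 + r4"
    unfolding r rec(2) by (simp add: algebra_simps power2_eq_square power3_eq_cube)
  show ?A unfolding 0[symmetric] 1[symmetric] by (simp add: algebra_simps power2_eq_square)
  show ?B unfolding 1[symmetric] by (simp add: algebra_simps power2_eq_square)
qed

lemma T1_values:
  "(5 - u) * T1 0 = psi ^ 2 * (9 - u)" "(5 - u) * T1 1 = psi ^ 2 * (5 - 5 * u)"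
  "(5 - u) * T1 2 = psi ^ 2 * (2 * u ^ 2 - 5 * u - 5)" "(5 - u) * T1 3 = psi ^ 2 * (- 6 * u ^ 2 + 15 * u - 25)"
  "(5 - u) * T1 4 = psi ^ 2 * (6 * u ^ 3 - 30 * u ^ 2 + 25 * u - 25)"
  "(5 - u) * T1 5 = psi ^ 2 * (- (u ^ 4) + 4 * u ^ 3 - 10 * u ^ 2 - 25 * u)"
  "(5 - u) * T1 6 = psi ^ 2 * (10 * u ^ 4 - 50 * u ^ 3 + 125 * u - 125)"
proof -
  have "u * T1 0 - T1 2 = psi ^ 2 * (5 * u * sig 0 - sig 2)" "u * T1 1 - T1 3 = psi ^ 2 * (5 * u * sig 1 - sig 3)"
    "u * T1 2 - T1 4 = psi ^ 2 * (5 * u * sig 2 - sig 4)" "u * T1 3 - T1 5 = psi ^ 2 * (5 * u * sig 3 - sig 5)"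
    "u * T1 4 - T1 6 = psi ^ 2 * (5 * u * sig 4 - sig 6)"
    by (rule T1_rel, simp)+
  note rel = this[unfolded sig_values]
  have rec: "T1 5 = 5 * T1 4 - (15 - 5 * u) * T1 3 + (25 - 15 * u) * T1 2 - (25 - 25 * u + 5 * u ^ 2) * T1 1 + u ^ 3 * T1 0"
    "T1 6 = 5 * T1 5 - (15 - 5 * u) * T1 4 + (25 - 15 * u) * T1 3 - (25 - 25 * u + 5 * u ^ 2) * T1 2 + u ^ 3 * T1 1"
    by (rule T_rec; simp)+
  note s = solve_rec[OF rel rec]
  have "((1 - u) * u * (u - 5) ^ 2) * ((5 - u) * T1 0) = (5 - u) * (((1 - u) * u * (u - 5) ^ 2) * T1 0)"
    by (simp only: mult_ac)
  also have "\<dots> = ((1 - u) * u * (u - 5) ^ 2) * (psi ^ 2 * (9 - u))" unfolding s(1) by algebra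
  finally show 0: "(5 - u) * T1 0 = psi ^ 2 * (9 - u)"
    by (rule mult_left_cancel[THEN iffD1, rotated]) (use u_nonzero u_not_1 in simp)
  have "(u * (u - 5) ^ 2) * ((5 - u) * T1 1) = (5 - u) * ((u * (u - 5) ^ 2) * T1 1)"
    by (simp only: mult_ac)
  also have "\<dots> = (u * (u - 5) ^ 2) * (psi ^ 2 * (5 - 5 * u))" unfolding s(2) using 0 by algebra
  finally show 1: "(5 - u) * T1 1 = psi ^ 2 * (5 - 5 * u)"
    by (rule mult_left_cancel[THEN iffD1, rotated]) (use u_nonzero in simp)
  show "(5 - u) * T1 2 = psi ^ 2 * (2 * u ^ 2 - 5 * u - 5)" using rel 0 by algebra
  show "(5 - u) * T1 3 = psi ^ 2 * (- 6 * u ^ 2 + 15 * u - 25)" using rel 1 by algebra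
  show "(5 - u) * T1 4 = psi ^ 2 * (6 * u ^ 3 - 30 * u ^ 2 + 25 * u - 25)" using rel 0 by algebra
  show "(5 - u) * T1 5 = psi ^ 2 * (- (u ^ 4) + 4 * u ^ 3 - 10 * u ^ 2 - 25 * u)" using rel 1 by algebra
  show "(5 - u) * T1 6 = psi ^ 2 * (10 * u ^ 4 - 50 * u ^ 3 + 125 * u - 125)" using rel 0 by algebra
qed

lemma T1_comb:
  fixes u p a b A B :: "complex fps"
  assumes "(5 - u) * a = p * A" "(5 - u) * b = p * B"
  shows "(5 - u) * (p * (5 * u * a - b)) = p * p * (5 * u * A - B)"
  using assms by algebra

text \<open>The right-hand sides of \<open>solve_rec\<close> for T2, with p for psi^4. Each r_i has
  the denominator 5 - u inherited from \<open>T1_values\<close>, so a second power of it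
  appears.\<close>

lemma
  fixes u p t0 r0 r1 r2 r3 r4 :: "complex fps"
  assumes r: "(5 - u) * r0 = p * (5 * u * (9 - u) - (2 * u ^ 2 - 5 * u - 5))"
    "(5 - u) * r1 = p * (5 * u * (5 - 5 * u) - (- 6 * u ^ 2 + 15 * u - 25))"
    "(5 - u) * r2 = p * (5 * u * (2 * u ^ 2 - 5 * u - 5) - (6 * u ^ 3 - 30 * u ^ 2 + 25 * u - 25))"
    "(5 - u) * r3 = p * (5 * u * (- 6 * u ^ 2 + 15 * u - 25) - (- (u ^ 4) + 4 * u ^ 3 - 10 * u ^ 2 - 25 * u))"
    "(5 - u) * r4 = p * (5 * u * (6 * u ^ 3 - 30 * u ^ 2 + 25 * u - 25) - (10 * u ^ 4 - 50 * u ^ 3 + 125 * u - 125))"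
  shows solve_comb_1: "(5 - u) ^ 2 * (u * ((10 * u - 25) * r0 + (15 - 4 * u) * r1 - 5 * r2 + r3) + ((u - 5) ^ 2 * r0 + (10 * u - 25) * r1 + (15 - 4 * u) * r2 - 5 * r3 + r4)) =
      ((1 - u) * u * (u - 5) ^ 2) * (p * (u ^ 2 - 50 * u + 145))"
    and solve_comb_2: "(5 - u) ^ 2 * t0 = p * (u ^ 2 - 50 * u + 145) \<Longrightarrow>
      (5 - u) ^ 2 * ((u * (u - 5) ^ 2) * t0 - ((u - 5) ^ 2 * r0 + (10 * u - 25) * r1 + (15 - 4 * u) * r2 - 5 * r3 + r4)) = (u * (u - 5) ^ 2) * (p * (- 7 * u ^ 2 - 50 * u + 25))"
proof -
  have "(5 - u) ^ 2 * (u * ((10 * u - 25) * r0 + (15 - 4 * u) * r1 - 5 * r2 + r3) + ((u - 5) ^ 2 * r0 + (10 * u - 25) * r1 + (15 - 4 * u) * r2 - 5 * r3 + r4)) =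
      (5 - u) * (u * ((10 * u - 25) * ((5 - u) * r0) + (15 - 4 * u) * ((5 - u) * r1) - 5 * ((5 - u) * r2) + ((5 - u) * r3)) + ((u - 5) ^ 2 * ((5 - u) * r0) + (10 * u - 25) * ((5 - u) * r1) + (15 - 4 * u) * ((5 - u) * r2) - 5 * ((5 - u) * r3) + ((5 - u) * r4)))"
    by (simp add: power2_eq_square algebra_simps)
  also have "\<dots> = ((1 - u) * u * (u - 5) ^ 2) * (p * (u ^ 2 - 50 * u + 145))"
    unfolding r by algebra
  finally show "(5 - u) ^ 2 * (u * ((10 * u - 25) * r0 + (15 - 4 * u) * r1 - 5 * r2 + r3) + ((u - 5) ^ 2 * r0 + (10 * u - 25) * r1 + (15 - 4 * u) * r2 - 5 * r3 + r4)) =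
      ((1 - u) * u * (u - 5) ^ 2) * (p * (u ^ 2 - 50 * u + 145))" .
  assume t0: "(5 - u) ^ 2 * t0 = p * (u ^ 2 - 50 * u + 145)"
  have "(5 - u) ^ 2 * ((u * (u - 5) ^ 2) * t0 - ((u - 5) ^ 2 * r0 + (10 * u - 25) * r1 + (15 - 4 * u) * r2 - 5 * r3 + r4)) =
      (u * (u - 5) ^ 2) * ((5 - u) ^ 2 * t0) - (5 - u) * ((u - 5) ^ 2 * ((5 - u) * r0) + (10 * u - 25) * ((5 - u) * r1) + (15 - 4 * u) * ((5 - u) * r2) - 5 * ((5 - u) * r3) + ((5 - u) * r4))"
    by (simp add: power2_eq_square algebra_simps)
  also have "\<dots> = (u * (u - 5) ^ 2) * (p * (- 7 * u ^ 2 - 50 * u + 25))"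
    unfolding r t0 by algebra
  finally show "(5 - u) ^ 2 * ((u * (u - 5) ^ 2) * t0 - ((u - 5) ^ 2 * r0 + (10 * u - 25) * r1 + (15 - 4 * u) * r2 - 5 * r3 + r4)) = (u * (u - 5) ^ 2) * (p * (- 7 * u ^ 2 - 50 * u + 25))" .
qed

lemma T2_values:
  "(5 - u) ^ 2 * T2 0 = psi ^ 4 * (u ^ 2 - 50 * u + 145)"
  "(5 - u) ^ 2 * T2 1 = psi ^ 4 * (- 7 * u ^ 2 - 50 * u + 25)"
  "(5 - u) ^ 2 * T2 2 = psi ^ 4 * (- 6 * u ^ 3 + 35 * u ^ 2 - 100 * u - 25)"
  "(5 - u) ^ 2 * T2 3 = psi ^ 4 * (- 26 * u ^ 3 + 55 * u ^ 2 - 125)"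
  "(5 - u) ^ 2 * T2 4 = psi ^ 4 * (- 2 * u ^ 4 + 20 * u ^ 3 - 175 * u ^ 2 + 250 * u - 125)"
proof -
  have p: "psi ^ 4 = psi ^ 2 * psi ^ 2" by (simp flip: power_add)
  have t: "u * T2 0 - T2 2 = psi ^ 2 * (5 * u * T1 0 - T1 2)" "u * T2 1 - T2 3 = psi ^ 2 * (5 * u * T1 1 - T1 3)"
    "u * T2 2 - T2 4 = psi ^ 2 * (5 * u * T1 2 - T1 4)" "u * T2 3 - T2 5 = psi ^ 2 * (5 * u * T1 3 - T1 5)"
    "u * T2 4 - T2 6 = psi ^ 2 * (5 * u * T1 4 - T1 6)"
    by (rule T2_rel, simp)+
  have rel: "(5 - u) * (u * T2 0 - T2 2) = psi ^ 4 * (5 * u * (9 - u) - (2 * u ^ 2 - 5 * u - 5))"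
    "(5 - u) * (u * T2 1 - T2 3) = psi ^ 4 * (5 * u * (5 - 5 * u) - (- 6 * u ^ 2 + 15 * u - 25))"
    "(5 - u) * (u * T2 2 - T2 4) = psi ^ 4 * (5 * u * (2 * u ^ 2 - 5 * u - 5) - (6 * u ^ 3 - 30 * u ^ 2 + 25 * u - 25))"
    "(5 - u) * (u * T2 3 - T2 5) = psi ^ 4 * (5 * u * (- 6 * u ^ 2 + 15 * u - 25) - (- (u ^ 4) + 4 * u ^ 3 - 10 * u ^ 2 - 25 * u))"
    "(5 - u) * (u * T2 4 - T2 6) = psi ^ 4 * (5 * u * (6 * u ^ 3 - 30 * u ^ 2 + 25 * u - 25) - (10 * u ^ 4 - 50 * u ^ 3 + 125 * u - 125))"
    unfolding t p by (rule T1_comb[OF T1_values(1,3)] T1_comb[OF T1_values(2,4)] T1_comb[OF T1_values(3,5)]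
      T1_comb[OF T1_values(4,6)] T1_comb[OF T1_values(5,7)])+
  have rec: "T2 5 = 5 * T2 4 - (15 - 5 * u) * T2 3 + (25 - 15 * u) * T2 2 - (25 - 25 * u + 5 * u ^ 2) * T2 1 + u ^ 3 * T2 0"
    "T2 6 = 5 * T2 5 - (15 - 5 * u) * T2 4 + (25 - 15 * u) * T2 3 - (25 - 25 * u + 5 * u ^ 2) * T2 2 + u ^ 3 * T2 1"
    by (rule T_rec; simp)+
  note s = solve_rec[OF refl refl refl refl refl rec]
  have "((1 - u) * u * (u - 5) ^ 2) * ((5 - u) ^ 2 * T2 0) = (5 - u) ^ 2 * (((1 - u) * u * (u - 5) ^ 2) * T2 0)"
    by (simp only: mult_ac)
  also have "\<dots> = ((1 - u) * u * (u - 5) ^ 2) * (psi ^ 4 * (u ^ 2 - 50 * u + 145))"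
    unfolding s(1) using rel by (rule solve_comb_1)
  finally show 0: "(5 - u) ^ 2 * T2 0 = psi ^ 4 * (u ^ 2 - 50 * u + 145)"
    by (rule mult_left_cancel[THEN iffD1, rotated]) (use u_nonzero u_not_1 in simp)
  have "(u * (u - 5) ^ 2) * ((5 - u) ^ 2 * T2 1) = (5 - u) ^ 2 * ((u * (u - 5) ^ 2) * T2 1)"
    by (simp only: mult_ac)
  also have "\<dots> = (u * (u - 5) ^ 2) * (psi ^ 4 * (- 7 * u ^ 2 - 50 * u + 25))"
    unfolding s(2) using rel 0 by (rule solve_comb_2)
  finally show 1: "(5 - u) ^ 2 * T2 1 = psi ^ 4 * (- 7 * u ^ 2 - 50 * u + 25)"
    by (rule mult_left_cancel[THEN iffD1, rotated]) (use u_nonzero in simp)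
  show "(5 - u) ^ 2 * T2 2 = psi ^ 4 * (- 6 * u ^ 3 + 35 * u ^ 2 - 100 * u - 25)" using rel 0 by algebra
  show "(5 - u) ^ 2 * T2 3 = psi ^ 4 * (- 26 * u ^ 3 + 55 * u ^ 2 - 125)" using rel 1 by algebra
  show "(5 - u) ^ 2 * T2 4 = psi ^ 4 * (- 2 * u ^ 4 + 20 * u ^ 3 - 175 * u ^ 2 + 250 * u - 125)" using rel 0 by algebra
qed

subsection \<open>Divisibility of power series by powers of five\<close>

text \<open>Coefficients in 5^k Z, phrased by division because the series are complex;
  \<open>divis 0\<close> is integrality.\<close>

definition divis :: "nat \<Rightarrow> complex fps \<Rightarrow> bool" where
  "divis k f \<longleftrightarrow> (\<forall>n. f $ n / 5 ^ k \<in> \<int>)"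

lemma divis_add: "divis k f \<Longrightarrow> divis k g \<Longrightarrow> divis k (f + g)"
  and divis_diff: "divis k f \<Longrightarrow> divis k g \<Longrightarrow> divis k (f - g)"
  and divis_uminus: "divis k f \<Longrightarrow> divis k (- f)"
  and divis_zero: "divis k 0"
  and divis_us: "divis k f \<Longrightarrow> divis k (us r f)"
  by (auto simp: divis_def add_divide_distrib diff_divide_distrib)

lemma divis_mult:
  assumes "divis k f" "divis m g"
  shows "divis (k + m) (f * g)"
  unfolding divis_def
proof
  fix n
  have "(f * g) $ n / 5 ^ (k + m) = (\<Sum>i=0..n. (f $ i / 5 ^ k) * (g $ (n - i) / 5 ^ m))"
    by (simp add: fps_mult_nth sum_divide_distrib power_add)
  also have "\<dots> \<in> \<int>"
    using assms by (intro Ints_sum Ints_mult) (auto simp: divis_def)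
  finally show "(f * g) $ n / 5 ^ (k + m) \<in> \<int>" .
qed

lemma divis_mult_left: "divis 0 f \<Longrightarrow> divis k g \<Longrightarrow> divis k (f * g)"
  and divis_mult_right: "divis k f \<Longrightarrow> divis 0 g \<Longrightarrow> divis k (f * g)"
  using divis_mult[of 0 f k g] divis_mult[of k f 0 g] by simp_all

lemma divis_of_int: "5 ^ k dvd c \<Longrightarrow> divis k (of_int c)"
proof -
  assume "5 ^ k dvd c"
  then obtain d where "c = 5 ^ k * d" by (elim dvdE)
  thus ?thesis by (auto simp: divis_def fps_of_int[symmetric] simp del: fps_of_int)
qed

lemma divis_numeral [simp]: "divis 0 (numeral k)" and divis_one [simp]: "divis 0 1"
  using divis_of_int[of 0 "numeral k"] divis_of_int[of 0 1] by simp_all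

lemma divis_power: "divis 0 f \<Longrightarrow> divis 0 (f ^ k)"
  by (induction k) (auto intro: divis_mult_left)

lemma divis_X [simp]: "divis 0 X"
  by (auto simp: divis_def)

lemma divis_mono:
  assumes "divis k f" "m \<le> k"
  shows "divis m f"
  unfolding divis_def
proof
  fix n
  have "f $ n / 5 ^ m = 5 ^ (k - m) * (f $ n / 5 ^ k)"
    using assms(2) by (simp add: power_diff)
  also have "\<dots> \<in> \<int>" using assms(1) by (intro Ints_mult) (auto simp: divis_def)
  finally show "f $ n / 5 ^ m \<in> \<int>" .
qed

lemma divis_compose: "m > 0 \<Longrightarrow> divis k f \<Longrightarrow> divis k (f oo X ^ m)"
  by (simp add: divis_def nth_compose_X_power)

lemma divis_gf: "(\<And>j. w j \<in> \<int>) \<Longrightarrow> divis 0 (gf e w A)"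
  by (auto simp: divis_def gf_def intro!: Ints_sum)

lemma divis_inverse:
  assumes f: "divis 0 f" "f $ 0 = 1"
  shows "divis 0 (inverse f)"
proof -
  have "inverse f $ n \<in> \<int>" for n
  proof (induction n rule: less_induct)
    case (less n)
    show ?case
    proof (cases "n = 0")
      case True
      thus ?thesis using f(2) by simp
    next
      case False
      have "f * inverse f = 1" by (rule inverse_mult_eq_1') (simp add: f)
      hence "0 = (f * inverse f) $ n" using False by simp
      also have "\<dots> = inverse f $ n + (\<Sum>i=Suc 0..n. f $ i * inverse f $ (n - i))"
        using f(2) by (simp add: fps_mult_nth sum.atLeast_Suc_atMost)
      finally have "inverse f $ n = - (\<Sum>i=Suc 0..n. f $ i * inverse f $ (n - i))"
        by (simp add: eq_neg_iff_add_eq_0)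
      also have "\<dots> \<in> \<int>"
        using f(1) less.IH by (intro Ints_minus Ints_sum Ints_mult) (auto simp: divis_def)
      finally show ?thesis .
    qed
  qed
  thus ?thesis by (simp add: divis_def)
qed

lemma divis_X_mult_cancel:
  assumes "divis k (X * f)"
  shows "divis k f"
  unfolding divis_def
proof
  fix n
  show "f $ n / 5 ^ k \<in> \<int>" using assms[unfolded divis_def, rule_format, of "Suc n"] by simp
qed

text \<open>The series g need not be invertible over the integers: its constant term is only prime
  to 5. The coefficients of h are treated in order, and their integrality allows that constant to be
  cancelled.\<close>

lemma divis_cancel:
  assumes g: "divis 0 g" "g $ 0 = of_int a" "coprime a 5" and h: "divis 0 h" and gh: "divis k (g * h)"
  shows "divis k h"
proof -
  have "h $ n / 5 ^ k \<in> \<int>" for n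
  proof (induction n rule: less_induct)
    case (less n)
    have "(g * h) $ n = of_int a * h $ n + (\<Sum>i=Suc 0..n. g $ i * h $ (n - i))"
      using g(2) by (simp add: fps_mult_nth sum.atLeast_Suc_atMost)
    hence "of_int a * (h $ n / 5 ^ k) = (g * h) $ n / 5 ^ k - (\<Sum>i=Suc 0..n. g $ i * (h $ (n - i) / 5 ^ k))"
      by (simp add: diff_divide_distrib add_divide_distrib flip: sum_divide_distrib)
    also have "\<dots> \<in> \<int>"
      using gh g(1) less.IH by (intro Ints_diff Ints_sum Ints_mult) (auto simp: divis_def)
    finally obtain b where b: "of_int a * (h $ n / 5 ^ k) = of_int b" by (elim Ints_cases)
    obtain c where c: "h $ n = of_int c" using h by (auto simp: divis_def elim: Ints_cases)
    have "(of_int (a * c) :: complex) = of_int (b * 5 ^ k)" using b c by (simp add: field_simps)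
    hence "a * c = b * 5 ^ k" by (simp only: of_int_eq_iff)
    hence "5 ^ k dvd a * c" by simp
    moreover have "coprime (5 ^ k) a" using g(3) by (simp add: coprime_commute)
    ultimately have "5 ^ k dvd c" by (simp add: coprime_dvd_mult_right_iff)
    thus ?case by (auto simp: c elim!: dvdE)
  qed
  thus ?thesis by (simp add: divis_def)
qed

lemma divis_theta: "divis 0 phim" "divis 0 psi" "divis 0 ht1" "divis 0 ht2"
  unfolding phim_def psi_def ht1_def ht2_def by (intro divis_gf; simp add: par_def)+

lemma divis_P5: "divis 0 P5" "divis 0 A25"
  unfolding P5_def A25_def by (intro divis_compose divis_theta; simp)+

lemma divis_inverses: "divis 0 (inverse phim)" "divis 0 (inverse P5)" "divis 0 (inverse A25)"
  by (intro divis_inverse divis_theta divis_P5; simp)+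

lemma divis_R: "divis 0 R" and divis_u: "divis 0 u" and divis_x: "divis 0 x"
  unfolding R_def u_def x_def
  by (intro divis_mult_left divis_power divis_theta divis_P5 divis_inverses)+

subsection \<open>Polynomials in \<open>x\<close> modulo \<open>5\<^sup>6\<close>\<close>

text \<open>As \<open>u = 1 / x\<close>, this is \<open>x^((i - 3) / 2)\<close> for odd \<open>i\<close> and \<open>R x^(i / 2 - 2)\<close> for even \<open>i\<close>. The terms with negative
  powers of \<open>x\<close> only serve to start the recurrences below.\<close>

definition w :: "nat \<Rightarrow> complex fps" where
  "w i = (if odd i then u * x ^ (i div 2) else R * u ^ 2 * x ^ (i div 2))"

lemma w_add_2: "w (i + 2) = x * w i"
  by (simp add: w_def)

lemma w_values: "w 0 = R * u ^ 2" "w 1 = u" "w 2 = R * u" "w 3 = 1" "w 4 = R" "w 5 = x" "w 6 = R * x"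
proof -
  show "w 0 = R * u ^ 2" "w 1 = u" by (simp_all add: w_def)
  have "w 2 = R * u ^ 2 * x" "w 3 = u * x" "w 4 = R * u ^ 2 * x ^ 2" "w 5 = u * x ^ 2" "w 6 = R * u ^ 2 * x ^ 3"
    by (simp_all add: w_def)
  thus "w 2 = R * u" "w 3 = 1" "w 4 = R" "w 5 = x" "w 6 = R * x"
    using u_x by algebra+
qed

lemma w_shift: "w (2 * j + m) = x ^ j * w m"
proof (induction j)
  case (Suc j)
  have "2 * Suc j + m = (2 * j + m) + 2" by simp
  thus ?case using Suc by (simp only: w_add_2) simp
qed simp

lemma u_S: "u = S ^ 2 * y" "x = R ^ 2 * v"
  using S_square v_y u_x S_R by algebra+

text \<open>The quintic for S times y^2 R^2, solved for its constant term, which becomes v^3 y^2 R^2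
  = x.\<close>

lemma w_base_even:
  "w 5 = w 0 - 5 * (y * w 1) + (15 * (y * w 2) - 5 * w 2) + (15 * (y * w 3) - 25 * (y ^ 2 * w 3))
     + (25 * (y ^ 2 * w 4) - 25 * (y * w 4) + 5 * w 4)"
proof -
  have "v ^ 3 * R ^ 5 = 1 - 5 * R + (15 - 5 * v) * R ^ 2 - (25 - 15 * v) * R ^ 3 + (25 - 25 * v + 5 * v ^ 2) * R ^ 4"
    using S_equation S_R by algebra
  thus ?thesis unfolding w_values using u_S S_R v_y by algebra
qed

text \<open>The preceding relation times R; products of two R are rewritten by R^2 = x y.\<close>

lemma w_base_odd:
  "w 6 = y * w 1 - 5 * (y * w 2) + (15 * (y ^ 2 * w 3) - 5 * (y * w 3)) + (15 * (y * w 4) - 25 * (y ^ 2 * w 4))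
     + (25 * (y ^ 3 * w 5) - 25 * (y ^ 2 * w 5) + 5 * (y * w 5))"
proof -
  have a: "R * (R * u ^ 2) = y * u" "R * (R * u) = y" "R * R = x * y"
    using u_S S_R v_y by algebra+
  have "R * w 5 = R * (R * u ^ 2) - 5 * (y * (R * u)) + (15 * (y * (R * (R * u))) - 5 * (R * (R * u)))
     + (15 * (y * R) - 25 * (y ^ 2 * R)) + (25 * (y ^ 2 * (R * R)) - 25 * (y * (R * R)) + 5 * (R * R))"
    unfolding w_base_even unfolding w_values by (simp add: algebra_simps)
  thus ?thesis unfolding a unfolding w_values by (simp add: algebra_simps power3_eq_cube power2_eq_square)
qed

definition om :: "nat \<Rightarrow> complex fps" where "om i = us 2 (psi ^ 4 * w i)"

lemma us2_y: "us 2 (y * f) = x * us 2 f" "us 2 (y ^ k * f) = x ^ k * us 2 f"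
  by (rule us_y_mult, simp)+

text \<open>The base relation is multiplied by psi^4 x^j. Its coefficients are polynomials in y, a
  series in q^5, and come out of the extraction with y replaced by x.\<close>

lemma om_rec_even:
  assumes "even i"
  shows "om (i + 5) = om i - 5 * (x * om (i + 1)) + (15 * (x * om (i + 2)) - 5 * om (i + 2))
     + (15 * (x * om (i + 3)) - 25 * (x ^ 2 * om (i + 3)))
     + (25 * (x ^ 2 * om (i + 4)) - 25 * (x * om (i + 4)) + 5 * om (i + 4))"
proof -
  from assms obtain j where i: "i = 2 * j" by auto
  let ?f = "\<lambda>m. psi ^ 4 * (x ^ j * w m)"
  have ww: "w (i + m) = x ^ j * w m" for m unfolding i by (rule w_shift)
  have w0: "w i = x ^ j * w 0" using ww[of 0] by simp
  have "?f 5 = ?f 0 - 5 * (y * ?f 1) + (15 * (y * ?f 2) - 5 * ?f 2) + (15 * (y * ?f 3) - 25 * (y ^ 2 * ?f 3))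
     + (25 * (y ^ 2 * ?f 4) - 25 * (y * ?f 4) + 5 * ?f 4)"
    unfolding w_base_even by (simp add: algebra_simps)
  hence "us 2 (?f 5) = us 2 (?f 0 - 5 * (y * ?f 1) + (15 * (y * ?f 2) - 5 * ?f 2)
     + (15 * (y * ?f 3) - 25 * (y ^ 2 * ?f 3))
     + (25 * (y ^ 2 * ?f 4) - 25 * (y * ?f 4) + 5 * ?f 4))" by (rule arg_cong)
  thus ?thesis unfolding om_def ww w0 us_add us_diff us_numeral us2_y .
qed

lemma om_rec_odd:
  assumes "odd i"
  shows "om (i + 5) = x * om i - 5 * (x * om (i + 1)) + (15 * (x ^ 2 * om (i + 2)) - 5 * (x * om (i + 2)))
     + (15 * (x * om (i + 3)) - 25 * (x ^ 2 * om (i + 3)))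
     + (25 * (x ^ 3 * om (i + 4)) - 25 * (x ^ 2 * om (i + 4)) + 5 * (x * om (i + 4)))"
proof -
  from assms obtain j where i: "i = 2 * j + 1" by (elim oddE)
  let ?f = "\<lambda>m. psi ^ 4 * (x ^ j * w m)"
  have ww: "w (i + m) = x ^ j * w (m + 1)" for m
  proof -
    have "i + m = 2 * j + (m + 1)" using i by simp
    thus ?thesis by (simp only: w_shift)
  qed
  have w0: "w i = x ^ j * w 1" using ww[of 0] by simp
  have ws: "w (i + 1) = x ^ j * w 2" "w (i + 2) = x ^ j * w 3" "w (i + 3) = x ^ j * w 4"
    "w (i + 4) = x ^ j * w 5" "w (i + 5) = x ^ j * w 6"
    unfolding ww by (simp_all del: add_2_eq_Suc add_2_eq_Suc' One_nat_def)
  have "?f 6 = y * ?f 1 - 5 * (y * ?f 2) + (15 * (y ^ 2 * ?f 3) - 5 * (y * ?f 3)) + (15 * (y * ?f 4) - 25 * (y ^ 2 * ?f 4))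
     + (25 * (y ^ 3 * ?f 5) - 25 * (y ^ 2 * ?f 5) + 5 * (y * ?f 5))"
    unfolding w_base_odd by (simp add: algebra_simps)
  hence "us 2 (?f 6) = us 2 (y * ?f 1 - 5 * (y * ?f 2) + (15 * (y ^ 2 * ?f 3) - 5 * (y * ?f 3))
     + (15 * (y * ?f 4) - 25 * (y ^ 2 * ?f 4))
     + (25 * (y ^ 3 * ?f 5) - 25 * (y ^ 2 * ?f 5) + 5 * (y * ?f 5)))" by (rule arg_cong)
  thus ?thesis unfolding om_def ws w0 us_add us_diff us_numeral us2_y .
qed

section \<open>Polynomials in x as coefficient lists, lowest degree first\<close>

primrec ev :: "int list \<Rightarrow> complex fps" where
  "ev [] = 0"
| "ev (c # cs) = of_int c + x * ev cs"

fun ladd :: "int list \<Rightarrow> int list \<Rightarrow> int list" where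
  "ladd [] b = b"
| "ladd (a # as) [] = a # as"
| "ladd (a # as) (b # bs) = (a + b) # ladd as bs"

definition lsc :: "int \<Rightarrow> int list \<Rightarrow> int list" where "lsc c = map (\<lambda>a. c * a)"

primrec lmul :: "int list \<Rightarrow> int list \<Rightarrow> int list" where
  "lmul [] b = []"
| "lmul (a # as) b = ladd (lsc a b) (0 # lmul as b)"

text \<open>Trailing zeros are removed, so that results of computations can be compared as lists and
  have a sharp length.\<close>

primrec strip :: "int list \<Rightarrow> int list" where
  "strip [] = []"
| "strip (a # as) = (if a = 0 \<and> strip as = [] then [] else a # strip as)"

definition red :: "int list \<Rightarrow> int list" where "red l = strip (map (\<lambda>c. c mod 15625) l)"

lemma ev_ladd: "ev (ladd a b) = ev a + ev b"
  by (induction a b rule: ladd.induct) (simp_all add: algebra_simps)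

lemma ev_lsc: "ev (lsc c a) = of_int c * ev a"
  by (induction a) (simp_all add: lsc_def algebra_simps)

lemma ev_lmul: "ev (lmul a b) = ev a * ev b"
  by (induction a) (simp_all add: ev_ladd ev_lsc algebra_simps)

lemma ev_strip: "ev (strip a) = ev a"
  by (induction a) auto

lemma divis_ev:
  assumes "\<forall>c\<in>set l. 5 ^ k dvd c"
  shows "divis k (ev l)"
  using assms by (induction l) (auto intro!: divis_add divis_mult_left divis_of_int divis_x divis_zero)

lemma divis_ev_0: "divis 0 (ev l)"
  by (rule divis_ev) simp

lemma ev_red: "divis 6 (ev l - ev (red l))"
proof -
  have "divis 6 (ev l - ev (map (\<lambda>c. c mod 15625) l))"
  proof (induction l)
    case (Cons c l)
    have "divis 6 (of_int (c - c mod 15625) + x * (ev l - ev (map (\<lambda>c. c mod 15625) l)))"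
      by (intro divis_add divis_mult_left divis_x Cons divis_of_int) (simp add: dvd_minus_mod)
    thus ?case by (simp add: algebra_simps)
  qed (simp add: divis_zero)
  thus ?thesis by (simp add: red_def ev_strip)
qed

definition rep :: "complex fps \<Rightarrow> int list \<Rightarrow> bool" where
  "rep f l \<longleftrightarrow> divis 6 (f - psi ^ 4 * ev l)"

lemma divis_psi4: "divis 0 (psi ^ 4)"
  by (intro divis_power divis_theta)

lemma rep_red:
  assumes "rep f l"
  shows "rep f (red l)"
proof -
  have "divis 6 ((f - psi ^ 4 * ev l) + psi ^ 4 * (ev l - ev (red l)))"
    using assms by (intro divis_add divis_mult_left divis_psi4 ev_red) (simp_all add: rep_def)
  thus ?thesis by (simp add: rep_def algebra_simps)
qed

lemma rep_add:
  assumes "rep f a" "rep g b"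
  shows "rep (f + g) (ladd a b)"
  using divis_add[OF assms[unfolded rep_def]] by (simp add: rep_def ev_ladd algebra_simps)

lemma rep_mult:
  assumes "rep f b"
  shows "rep (ev a * f) (lmul a b)"
  using divis_mult_left[OF divis_ev_0[of a] assms[unfolded rep_def]]
  by (simp add: rep_def ev_lmul algebra_simps)

definition nxt :: "int list list \<Rightarrow> int list \<Rightarrow> int list \<Rightarrow> int list \<Rightarrow> int list \<Rightarrow> int list \<Rightarrow> int list" where
  "nxt cs a b c d e = red (ladd (lmul (cs ! 0) a) (ladd (lmul (cs ! 1) b)
     (ladd (lmul (cs ! 2) c) (ladd (lmul (cs ! 3) d) (lmul (cs ! 4) e)))))"

text \<open>Entry j is the coefficient polynomial of \<open>om (i + j)\<close> in
  \<open>om_rec_odd\<close> (argument True) or \<open>om_rec_even\<close>.\<close>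

definition cf :: "bool \<Rightarrow> int list list" where
  "cf p = (if p then [[0, 1], [0, -5], [0, -5, 15], [0, 15, -25], [0, 5, -25, 25]]
     else [[1], [0, -5], [-5, 15], [0, 15, -25], [5, -25, 25]])"

lemma rep_nxt:
  assumes "rep (om i) a" "rep (om (i + 1)) b" "rep (om (i + 2)) c" "rep (om (i + 3)) d" "rep (om (i + 4)) e"
  shows "rep (om (i + 5)) (nxt (cf (odd i)) a b c d e)"
proof -
  let ?c = "\<lambda>j. ev (cf (odd i) ! j)"
  have "rep (?c 0 * om i + (?c 1 * om (i + 1) + (?c 2 * om (i + 2) + (?c 3 * om (i + 3) + ?c 4 * om (i + 4)))))
     (nxt (cf (odd i)) a b c d e)"
    unfolding nxt_def by (intro rep_red rep_add rep_mult assms)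
  moreover have "om (i + 5) = ?c 0 * om i + (?c 1 * om (i + 1) + (?c 2 * om (i + 2) + (?c 3 * om (i + 3) + ?c 4 * om (i + 4))))"
  proof (cases "even i")
    case True
    thus ?thesis unfolding om_rec_even[OF True]
      by (simp add: cf_def numeral_2_eq_2 numeral_3_eq_3 numeral_eq_Suc algebra_simps power2_eq_square power3_eq_cube)
  next
    case False
    thus ?thesis unfolding om_rec_odd[OF False]
      by (simp add: cf_def numeral_2_eq_2 numeral_3_eq_3 numeral_eq_Suc algebra_simps power2_eq_square power3_eq_cube)
  qed
  ultimately show ?thesis by simp
qed

text \<open>The list \<open>[1, 10, 75, \<dots>]\<close> is \<open>1 / (1 - 5 x)\<^sup>2\<close> modulo \<open>5\<^sup>6\<close>.\<close>

lemma rep_init: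
  assumes "divis 0 f" "(1 - 5 * x) ^ 2 * f = psi ^ 4 * ev l"
  shows "rep f (red (lmul l [1, 10, 75, 500, 3125, 18750]))"
proof -
  \<comment> \<open>Multiplying the truncated inverse back leaves only 109375 = 7 * 5^6 and 468750 =
    6 * 5^7 besides 1.\<close>
  have "ev [1, 10, 75, 500, 3125, 18750] * (1 - 5 * x) ^ 2 = 1 - of_int 109375 * x ^ 6 + of_int 468750 * x ^ 7"
    by simp algebra
  hence "f - psi ^ 4 * (ev l * ev [1, 10, 75, 500, 3125, 18750]) =
      of_int 109375 * (x ^ 6 * f) - of_int 468750 * (x ^ 7 * f)"
    using assms(2) by algebra
  moreover have "divis 6 \<dots>"
    by (intro divis_diff divis_mult_right divis_of_int divis_mult_left divis_power divis_x assms) simp_all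
  ultimately have "rep f (lmul l [1, 10, 75, 500, 3125, 18750])"
    by (simp only: rep_def ev_lmul)
  thus ?thesis by (rule rep_red)
qed

lemma divis_w: "divis 0 (w i)"
  unfolding w_def using divis_u divis_R divis_x by (auto intro!: divis_mult_left divis_power)

lemma divis_om: "divis 0 (om i)"
  unfolding om_def by (intro divis_us divis_mult_left divis_psi4 divis_w)

text \<open>The first four \<open>w i\<close> are powers of S up to factors in y. For
  \<open>w 4\<close> = R = 1 / S the quintic is used to express v^3 / S by nonnegative powers of
  S.\<close>

lemma om_T2:
  "om 0 = x ^ 2 * T2 3" "om 1 = x * T2 2" "om 2 = x * T2 1" "om 3 = T2 0"
  "u ^ 3 * om 4 = T2 4 - 5 * T2 3 + (15 * T2 2 - 5 * (u * T2 2)) - (25 * T2 1 - 15 * (u * T2 1))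
     + (25 * T2 0 - 25 * (u * T2 0) + 5 * (u ^ 2 * T2 0))"
proof -
  have "w 0 = y ^ 2 * S ^ 3" "w 1 = y * S ^ 2" "w 2 = y * S ^ 1"
    unfolding w_values using u_S S_R by algebra+
  moreover have "w 3 = S ^ 0" unfolding w_values by simp
  ultimately have "psi ^ 4 * w 0 = y ^ 2 * (psi ^ 4 * S ^ 3)" "psi ^ 4 * w 1 = y * (psi ^ 4 * S ^ 2)"
    "psi ^ 4 * w 2 = y * (psi ^ 4 * S ^ 1)" "psi ^ 4 * w 3 = psi ^ 4 * S ^ 0"
    by (simp_all only: mult_ac)
  thus "om 0 = x ^ 2 * T2 3" "om 1 = x * T2 2" "om 2 = x * T2 1" "om 3 = T2 0"
    by (simp_all only: om_def T2_def us2_y)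
  have "v ^ 3 * R = S ^ 4 - 5 * S ^ 3 + (15 - 5 * v) * S ^ 2 - (25 - 15 * v) * S ^ 1 + (25 - 25 * v + 5 * v ^ 2) * S ^ 0"
    using S_equation S_R by algebra
  hence "psi ^ 4 * (v ^ 3 * R) = psi ^ 4 * (S ^ 4 - 5 * S ^ 3 + (15 - 5 * v) * S ^ 2 - (25 - 15 * v) * S ^ 1
      + (25 - 25 * v + 5 * v ^ 2) * S ^ 0)" by (rule arg_cong)
  hence "v ^ 3 * (psi ^ 4 * R) = psi ^ 4 * S ^ 4 - 5 * (psi ^ 4 * S ^ 3)
     + (15 * (psi ^ 4 * S ^ 2) - 5 * (v * (psi ^ 4 * S ^ 2)))
     - (25 * (psi ^ 4 * S ^ 1) - 15 * (v * (psi ^ 4 * S ^ 1)))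
     + (25 * (psi ^ 4 * S ^ 0) - 25 * (v * (psi ^ 4 * S ^ 0)) + 5 * (v ^ 2 * (psi ^ 4 * S ^ 0)))" (is "_ = ?E") by algebra
  hence "us 2 (v ^ 3 * (psi ^ 4 * R)) = us 2 ?E" by (rule arg_cong)
  moreover have "us 2 (v * f) = u * us 2 f" "us 2 (v ^ k * f) = u ^ k * us 2 f" for f k
    by (rule us_v_mult, simp)+
  ultimately show "u ^ 3 * om 4 = T2 4 - 5 * T2 3 + (15 * T2 2 - 5 * (u * T2 2)) - (25 * T2 1 - 15 * (u * T2 1))
     + (25 * T2 0 - 25 * (u * T2 0) + 5 * (u ^ 2 * T2 0))"
    unfolding om_def T2_def w_values by (simp only: us_add us_diff us_numeral)
qed

lemma om_init:
  "(1 - 5 * x) ^ 2 * om 0 = psi ^ 4 * ev [0, -26, 55, 0, -125]"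
  "(1 - 5 * x) ^ 2 * om 1 = psi ^ 4 * ev [-6, 35, -100, -25]"
  "(1 - 5 * x) ^ 2 * om 2 = psi ^ 4 * ev [0, -7, -50, 25]"
  "(1 - 5 * x) ^ 2 * om 3 = psi ^ 4 * ev [1, -50, 145]"
  "(1 - 5 * x) ^ 2 * om 4 = psi ^ 4 * ev [0, 33, -495, 2000, -4375, 3125]"
proof -
  have X: "(1 - 5 * x) ^ 2 = x ^ 2 * (5 - u) ^ 2" using u_x by algebra
  have s: "(1 - 5 * x) ^ 2 * (z * t) = x ^ 2 * (z * ((5 - u) ^ 2 * t))" for z t
    unfolding X by (simp only: mult_ac)
  show "(1 - 5 * x) ^ 2 * om 0 = psi ^ 4 * ev [0, -26, 55, 0, -125]"
    unfolding om_T2 s T2_values using u_x by simp algebra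
  show "(1 - 5 * x) ^ 2 * om 1 = psi ^ 4 * ev [-6, 35, -100, -25]"
    unfolding om_T2 s T2_values using u_x by simp algebra
  show "(1 - 5 * x) ^ 2 * om 2 = psi ^ 4 * ev [0, -7, -50, 25]"
    unfolding om_T2 s T2_values using u_x by simp algebra
  show "(1 - 5 * x) ^ 2 * om 3 = psi ^ 4 * ev [1, -50, 145]"
    unfolding om_T2 X mult.assoc T2_values using u_x by simp algebra
  have "(5 - u) ^ 2 * (u ^ 3 * om 4) = (5 - u) ^ 2 * T2 4 - 5 * ((5 - u) ^ 2 * T2 3)
      + (15 * ((5 - u) ^ 2 * T2 2) - 5 * (u * ((5 - u) ^ 2 * T2 2)))
      - (25 * ((5 - u) ^ 2 * T2 1) - 15 * (u * ((5 - u) ^ 2 * T2 1)))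
      + (25 * ((5 - u) ^ 2 * T2 0) - 25 * (u * ((5 - u) ^ 2 * T2 0)) + 5 * (u ^ 2 * ((5 - u) ^ 2 * T2 0)))"
    unfolding om_T2 by (simp add: algebra_simps)
  also have "\<dots> = psi ^ 4 * (33 * u ^ 4 - 495 * u ^ 3 + 2000 * u ^ 2 - 4375 * u + 3125)"
    unfolding T2_values by (simp add: algebra_simps power2_eq_square power3_eq_cube power4_eq_xxxx)
  finally have e: "(5 - u) ^ 2 * (u ^ 3 * om 4) = psi ^ 4 * (33 * u ^ 4 - 495 * u ^ 3 + 2000 * u ^ 2 - 4375 * u + 3125)" .
  have "(1 - 5 * x) ^ 2 * om 4 = x ^ 5 * ((5 - u) ^ 2 * (u ^ 3 * om 4))"
    unfolding X using u_x by algebra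
  thus "(1 - 5 * x) ^ 2 * om 4 = psi ^ 4 * ev [0, 33, -495, 2000, -4375, 3125]"
    unfolding e using u_x by simp algebra
qed

text \<open>Row i is the polynomial for \<open>om i\<close> modulo 5^6. A polynomial with 7
  coefficients started at \<open>w 4\<close> reaches index 4 + 2 * 6 = 16, hence 17 rows.\<close>

definition TAB :: "int list list" where
  "TAB = [[0, 15599, 15420, 14225, 6625, 7500, 3125],
    [15619, 15600, 15425, 14225, 6625, 7500, 3125],
    [0, 15618, 15505, 14625, 8625, 1875, 6250],
    [1, 15585, 15345, 13825, 4625, 13125],
    [0, 33, 15460, 15150, 10625, 11875, 9375],
    [0, 219, 13765, 2175, 12000, 6250, 12500],
    [0, 15614, 1815, 14375, 5750, 12500, 12500],
    [0, 15393, 14035, 8775, 1250, 13750, 9375],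
    [0, 1, 13000, 7230, 6750, 7500, 12500],
    [0, 93, 4120, 1050, 4750, 12000, 9375],
    [0, 0, 1914, 3660, 3725, 4625, 8125, 6250, 3125],
    [0, 15609, 11455, 7975, 2425, 11500, 10625, 3125],
    [0, 0, 14843, 590, 8075, 7375, 3750, 6250, 6250],
    [0, 1, 14440, 4265, 2100, 125, 4375, 6250],
    [0, 0, 178, 13105, 6575, 11750, 9375, 0, 6250],
    [0, 0, 6809, 6230, 1250, 4875, 3125, 6250, 3125],
    [0, 0, 15604, 11145, 3350, 10375, 10000, 9375, 3125]]"

definition tab_ok :: bool where
  "tab_ok \<longleftrightarrow> TAB ! 0 = red (lmul [0, -26, 55, 0, -125] [1, 10, 75, 500, 3125, 18750]) \<and>
     TAB ! 1 = red (lmul [-6, 35, -100, -25] [1, 10, 75, 500, 3125, 18750]) \<and>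
     TAB ! 2 = red (lmul [0, -7, -50, 25] [1, 10, 75, 500, 3125, 18750]) \<and>
     TAB ! 3 = red (lmul [1, -50, 145] [1, 10, 75, 500, 3125, 18750]) \<and>
     TAB ! 4 = red (lmul [0, 33, -495, 2000, -4375, 3125] [1, 10, 75, 500, 3125, 18750]) \<and>
     (\<forall>i\<in>set [0..<12]. TAB ! (i + 5) = nxt (cf (odd i)) (TAB ! i) (TAB ! (i + 1)) (TAB ! (i + 2)) (TAB ! (i + 3)) (TAB ! (i + 4)))"

lemma tab_ok: tab_ok
  unfolding tab_ok_def by code_simp

lemma rep_TAB: "i < 17 \<Longrightarrow> rep (om i) (TAB ! i)"
proof (induction i rule: less_induct)
  case (less i)
  note t = tab_ok[unfolded tab_ok_def]
  have base: "rep (om 0) (TAB ! 0)" "rep (om 1) (TAB ! 1)" "rep (om 2) (TAB ! 2)" "rep (om 3) (TAB ! 3)" "rep (om 4) (TAB ! 4)"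
    using t by (simp_all only: rep_init[OF divis_om om_init(1)] rep_init[OF divis_om om_init(2)]
        rep_init[OF divis_om om_init(3)] rep_init[OF divis_om om_init(4)] rep_init[OF divis_om om_init(5)])
  show ?case
  proof (cases "i < 5")
    case True
    hence "i = 0 \<or> i = 1 \<or> i = 2 \<or> i = 3 \<or> i = 4" by arith
    thus ?thesis using base by blast
  next
    case False
    define j where "j = i - 5"
    have i: "i = j + 5" and j: "j < 12" using False less.prems by (simp_all add: j_def)
    have "TAB ! (j + 5) = nxt (cf (odd j)) (TAB ! j) (TAB ! (j + 1)) (TAB ! (j + 2)) (TAB ! (j + 3)) (TAB ! (j + 4))"
      using t j by simp
    moreover have "rep (om (j + 5)) \<dots>"
      by (intro rep_nxt less.IH) (use i j in simp_all)
    ultimately show ?thesis unfolding i by simp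
  qed
qed

text \<open>Multiplication by x raises the index of \<open>w\<close> by 2, so the polynomial uses
  every second row of the table.\<close>

fun comb :: "int list \<Rightarrow> int list list \<Rightarrow> int list" where
  "comb [] ts = []"
| "comb (c # cs) ts = ladd (lsc c (hd ts)) (comb cs (drop 2 ts))"

lemma rep_comb:
  assumes "2 * length r + m \<le> 18"
  shows "rep (us 2 (psi ^ 4 * (w m * ev r))) (comb r (drop m TAB))"
  using assms
proof (induction r arbitrary: m)
  case Nil
  have "us 2 0 = 0" by (simp add: fps_eq_iff)
  thus ?case by (simp add: rep_def divis_zero)
next
  case (Cons c r)
  have m: "m < 17" using Cons.prems by simp
  have "length TAB = 17" by (simp add: TAB_def)
  hence hd: "hd (drop m TAB) = TAB ! m" using m by (simp add: hd_drop_conv_nth)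
  have "psi ^ 4 * (w m * ev (c # r)) = fps_const (of_int c) * (psi ^ 4 * w m) + psi ^ 4 * (w (m + 2) * ev r)"
    unfolding w_add_2 ev.simps by (simp add: fps_of_int algebra_simps)
  hence "us 2 (psi ^ 4 * (w m * ev (c # r))) = fps_const (of_int c) * om m + us 2 (psi ^ 4 * (w (m + 2) * ev r))"
    by (simp only: us_add us_const om_def)
  also have "fps_const (of_int c) * om m = ev [c] * om m" by (simp add: fps_of_int)
  finally have e: "us 2 (psi ^ 4 * (w m * ev (c # r))) = ev [c] * om m + us 2 (psi ^ 4 * (w (m + 2) * ev r))" .
  have "rep (ev [c] * om m + us 2 (psi ^ 4 * (w (m + 2) * ev r))) (ladd (lmul [c] (TAB ! m)) (comb r (drop (m + 2) TAB)))"
    by (intro rep_add rep_mult rep_TAB m Cons.IH) (use Cons.prems in simp)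
  hence "divis 6 (us 2 (psi ^ 4 * (w m * ev (c # r))) - psi ^ 4 * (ev [c] * ev (TAB ! m) + ev (comb r (drop (m + 2) TAB))))"
    unfolding e rep_def ev_ladd ev_lmul .
  thus ?case by (simp add: rep_def ev_ladd ev_lsc hd drop_drop add.commute)
qed

subsection \<open>Iterating the extraction\<close>

definition godd :: "complex fps" where "godd = psi ^ 4 * inverse P5"

lemma oddspt_eq: "oddspt = psi ^ 4 * inverse phim"
  using oddspt_phim inverse_mult_unit(1) by algebra

lemma divis_oddspt: "divis 0 oddspt" and divis_godd: "divis 0 godd"
  unfolding oddspt_eq godd_def by (intro divis_mult_left divis_psi4 divis_inverses)+

text \<open>\<open>opA\<close> and \<open>opB\<close> are the extraction on polynomials. Over
  \<open>oddspt\<close> the factor 1 / phim = R / A25 starts the table at \<open>w 4\<close> = R;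
  over \<open>godd\<close> the denominator is already a series in q^5, and the start is
  \<open>w 3\<close> = 1.\<close>

definition opA :: "int list \<Rightarrow> int list" where "opA r = red (comb r (drop 4 TAB))"
definition opB :: "int list \<Rightarrow> int list" where "opB r = red (comb r (drop 3 TAB))"

lemma us_oddspt:
  assumes "length r \<le> 7" "divis 6 (f - oddspt * ev r)"
  shows "divis 6 (us 2 f - godd * ev (opA r))"
proof -
  have "inverse phim = R * inverse A25"
    using inverse_mult_unit unfolding R_def by algebra
  hence "oddspt * ev r = (inverse P5 oo X ^ 5) * (psi ^ 4 * (w 4 * ev r))"
    unfolding oddspt_eq inverse_A25[symmetric] w_values by (simp only: mult_ac)
  moreover have "us 2 ((inverse P5 oo X ^ 5) * (psi ^ 4 * (w 4 * ev r))) = inverse P5 * us 2 (psi ^ 4 * (w 4 * ev r))"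
    by (rule us_compose_mult) simp
  moreover have "rep (us 2 (psi ^ 4 * (w 4 * ev r))) (opA r)"
    unfolding opA_def using assms(1) by (intro rep_red rep_comb) simp
  ultimately have "divis 6 (us 2 (f - oddspt * ev r) + inverse P5 * (us 2 (psi ^ 4 * (w 4 * ev r)) - psi ^ 4 * ev (opA r)))"
    using assms(2) by (intro divis_add divis_us divis_mult_left divis_inverses) (simp_all add: rep_def)
  moreover have "us 2 (f - oddspt * ev r) + inverse P5 * (us 2 (psi ^ 4 * (w 4 * ev r)) - psi ^ 4 * ev (opA r))
      = us 2 f - godd * ev (opA r)"
    unfolding us_diff \<open>oddspt * ev r = _\<close> \<open>us 2 (_ * _) = inverse P5 * _\<close> godd_def by (simp add: algebra_simps)
  ultimately show ?thesis by simp
qed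

lemma us_godd:
  assumes "length r \<le> 7" "divis 6 (f - godd * ev r)"
  shows "divis 6 (us 2 f - oddspt * ev (opB r))"
proof -
  have "inverse P5 = inverse phim oo X ^ 5"
    unfolding P5_def by (rule fps_inverse_compose[symmetric]) simp_all
  hence 1: "godd * ev r = (inverse phim oo X ^ 5) * (psi ^ 4 * (w 3 * ev r))"
    unfolding godd_def w_values by (simp only: mult_ac mult_1_left)
  have 2: "us 2 ((inverse phim oo X ^ 5) * (psi ^ 4 * (w 3 * ev r))) = inverse phim * us 2 (psi ^ 4 * (w 3 * ev r))"
    by (rule us_compose_mult) simp
  have "rep (us 2 (psi ^ 4 * (w 3 * ev r))) (opB r)"
    unfolding opB_def using assms(1) by (intro rep_red rep_comb) simp
  hence "divis 6 (us 2 (f - godd * ev r) + inverse phim * (us 2 (psi ^ 4 * (w 3 * ev r)) - psi ^ 4 * ev (opB r)))"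
    using assms(2) by (intro divis_add divis_us divis_mult_left divis_inverses) (simp_all add: rep_def)
  moreover have "us 2 (f - godd * ev r) + inverse phim * (us 2 (psi ^ 4 * (w 3 * ev r)) - psi ^ 4 * ev (opB r))
      = us 2 f - oddspt * ev (opB r)"
    unfolding us_diff 1 2 oddspt_eq by (simp add: algebra_simps)
  ultimately show ?thesis by simp
qed

section \<open>The classes 10n + 3 and 10n + 7\<close>

definition resA :: "int list \<Rightarrow> int list" where
  "resA r = ladd (comb r (drop 3 TAB)) (lsc (-1) (comb r (drop 4 TAB)))"

text \<open>The lists are the coefficients of w 0 to w 4 in y^2 R (al^4 + be^4), with y replaced by
  x as in the extraction. For \<open>resA\<close> the corresponding expression is R (al + be) = w 3
  - w 4.\<close>

definition resB :: "int list \<Rightarrow> int list" where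
  "resB r = ladd (comb r (drop 0 TAB)) (ladd (lmul [0, -4] (comb r (drop 1 TAB)))
     (ladd (lmul [-4, 10] (comb r (drop 2 TAB))) (ladd (lmul [0, 8, -12] (comb r (drop 3 TAB)))
       (lmul [2, -8, 7] (comb r (drop 4 TAB))))))"

definition res_ok :: "nat \<Rightarrow> int list \<Rightarrow> bool" where
  "res_ok k r \<longleftrightarrow> list_all (\<lambda>c. c mod 5 ^ k = 0) (resA r) \<and> list_all (\<lambda>c. c mod 5 ^ k = 0) (resB r)"

text \<open>The classes 1 and 3 of \<open>h\<close> both occur in the class 2 of \<open>(al + be) h\<close> and of
  \<open>(al\<^sup>4 + be\<^sup>4) h\<close>. This linear system for them can be solved because the constant term \<open>- 32\<close> of
  its determinant \<open>al'\<^sup>5 - q\<^sup>3 be'\<^sup>5\<close> is prime to 5.\<close>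

lemma residue_vanish:
  assumes ok: "res_ok k r" and r: "length r \<le> 7" and k: "k \<le> 6" and f: "divis 6 (f - oddspt * ev r)"
  shows "divis k (us 1 f)" "divis k (us 3 f)"
proof -
  have c: "\<forall>c\<in>set (resA r). 5 ^ k dvd c" "\<forall>c\<in>set (resB r). 5 ^ k dvd c"
    using ok by (auto simp: res_ok_def list_all_iff dvd_eq_mod_eq_0)
  \<comment> \<open>This is \<open>oddspt * ev r\<close> times A25. Since A25 is a unit series in
    q^5, it does not mix the residue classes, so f may be replaced by h.\<close>
  define h where "h = psi ^ 4 * (R * ev r)"
  have h0: "divis 0 h" unfolding h_def by (intro divis_mult_left divis_psi4 divis_R divis_ev_0)
  have repk: "divis k g" if "rep g l" "\<forall>c\<in>set l. 5 ^ k dvd c" for g l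
  proof -
    have "divis k ((g - psi ^ 4 * ev l) + psi ^ 4 * ev l)"
      using that k by (intro divis_add divis_mono[of 6 _ k] divis_mult_left divis_psi4 divis_ev) (simp_all add: rep_def)
    thus ?thesis by simp
  qed
  define W where "W m = us 2 (psi ^ 4 * (w m * ev r))" for m
  have W: "rep (W m) (comb r (drop m TAB))" if "m \<le> 4" for m
    unfolding W_def using that r by (intro rep_comb) simp
  have 1: "divis k (us 2 (al * h) + us 2 (be * h))"
  proof -
    have "al * h + be * h = psi ^ 4 * (w 3 * ev r) - psi ^ 4 * (w 4 * ev r)"
      unfolding h_def w_values using S_eq S_R by algebra
    hence "us 2 (al * h) + us 2 (be * h) = W 3 - W 4"
      unfolding W_def by (simp only: us_add[symmetric] us_diff[symmetric])
    moreover have "rep (W 3 + ev [-1] * W 4) (ladd (comb r (drop 3 TAB)) (lmul [-1] (comb r (drop 4 TAB))))"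
      by (intro rep_add rep_mult W) simp_all
    hence "rep (W 3 - W 4) (resA r)"
      by (simp add: resA_def rep_def ev_ladd ev_lsc ev_lmul)
    ultimately show ?thesis using repk c(1) by simp
  qed
  have 2: "divis k (us 2 (al ^ 4 * h) + us 2 (be ^ 4 * h))"
  proof -
    \<comment> \<open>The power sum is symmetric, hence a polynomial in al + be = S - 1 and al be =
      v - 1. The factor y^2 then brings it into the range of the \<open>w i\<close>; after
      extraction it is x^2 and is removed by u^2.\<close>
    have "al ^ 4 + be ^ 4 = (S - 1) ^ 4 - 4 * (v - 1) * (S - 1) ^ 2 + 2 * (v - 1) ^ 2"
      using S_eq al_be by algebra
    moreover have "y ^ 2 * (R * ((S - 1) ^ 4 - 4 * (v - 1) * (S - 1) ^ 2 + 2 * (v - 1) ^ 2)) =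
        w 0 - 4 * (y * w 1) + (10 * (y * w 2) - 4 * w 2) + (8 * (y * w 3) - 12 * (y ^ 2 * w 3))
        + (7 * (y ^ 2 * w 4) - 8 * (y * w 4) + 2 * w 4)" (is "_ = ?D")
      unfolding w_values using u_S S_R v_y by algebra
    ultimately have "y ^ 2 * (R * (al ^ 4 + be ^ 4)) = ?D" by simp
    hence "y ^ 2 * (al ^ 4 * h + be ^ 4 * h) =
        psi ^ 4 * (w 0 * ev r) - 4 * (y * (psi ^ 4 * (w 1 * ev r)))
        + (10 * (y * (psi ^ 4 * (w 2 * ev r))) - 4 * (psi ^ 4 * (w 2 * ev r)))
        + (8 * (y * (psi ^ 4 * (w 3 * ev r))) - 12 * (y ^ 2 * (psi ^ 4 * (w 3 * ev r))))
        + (7 * (y ^ 2 * (psi ^ 4 * (w 4 * ev r))) - 8 * (y * (psi ^ 4 * (w 4 * ev r))) + 2 * (psi ^ 4 * (w 4 * ev r)))" (is "_ = ?E")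
      unfolding h_def by algebra
    hence "us 2 (y ^ 2 * (al ^ 4 * h + be ^ 4 * h)) = us 2 ?E"
      by (rule arg_cong)
    hence e: "x ^ 2 * (us 2 (al ^ 4 * h) + us 2 (be ^ 4 * h)) =
        W 0 - 4 * (x * W 1) + (10 * (x * W 2) - 4 * W 2) + (8 * (x * W 3) - 12 * (x ^ 2 * W 3))
        + (7 * (x ^ 2 * W 4) - 8 * (x * W 4) + 2 * W 4)"
      unfolding us_add us_diff us_numeral us2_y W_def[symmetric] .
    have "rep (W 0 + (ev [0, -4] * W 1 + (ev [-4, 10] * W 2 + (ev [0, 8, -12] * W 3 + ev [2, -8, 7] * W 4))))
        (resB r)" (is "rep ?F _")
      unfolding resB_def by (intro rep_add rep_mult W) simp_all
    hence "divis k ?F" using c(2) by (rule repk)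
    also have "?F = x ^ 2 * (us 2 (al ^ 4 * h) + us 2 (be ^ 4 * h))"
      unfolding e by (simp add: algebra_simps power2_eq_square)
    finally have "divis k (x ^ 2 * (us 2 (al ^ 4 * h) + us 2 (be ^ 4 * h)))" .
    hence "divis k (u ^ 2 * (x ^ 2 * (us 2 (al ^ 4 * h) + us 2 (be ^ 4 * h))))"
      by (rule divis_mult_left[OF divis_power[OF divis_u]])
    moreover have "u ^ 2 * (x ^ 2 * z) = z" for z using u_x by algebra
    ultimately show ?thesis by simp
  qed
  define H1 H3 where "H1 = us 1 h" and "H3 = us 3 h"
  have a1: "us 2 (al * h) = al' * H1"
  proof -
    have "al * h = (al' oo X ^ 5) * (X ^ 1 * h)" by (simp add: al_def mult_ac)
    moreover have "us 2 (X ^ 1 * h) = us 1 h" using us_X_power_mult[of 1 2 h] by simp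
    ultimately show ?thesis using us_compose_mult[of 2 al' "X ^ 1 * h"] by (simp only: H1_def)
  qed
  have a2: "us 2 (be * h) = X * (be' * H3)"
  proof -
    have "be * h = (be' oo X ^ 5) * (X ^ 4 * h)" by (simp add: be_def mult_ac)
    moreover have "us 2 (X ^ 4 * h) = X * us 3 h" using us_X_power_mult'[of 2 4 h] by simp
    ultimately show ?thesis using us_compose_mult[of 2 be' "X ^ 4 * h"] by (simp only: H3_def mult_ac)
  qed
  have a3: "us 2 (al ^ 4 * h) = X * (al' ^ 4 * H3)"
  proof -
    have "al ^ 4 * h = (al' ^ 4 oo X ^ 5) * (X ^ 4 * h)" by (simp add: al_def mult_ac compose_hom power_mult_distrib)
    moreover have "us 2 (X ^ 4 * h) = X * us 3 h" using us_X_power_mult'[of 2 4 h] by simp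
    ultimately show ?thesis using us_compose_mult[of 2 "al' ^ 4" "X ^ 4 * h"] by (simp only: H3_def mult_ac)
  qed
  have a4: "us 2 (be ^ 4 * h) = X ^ 3 * (be' ^ 4 * H1)"
  proof -
    have "be ^ 4 * h = X ^ 16 * ((be' ^ 4 oo X ^ 5) * h)"
      by (simp add: be_def power_mult_distrib compose_hom mult_ac flip: power_mult)
    also have "X ^ 16 = X ^ 15 * X ^ 1" unfolding power_add[symmetric] by (rule arg_cong) simp
    also have "X ^ 15 = X ^ 3 oo X ^ 5" by (simp add: fps_X_power_compose flip: power_mult)
    finally have "be ^ 4 * h = ((X ^ 3 * be' ^ 4) oo X ^ 5) * (X ^ 1 * h)"
      by (simp add: fps_compose_mult_distrib mult_ac)
    moreover have "us 2 (X ^ 1 * h) = us 1 h" using us_X_power_mult[of 1 2 h] by simp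
    ultimately show ?thesis using us_compose_mult[of 2 "X ^ 3 * be' ^ 4" "X ^ 1 * h"]
      by (simp only: H1_def mult_ac)
  qed
  have ab0: "divis 0 al'" "divis 0 be'"
    unfolding al'_def be'_def using divis_theta divis_inverses
    by (auto intro!: divis_mult_left divis_uminus)
  have H0: "divis 0 H1" "divis 0 H3" unfolding H1_def H3_def by (intro divis_us h0)+
  have al0: "al' $ 0 = of_int (-2)"
  proof -
    have "ht1 $ 0 = 1"
    proof -
      have "j = 0" if "7 * tri j + 3 * tri (- j) = 0" for j
        using that abs_le_tri_add[of j] by simp
      hence "{j. 7 * tri j + 3 * tri (- j) = 0} = {0}" by (auto simp: tri_def)
      thus ?thesis by (simp add: ht1_def gf_def par_def)
    qed
    thus ?thesis by (simp add: al'_def numeral_fps_const)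
  qed
  \<comment> \<open>H1 is eliminated from the two relations; the determinant stays in front of X
    H3.\<close>
  have "divis k (al' * (us 2 (al ^ 4 * h) + us 2 (be ^ 4 * h)) - X ^ 3 * (be' ^ 4 * (us 2 (al * h) + us 2 (be * h))))"
    by (intro divis_diff divis_mult_left divis_power divis_X ab0 1 2)
  also have "al' * (us 2 (al ^ 4 * h) + us 2 (be ^ 4 * h)) - X ^ 3 * (be' ^ 4 * (us 2 (al * h) + us 2 (be * h))) =
      X * ((al' ^ 5 - X ^ 3 * be' ^ 5) * H3)"
    unfolding a1 a2 a3 a4 by (simp add: algebra_simps eval_nat_numeral)
  finally have "divis k (X * ((al' ^ 5 - X ^ 3 * be' ^ 5) * H3))" .
  hence g3: "divis k ((al' ^ 5 - X ^ 3 * be' ^ 5) * H3)"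
    by (rule divis_X_mult_cancel)
  have g1: "(al' ^ 5 - X ^ 3 * be' ^ 5) $ 0 = of_int ((-2) ^ 5)"
    by (simp add: fps_power_zeroth al0)
  have g2: "coprime ((-2) ^ 5 :: int) 5" unfolding coprime_power_left_iff by simp
  have "divis 0 (al' ^ 5 - X ^ 3 * be' ^ 5)"
    by (intro divis_diff divis_mult_left divis_power divis_X ab0)
  hence H3: "divis k H3" by (rule divis_cancel[OF _ g1 g2 H0(2) g3])
  have "divis k ((us 2 (al * h) + us 2 (be * h)) - X * (be' * H3))"
    by (intro divis_diff divis_mult_left divis_X ab0 1 H3)
  hence al'_H1: "divis k (al' * H1)" unfolding a1 a2 by simp
  have "coprime (-2 :: int) 5" by simp
  hence H1: "divis k H1"
    by (rule divis_cancel[OF ab0(1) al0 _ H0(1) al'_H1])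
  have "inverse phim = R * inverse A25"
    using inverse_mult_unit unfolding R_def by algebra
  hence o: "oddspt * ev r = (inverse P5 oo X ^ 5) * h"
    unfolding oddspt_eq inverse_A25[symmetric] h_def by (simp only: mult_ac)
  have d: "divis k (us m f)" if m: "m < 5" and hm: "divis k (us m h)" for m
  proof -
    have "divis k (us m (f - oddspt * ev r) + inverse P5 * us m h)"
      by (intro divis_add divis_mult_left divis_inverses hm divis_us[OF divis_mono[OF f k]])
    thus ?thesis unfolding us_diff o us_compose_mult[OF m] by simp
  qed
  show "divis k (us 1 f)" "divis k (us 3 f)"
    using d[of 1] d[of 3] H1 H3 by (simp_all add: H1_def H3_def)
qed

section \<open>The iterates and their polynomials modulo 5^6\<close>

primrec sptser :: "nat \<Rightarrow> complex fps" where
  "sptser 0 = oddspt"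
| "sptser (Suc k) = us 2 (sptser k)"

lemma sptser_nth: "sptser k $ n = of_nat (spt_omega (5 ^ k * (2 * n + 1)))"
proof (induction k arbitrary: n)
  case (Suc k)
  have e: "5 ^ k * (2 * (5 * n + 2) + 1) = 5 ^ Suc k * (2 * n + 1)" by (simp add: algebra_simps)
  have "sptser (Suc k) $ n = sptser k $ (5 * n + 2)" by simp
  thus ?case by (simp only: Suc.IH e)
qed (simp add: oddspt_def)

text \<open>Modulo 5^6, iterate j is the polynomial \<open>el j\<close> times \<open>oddspt\<close>
  for even j and times \<open>godd\<close> for odd j. The lists were computed by \<open>opA\<close>
  and \<open>opB\<close>, which \<open>el_step\<close> verifies; \<open>el8\<close> repeats
  \<open>el6\<close>.\<close>

definition el0 :: "int list" where "el0 = [1]"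
definition el1 :: "int list" where "el1 = [0, 33, 15460, 15150, 10625, 11875, 9375]"
definition el2 :: "int list" where "el2 = [0, 15082, 12720, 6400, 11625, 3125, 6250]"
definition el3 :: "int list" where "el3 = [0, 3068, 5180, 5225, 12125, 9375, 9375]"
definition el4 :: "int list" where "el4 = [0, 5807, 13695, 13650, 12875, 6250, 6250]"
definition el5 :: "int list" where "el5 = [0, 12318, 4430, 14475, 2750, 9375, 9375]"
definition el6 :: "int list" where "el6 = [0, 12682, 1820, 13650, 12875, 6250, 6250]"
definition el7 :: "int list" where "el7 = [0, 2943, 13805, 1975, 2750, 9375, 9375]"
definition el8 :: "int list" where "el8 = [0, 12682, 1820, 13650, 12875, 6250, 6250]"

lemmas el_defs = el0_def el1_def el2_def el3_def el4_def el5_def el6_def el7_def el8_def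

lemma el_step: "opA el0 = el1" "opB el1 = el2" "opA el2 = el3" "opB el3 = el4" "opA el4 = el5"
  "opB el5 = el6" "opA el6 = el7" "opB el7 = el8"
  by code_simp+

lemma sptser_el:
  "divis 6 (sptser 0 - oddspt * ev el0)" "divis 6 (sptser 1 - godd * ev el1)"
  "divis 6 (sptser 2 - oddspt * ev el2)" "divis 6 (sptser 3 - godd * ev el3)"
  "divis 6 (sptser 4 - oddspt * ev el4)" "divis 6 (sptser 5 - godd * ev el5)"
  "divis 6 (sptser 6 - oddspt * ev el6)" "divis 6 (sptser 7 - godd * ev el7)"
  "divis 6 (sptser 8 - oddspt * ev el8)"
proof -
  have s: "sptser 1 = us 2 (sptser 0)" "sptser 2 = us 2 (sptser 1)" "sptser 3 = us 2 (sptser 2)"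
    "sptser 4 = us 2 (sptser 3)" "sptser 5 = us 2 (sptser 4)" "sptser 6 = us 2 (sptser 5)"
    "sptser 7 = us 2 (sptser 6)" "sptser 8 = us 2 (sptser 7)"
    by (simp_all add: eval_nat_numeral)
  have l: "length el0 \<le> 7" "length el1 \<le> 7" "length el2 \<le> 7" "length el3 \<le> 7" "length el4 \<le> 7"
    "length el5 \<le> 7" "length el6 \<le> 7" "length el7 \<le> 7"
    by (simp_all add: el_defs)
  show 0: "divis 6 (sptser 0 - oddspt * ev el0)" by (simp add: el0_def divis_zero)
  show 1: "divis 6 (sptser 1 - godd * ev el1)" using us_oddspt[OF l(1) 0] unfolding s el_step .
  show 2: "divis 6 (sptser 2 - oddspt * ev el2)" using us_godd[OF l(2) 1] unfolding s(2) el_step .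
  show 3: "divis 6 (sptser 3 - godd * ev el3)" using us_oddspt[OF l(3) 2] unfolding s(3) el_step .
  show 4: "divis 6 (sptser 4 - oddspt * ev el4)" using us_godd[OF l(4) 3] unfolding s(4) el_step .
  show 5: "divis 6 (sptser 5 - godd * ev el5)" using us_oddspt[OF l(5) 4] unfolding s(5) el_step .
  show 6: "divis 6 (sptser 6 - oddspt * ev el6)" using us_godd[OF l(6) 5] unfolding s(6) el_step .
  show 7: "divis 6 (sptser 7 - godd * ev el7)" using us_oddspt[OF l(7) 6] unfolding s(7) el_step .
  show "divis 6 (sptser 8 - oddspt * ev el8)" using us_godd[OF l(8) 7] unfolding s(8) el_step .
qed

definition diff_ok :: "nat \<Rightarrow> int list \<Rightarrow> int list \<Rightarrow> bool" where
  "diff_ok k a b \<longleftrightarrow> list_all (\<lambda>c. c mod 5 ^ k = 0) (ladd a (lsc (-1) b))"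

lemma divis_diff_list:
  assumes "divis 6 (f - b * ev l)" "divis 6 (g - b * ev l')" "divis 0 b" "k \<le> 6" "diff_ok k l l'"
  shows "divis k (f - g)"
proof -
  have "divis k (ev (ladd l (lsc (-1) l')))"
    using assms(5) by (intro divis_ev) (auto simp: diff_ok_def list_all_iff dvd_eq_mod_eq_0)
  hence "divis k (b * ev (ladd l (lsc (-1) l')))" by (rule divis_mult_left[OF assms(3)])
  hence "divis k ((f - b * ev l) - (g - b * ev l') + b * ev (ladd l (lsc (-1) l')))"
    by (intro divis_add divis_diff divis_mono[OF assms(1,4)] divis_mono[OF assms(2,4)])
  thus ?thesis by (simp add: ev_ladd ev_lsc algebra_simps)
qed

lemma diff_ok_el: "diff_ok 1 el3 el1" "diff_ok 2 el4 el2" "diff_ok 3 el5 el3" "diff_ok 4 el6 el4"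
  "diff_ok 5 el7 el5" "diff_ok 6 el8 el6"
  by code_simp+

lemma sptser_step: "l \<in> {1, 2, 3, 4, 5, 6} \<Longrightarrow> divis l (sptser (l + 2) - sptser l)"
  using divis_diff_list[OF sptser_el(4) sptser_el(2) divis_godd _ diff_ok_el(1)]
    divis_diff_list[OF sptser_el(5) sptser_el(3) divis_oddspt _ diff_ok_el(2)]
    divis_diff_list[OF sptser_el(6) sptser_el(4) divis_godd _ diff_ok_el(3)]
    divis_diff_list[OF sptser_el(7) sptser_el(5) divis_oddspt _ diff_ok_el(4)]
    divis_diff_list[OF sptser_el(8) sptser_el(6) divis_godd _ diff_ok_el(5)]
    divis_diff_list[OF sptser_el(9) sptser_el(7) divis_oddspt _ diff_ok_el(6)]
  by (auto simp flip: numeral_2_eq_2 simp del: sptser.simps)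

text \<open>Extraction is linear and preserves divisibility, so a congruence between two iterates is
  inherited by all later ones.\<close>

lemma sptser_shift:
  assumes "divis l (sptser (a + 2) - sptser a)"
  shows "divis l (sptser (a + m + 2) - sptser (a + m))"
proof (induction m)
  case (Suc m)
  from divis_us[OF Suc.IH, of 2] show ?case by (simp add: us_diff)
qed (use assms in simp)

lemma sptser_congruence:
  assumes l: "l \<in> {1, 2, 3, 4, 5, 6}"
  shows "divis l (sptser (2 * k + l) - sptser l)"
proof (induction k)
  case (Suc k)
  have "divis l ((sptser (l + 2 * k + 2) - sptser (l + 2 * k)) + (sptser (2 * k + l) - sptser l))"
    by (intro divis_add Suc.IH sptser_shift sptser_step l)
  thus ?case by (simp add: add.commute add.left_commute)
qed (simp add: divis_zero)

lemma res_ok_el: "res_ok 2 el2" "res_ok 4 el4" "res_ok 6 el6"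
  by code_simp+

lemma of_nat_cong:
  assumes "(of_nat a - of_nat b :: complex) / 5 ^ k \<in> \<int>"
  shows "[a = b] (mod 5 ^ k)"
proof -
  obtain z where z: "(of_nat a - of_nat b :: complex) / 5 ^ k = of_int z" using assms by (elim Ints_cases)
  hence "(of_int (int a - int b) :: complex) = of_int (5 ^ k * z)" by (simp add: field_simps)
  hence "int a - int b = 5 ^ k * z" by (simp only: of_int_eq_iff)
  hence "[int a = int b] (mod int (5 ^ k))" by (simp add: cong_iff_dvd_diff)
  thus ?thesis by (simp only: cong_int_iff)
qed

text \<open>The arguments come from 2 (5n + 1) + 1 = 10n + 3 and 2 (5n + 3) + 1 = 10n + 7.\<close>

lemma residue_classes:
  assumes "res_ok k r" "length r \<le> 7" "k \<le> 6" "divis 6 (sptser k - oddspt * ev r)"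
  shows "[spt_omega (5 ^ k * (10 * n + 3)) = 0] (mod 5 ^ k)" "[spt_omega (5 ^ k * (10 * n + 7)) = 0] (mod 5 ^ k)"
proof -
  note d = residue_vanish[OF assms]
  have i: "2 * (5 * n + 1) + 1 = 10 * n + 3" "2 * (5 * n + 3) + 1 = 10 * n + 7" by simp_all
  have "(of_nat (spt_omega (5 ^ k * (2 * (5 * n + m) + 1))) - of_nat 0 :: complex) / 5 ^ k \<in> \<int>"
    if "divis k (us m (sptser k))" for m
    using that by (simp add: divis_def sptser_nth)
  from this[OF d(1), THEN of_nat_cong] this[OF d(2), THEN of_nat_cong]
  show "[spt_omega (5 ^ k * (10 * n + 3)) = 0] (mod 5 ^ k)" "[spt_omega (5 ^ k * (10 * n + 7)) = 0] (mod 5 ^ k)"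
    unfolding i by simp_all
qed

theorem corollary1p9:
  "(\<forall>l::nat \<in> {1, 2, 3, 4, 5, 6}. \<forall>k n :: nat.
      [spt_omega (5 ^ (2 * k + l - 1) * (10 * n + 5)) =
       spt_omega (5 ^ (l - 1) * (10 * n + 5))] (mod 5 ^ l)) \<and>
   (\<forall>n::nat.
      [spt_omega (5 ^ 2 * (10 * n + 3)) = spt_omega (5 ^ 2 * (10 * n + 7))] (mod 5 ^ 2) \<and>
      [spt_omega (5 ^ 2 * (10 * n + 7)) = 0] (mod 5 ^ 2)) \<and>
   (\<forall>n::nat.
      [spt_omega (5 ^ 4 * (10 * n + 3)) = spt_omega (5 ^ 4 * (10 * n + 7))] (mod 5 ^ 4) \<and>
      [spt_omega (5 ^ 4 * (10 * n + 7)) = 0] (mod 5 ^ 4)) \<and>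
   (\<forall>n::nat.
      [spt_omega (5 ^ 6 * (10 * n + 3)) = spt_omega (5 ^ 6 * (10 * n + 7))] (mod 5 ^ 6) \<and>
      [spt_omega (5 ^ 6 * (10 * n + 7)) = 0] (mod 5 ^ 6))"
proof (intro conjI ballI allI)
  fix l k n :: nat
  assume l: "l \<in> {1, 2, 3, 4, 5, 6}"
  \<comment> \<open>The 5 in 10n + 5 = 5 (2n + 1) makes up for the exponent lowered by 1; l >= 1
    keeps the natural subtraction exact.\<close>
  have p: "5 ^ (m + l - 1) * (10 * n + 5) = 5 ^ (m + l) * (2 * n + 1)" for m
  proof -
    have "m + l = Suc (m + l - 1)" using l by auto
    hence "(5 :: nat) ^ (m + l) = 5 * 5 ^ (m + l - 1)" by (metis power_Suc)
    thus ?thesis by (simp add: algebra_simps)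
  qed
  have "(of_nat (spt_omega (5 ^ (2 * k + l) * (2 * n + 1))) - of_nat (spt_omega (5 ^ l * (2 * n + 1))) :: complex) / 5 ^ l \<in> \<int>"
    using sptser_congruence[OF l, of k] unfolding divis_def fps_sub_nth sptser_nth by blast
  thus "[spt_omega (5 ^ (2 * k + l - 1) * (10 * n + 5)) = spt_omega (5 ^ (l - 1) * (10 * n + 5))] (mod 5 ^ l)"
    unfolding p using p[of 0] by (simp add: of_nat_cong)
next
  fix n :: nat
  have len: "length el2 \<le> 7" "length el4 \<le> 7" "length el6 \<le> 7" by (simp_all add: el_defs)
  note r2 = residue_classes[OF res_ok_el(1) len(1) _ sptser_el(3), of n]
  note r4 = residue_classes[OF res_ok_el(2) len(2) _ sptser_el(5), of n]
  note r6 = residue_classes[OF res_ok_el(3) len(3) _ sptser_el(7), of n]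
  show "[spt_omega (5 ^ 2 * (10 * n + 7)) = 0] (mod 5 ^ 2)" by (rule r2) simp
  show "[spt_omega (5 ^ 2 * (10 * n + 3)) = spt_omega (5 ^ 2 * (10 * n + 7))] (mod 5 ^ 2)"
    by (rule cong_trans[OF r2(1) cong_sym[OF r2(2)]]) simp_all
  show "[spt_omega (5 ^ 4 * (10 * n + 7)) = 0] (mod 5 ^ 4)" by (rule r4) simp
  show "[spt_omega (5 ^ 4 * (10 * n + 3)) = spt_omega (5 ^ 4 * (10 * n + 7))] (mod 5 ^ 4)"
    by (rule cong_trans[OF r4(1) cong_sym[OF r4(2)]]) simp_all
  show "[spt_omega (5 ^ 6 * (10 * n + 7)) = 0] (mod 5 ^ 6)" by (rule r6) simp
  show "[spt_omega (5 ^ 6 * (10 * n + 3)) = spt_omega (5 ^ 6 * (10 * n + 7))] (mod 5 ^ 6)"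
    by (rule cong_trans[OF r6(1) cong_sym[OF r6(2)]]) simp_all
qed

end
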